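(* Every path-friendship graph is determined by its Laplacian spectrum (DLS); that is, if $G$ is a path-friendship graph and $H$ is any graph whose Laplacian matrix has the same multiset of eigenvalues as that of $G$, then $H$ is isomorphic to $G$.
   Context: All graphs are finite and simple. The Laplacian matrix of a graph is $L(G)=D(G)-A(G)$, where $A(G)$ is the adjacency matrix and $D(G)$ the diagonal matrix of vertex degrees. The friendship graph $F_s$ consists of $s$ triangles sharing exactly one common vertex (its center). A starlike tree is obtained by identifying one endpoint of each of several paths into a single vertex (its root). A path-friendship graph is obtained by identifying the center of a friendship graph $F_s$ with the root of a starlike tree; equivalently, it consists of $s$ triangles and $k$ pendant paths (of arbitrary lengths $t_1,\dots,t_k\ge 1$) all sharing one common vertex. *)

theory Defs
  imports
    "Graph_Theory.Graph_Theory"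
    "Jordan_Normal_Form.Char_Poly"
begin

text \<open>
  Finite simple graphs are the library's \<^const>\<open>pair_graph\<close>s: a finite vertex set together with
  a symmetric irreflexive set of ordered pairs of vertices, so that an undirected edge
  \<open>{u, v}\<close> is the pair of arcs \<open>(u, v)\<close>, \<open>(v, u)\<close>, and the degree of a vertex is its out-degree.
\<close>

subsection \<open>Laplacian matrix and Laplacian spectrum\<close>

text \<open>Matrices are indexed by positions in a list \<open>vs\<close> that enumerates the vertices.\<close>

definition adjacency_mat :: "'a pair_pre_digraph \<Rightarrow> 'a list \<Rightarrow> real mat" where
  "adjacency_mat G vs = mat (length vs) (length vs)
     (\<lambda>(i, j). if (vs ! i, vs ! j) \<in> parcs G then 1 else 0)"

definition degree_mat :: "'a pair_pre_digraph \<Rightarrow> 'a list \<Rightarrow> real mat" where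
  "degree_mat G vs = mat (length vs) (length vs)
     (\<lambda>(i, j). if i = j then real (out_degree (with_proj G) (vs ! i)) else 0)"

definition laplacian_mat :: "'a pair_pre_digraph \<Rightarrow> 'a list \<Rightarrow> real mat" where
  "laplacian_mat G vs = degree_mat G vs - adjacency_mat G vs"

definition vertex_enum :: "'a pair_pre_digraph \<Rightarrow> 'a list" where
  "vertex_enum G = (SOME vs. distinct vs \<and> set vs = pverts G)"

text \<open>
  Eigenvalues are counted with algebraic multiplicity. The Laplacian matrix is real symmetric,
  so no eigenvalue is lost by taking only real roots of the characteristic polynomial.
\<close>

definition laplacian_spectrum :: "'a pair_pre_digraph \<Rightarrow> real multiset" where
  "laplacian_spectrum G = proots (char_poly (laplacian_mat G (vertex_enum G)))"

text \<open>The spectrum does not depend on the chosen enumeration.\<close>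

lemma char_poly_mat_reindex:
  fixes f :: "'a \<Rightarrow> 'a \<Rightarrow> 'b :: comm_ring_1"
  assumes vs: "distinct vs" and ws: "distinct ws" and eq: "set vs = set ws"
  shows "char_poly (mat (length vs) (length vs) (\<lambda>(i, j). f (vs ! i) (vs ! j))) =
         char_poly (mat (length ws) (length ws) (\<lambda>(i, j). f (ws ! i) (ws ! j)))"
proof -
  let ?n = "length vs"
  have len: "length ws = ?n"
    using vs ws eq by (metis distinct_card)
  define A where "A = mat ?n ?n (\<lambda>(i, j). f (vs ! i) (vs ! j))"
  define B where "B = mat ?n ?n (\<lambda>(i, j). f (ws ! i) (ws ! j))"
  define P where "P = mat ?n ?n (\<lambda>(i, j). if vs ! i = ws ! j then 1 else 0 :: 'b)"
  define Q where "Q = mat ?n ?n (\<lambda>(i, j). if ws ! i = vs ! j then 1 else 0 :: 'b)"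
  have carr: "A \<in> carrier_mat ?n ?n" "B \<in> carrier_mat ?n ?n"
      "P \<in> carrier_mat ?n ?n" "Q \<in> carrier_mat ?n ?n"
    by (auto simp: A_def B_def P_def Q_def)
  have collapse: "(\<Sum>k\<in>{0..<length us}. g (us ! k) * (if us ! k = v then 1 else 0)) = g v"
    "(\<Sum>k\<in>{0..<length us}. (if us ! k = v then 1 else 0) * g (us ! k)) = g v"
    if us: "distinct us" "v \<in> set us" for g :: "'a \<Rightarrow> 'b" and us v
  proof -
    have "(\<Sum>k\<in>{0..<length us}. h (us ! k)) = (\<Sum>u\<in>set us. h u)" for h :: "'a \<Rightarrow> 'b"
      using us(1) by (intro sum.reindex_bij_betw)
        (simp add: bij_betw_nth atLeast0LessThan)
    from this[of "\<lambda>u. g u * (if u = v then 1 else 0)"]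
      this[of "\<lambda>u. (if u = v then 1 else 0) * g u"] us(2)
    show "(\<Sum>k\<in>{0..<length us}. g (us ! k) * (if us ! k = v then 1 else 0)) = g v"
      "(\<Sum>k\<in>{0..<length us}. (if us ! k = v then 1 else 0) * g (us ! k)) = g v"
      by (simp_all add: if_distrib[of "\<lambda>x. _ * x"] if_distrib[of "\<lambda>x. x * _"] cong: if_cong)
  qed
  have mem: "vs ! i \<in> set vs" "vs ! i \<in> set ws" "ws ! i \<in> set vs" "ws ! i \<in> set ws" if "i < ?n" for i
    using that len eq by (metis nth_mem)+
  have PQ: "P * Q = 1\<^sub>m ?n"
  proof (intro eq_matI)
    fix i j assume ij: "i < dim_row (1\<^sub>m ?n :: 'b mat)" "j < dim_col (1\<^sub>m ?n :: 'b mat)"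
    have "(P * Q) $$ (i, j) = (\<Sum>k\<in>{0..<length ws}. (if ws ! k = vs ! i then 1 else 0) *
        (if ws ! k = vs ! j then 1 else 0))"
      using ij len by (auto simp: P_def Q_def scalar_prod_def intro!: sum.cong)
    also have "\<dots> = (if vs ! i = vs ! j then 1 else 0)"
      using collapse(2)[OF ws mem(2), of i "\<lambda>u. if u = vs ! j then 1 else 0"] ij by simp
    also have "\<dots> = 1\<^sub>m ?n $$ (i, j)"
      using ij vs by (simp add: nth_eq_iff_index_eq)
    finally show "(P * Q) $$ (i, j) = 1\<^sub>m ?n $$ (i, j)" .
  qed (simp_all add: P_def Q_def)
  have QP: "Q * P = 1\<^sub>m ?n"
  proof (intro eq_matI)
    fix i j assume ij: "i < dim_row (1\<^sub>m ?n :: 'b mat)" "j < dim_col (1\<^sub>m ?n :: 'b mat)"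
    have "(Q * P) $$ (i, j) = (\<Sum>k\<in>{0..<length vs}. (if vs ! k = ws ! i then 1 else 0) *
        (if vs ! k = ws ! j then 1 else 0))"
      using ij by (auto simp: P_def Q_def scalar_prod_def intro!: sum.cong)
    also have "\<dots> = (if ws ! i = ws ! j then 1 else 0)"
      using collapse(2)[OF vs mem(3), of i "\<lambda>u. if u = ws ! j then 1 else 0"] ij by simp
    also have "\<dots> = 1\<^sub>m ?n $$ (i, j)"
      using ij ws len by (simp add: nth_eq_iff_index_eq)
    finally show "(Q * P) $$ (i, j) = 1\<^sub>m ?n $$ (i, j)" .
  qed (simp_all add: P_def Q_def)
  have PB: "P * B = mat ?n ?n (\<lambda>(i, j). f (vs ! i) (ws ! j))"
  proof (intro eq_matI)
    fix i j assume ij: "i < dim_row (mat ?n ?n (\<lambda>(i, j). f (vs ! i) (ws ! j)))"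
      "j < dim_col (mat ?n ?n (\<lambda>(i, j). f (vs ! i) (ws ! j)))"
    have "(P * B) $$ (i, j) =
        (\<Sum>k\<in>{0..<length ws}. (if ws ! k = vs ! i then 1 else 0) * f (ws ! k) (ws ! j))"
      using ij len by (auto simp: P_def B_def scalar_prod_def intro!: sum.cong)
    also have "\<dots> = f (vs ! i) (ws ! j)"
      using collapse(2)[OF ws mem(2), of i "\<lambda>u. f u (ws ! j)"] ij by simp
    finally show "(P * B) $$ (i, j) = mat ?n ?n (\<lambda>(i, j). f (vs ! i) (ws ! j)) $$ (i, j)"
      using ij by simp
  qed (simp_all add: P_def B_def)
  have PBQ: "P * B * Q = A"
  proof (intro eq_matI)
    fix i j assume ij: "i < dim_row A" "j < dim_col A"
    have "(P * B * Q) $$ (i, j) =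
        (\<Sum>k\<in>{0..<length ws}. f (vs ! i) (ws ! k) * (if ws ! k = vs ! j then 1 else 0))"
      using ij len by (auto simp: PB A_def Q_def scalar_prod_def intro!: sum.cong)
    also have "\<dots> = f (vs ! i) (vs ! j)"
      using collapse(1)[OF ws mem(2), of j "\<lambda>u. f (vs ! i) u"] ij by (simp add: A_def)
    finally show "(P * B * Q) $$ (i, j) = A $$ (i, j)"
      using ij by (simp add: A_def)
  qed (simp_all add: P_def A_def Q_def)
  have "similar_mat A B"
    unfolding similar_mat_def similar_mat_wit_def using carr PQ QP PBQ
    by (intro exI[of _ P] exI[of _ Q]) (auto simp: Let_def)
  then show ?thesis
    using char_poly_similar len by (simp add: A_def B_def)
qed

lemma laplacian_spectrum_eq:
  assumes "distinct vs" "set vs = pverts G"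
  shows "laplacian_spectrum G = proots (char_poly (laplacian_mat G vs))"
proof -
  let ?f = "\<lambda>u v. (if u = v then real (out_degree (with_proj G) u) else 0) -
      (if (u, v) \<in> parcs G then 1 else 0)"
  have L: "laplacian_mat G us = mat (length us) (length us) (\<lambda>(i, j). ?f (us ! i) (us ! j))"
    if "distinct us" for us
    using that by (intro eq_matI)
      (auto simp: laplacian_mat_def degree_mat_def adjacency_mat_def nth_eq_iff_index_eq)
  have enum: "distinct (vertex_enum G) \<and> set (vertex_enum G) = pverts G"
    unfolding vertex_enum_def by (rule someI[of _ vs]) (use assms in simp)
  then show ?thesis
    using char_poly_mat_reindex[of "vertex_enum G" vs ?f] assms
    by (simp add: laplacian_spectrum_def L)
qed

subsection \<open>Path-friendship graphs\<close>

text \<open>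
  The standard model with \<open>s\<close> triangles and one pendant path for each entry of \<open>ts\<close>, the entry
  being the number of edges of the path. Triangle \<open>i\<close> has vertices \<open>Center\<close>, \<open>Tri i False\<close>,
  \<open>Tri i True\<close>; path \<open>i\<close> runs through \<open>Center\<close>, \<open>Pth i 0\<close>, \<dots>, \<open>Pth i (ts ! i - 1)\<close>.
\<close>

datatype pf_vertex = Center | Tri nat bool | Pth nat nat

definition pf_verts :: "nat \<Rightarrow> nat list \<Rightarrow> pf_vertex set" where
  "pf_verts s ts = {Center} \<union> {Tri i b | i b. i < s}
     \<union> {Pth i j | i j. i < length ts \<and> j < ts ! i}"

definition pf_edges :: "nat \<Rightarrow> nat list \<Rightarrow> (pf_vertex \<times> pf_vertex) set" where
  "pf_edges s ts =
       {(Center, Tri i b) | i b. i < s}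
     \<union> {(Tri i False, Tri i True) | i. i < s}
     \<union> {(Center, Pth i 0) | i. i < length ts \<and> 0 < ts ! i}
     \<union> {(Pth i j, Pth i (Suc j)) | i j. i < length ts \<and> Suc j < ts ! i}"

definition pf_graph :: "nat \<Rightarrow> nat list \<Rightarrow> pf_vertex pair_pre_digraph" where
  "pf_graph s ts = \<lparr>pverts = pf_verts s ts, parcs = pf_edges s ts \<union> (pf_edges s ts)\<inverse>\<rparr>"

text \<open>
  No lower bound is imposed on the number of triangles or of paths, so friendship graphs and
  starlike trees themselves are included as the cases \<open>ts = []\<close> and \<open>s = 0\<close>.
\<close>

definition path_friendship_graph :: "'a pair_pre_digraph \<Rightarrow> bool" where
  "path_friendship_graph G \<longleftrightarrow> pair_graph G \<and>
     (\<exists>s ts. (\<forall>t \<in> set ts. 1 \<le> t) \<and> digraph_iso (with_proj (pf_graph s ts)) (with_proj G))"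

lemma pair_graph_pf_graph: "pair_graph (pf_graph s ts)"
proof -
  have "{Tri i b | i b. i < s} = (\<lambda>(i, b). Tri i b) ` ({..<s} \<times> UNIV)"
    by auto
  moreover have "{Pth i j | i j. i < length ts \<and> j < ts ! i} =
      (\<lambda>(i, j). Pth i j) ` (SIGMA i:{..<length ts}. {..<ts ! i})"
    by auto
  ultimately have fin: "finite (pf_verts s ts)"
    by (simp add: pf_verts_def)
  have sub: "pf_edges s ts \<subseteq> pf_verts s ts \<times> pf_verts s ts"
    by (auto simp: pf_edges_def pf_verts_def)
  then have "finite (pf_edges s ts)"
    using fin finite_subset by blast
  moreover have "(u, u) \<notin> pf_edges s ts" for u
    by (auto simp: pf_edges_def)
  ultimately show ?thesis
    using fin sub
    by unfold_locales
      (auto simp: pf_graph_def symmetric_def arcs_ends_def arc_to_ends_def intro!: symI)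
qed

end

theory Submission
  imports Defs
begin

text \<open>
  Let \<open>P\<close> be a path-friendship graph with \<open>s\<close> triangles and \<open>k\<close> paths, so that its center has degree
  \<open>\<Delta> = 2s + k\<close>, and let \<open>H\<close> be cospectral to \<open>P\<close>. The multiplicity of the eigenvalue 0 shows that \<open>H\<close> is
  connected. On the hyperplane of vectors vanishing at the center of \<open>P\<close> the Laplacian form is smaller
  than 4, so at most one eigenvalue is at least 4; two vertices of degree at least 4 in \<open>H\<close> would give
  two such eigenvalues. Let \<open>\<Delta>'\<close> be the largest degree of \<open>H\<close>; all other degrees are then at most 3.

  The traces of \<open>L\<close>, \<open>L\<^sup>2\<close> and \<open>L\<^sup>3\<close> now force \<open>\<Delta>' = \<Delta>\<close>, no vertices of degree 3 besides the center, and
  \<open>s\<close> triangles, unless \<open>\<Delta> = 4\<close>, \<open>\<Delta>' = 3\<close> and \<open>H\<close> has \<open>s - 1\<close> triangles. In the latter case, either \<open>s = 1\<close>,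
  and \<open>H\<close> is unicyclic with three spanning trees but without triangles; or \<open>s = 2\<close>, and the order 5 is an
  eigenvalue of \<open>P\<close> but not of \<open>H\<close>. Both are impossible.

  A connected graph in which all vertices but one have degree at most 2, with cyclomatic number \<open>s\<close> and
  \<open>s\<close> triangles, is a path-friendship graph (remove leaves until a friendship graph remains). Finally, for
  \<open>\<Delta> \<ge> 3\<close> the path lengths are read off the characteristic polynomial after substituting
  \<open>x = 2 + q + 1/q\<close>.
\<close>

subsection \<open>Matrices and determinants indexed by finite sets\<close>

text \<open>Cospectrality relates eigenvalues but not vertices. Three kinds of information cross it:
  traces of powers, which see only degrees and triangles; the number of eigenvalues above a
  threshold, tested by explicit vectors in the quadratic form; and the determinant of
  \<open>x I - L\<close>, which carries the path lengths and, divided by \<open>x\<close> near 0,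
  the number of spanning trees.

  The threshold 4 fits both sides: comparison with the signless form bounds the Laplacian form
  strictly below 4 where only degrees at most 2 matter, whereas four neighbours already support a
  vector on which the form reaches 4.

  The exception \<open>\<Delta> = 4\<close> arises because raising the center degree from
  \<open>m\<close> to \<open>m + 1\<close> changes the cubic degree sum by
  \<open>3 (m - 1) (m - 2)\<close>, which missing triangles must balance. There are at most
  \<open>(m + 1) / 2\<close> of them, which is enough only for \<open>m \<le> 3\<close>, and at
  \<open>m = 3\<close> exactly one is missing. The length argument rests on a coefficient with the
  factor \<open>\<Delta> - 2\<close>; the graphs with \<open>\<Delta> \<le> 2\<close> are paths and
  one triangle and are treated directly.\<close>

definition fmat :: "'a list \<Rightarrow> ('a \<Rightarrow> 'a \<Rightarrow> real) \<Rightarrow> real mat" where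
  "fmat vs f = mat (length vs) (length vs) (\<lambda>(i, j). f (vs ! i) (vs ! j))"

definition fmul :: "'a set \<Rightarrow> ('a \<Rightarrow> 'a \<Rightarrow> real) \<Rightarrow> ('a \<Rightarrow> 'a \<Rightarrow> real) \<Rightarrow> 'a \<Rightarrow> 'a \<Rightarrow> real" where
  "fmul V f g u v = (\<Sum>w\<in>V. f u w * g w v)"

text \<open>Indexing by a set instead of positions lets a vertex be deleted or split off as
  \<open>V - {r}\<close> or \<open>insert v U\<close>. The enumeration is arbitrary;
  \<open>fdet_eq\<close> makes its choice irrelevant.\<close>

definition fdet :: "'a set \<Rightarrow> ('a \<Rightarrow> 'a \<Rightarrow> real) \<Rightarrow> real" where
  "fdet V f = det (fmat (SOME vs. distinct vs \<and> set vs = V) f)"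

abbreviation charmat :: "real \<Rightarrow> ('a \<Rightarrow> 'a \<Rightarrow> real) \<Rightarrow> 'a \<Rightarrow> 'a \<Rightarrow> real" where
  "charmat x f \<equiv> \<lambda>u v. (if u = v then x else 0) - f u v"

lemma fmat_carrier [simp]: "fmat vs f \<in> carrier_mat (length vs) (length vs)"
  by (simp add: fmat_def)

lemma sum_nth_distinct:
  assumes "distinct vs"
  shows "(\<Sum>k\<in>{0..<length vs}. h (vs ! k)) = (\<Sum>v\<in>set vs. h v)"
  using assms by (intro sum.reindex_bij_betw) (simp add: bij_betw_nth atLeast0LessThan)

lemma fmat_mult: "distinct vs \<Longrightarrow> fmat vs f * fmat vs g = fmat vs (fmul (set vs) f g)"
  by (rule eq_matI)
    (auto simp: fmat_def fmul_def scalar_prod_def sum_nth_distinct[of vs "\<lambda>w. f _ w * g w _"])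

lemma fmat_cong:
  "(\<And>u v. u \<in> set vs \<Longrightarrow> v \<in> set vs \<Longrightarrow> f u v = g u v) \<Longrightarrow> fmat vs f = fmat vs g"
  by (rule eq_matI) (auto simp: fmat_def)

lemma fmat_one: "distinct vs \<Longrightarrow> fmat vs (\<lambda>u v. if u = v then 1 else 0) = 1\<^sub>m (length vs)"
  by (rule eq_matI) (auto simp: fmat_def nth_eq_iff_index_eq)

lemma poly_char_poly_fmat:
  assumes "distinct vs"
  shows "poly (char_poly (fmat vs f)) x = det (fmat vs (charmat x f))"
proof -
  have "- char_matrix (fmat vs f) x = fmat vs (charmat x f)"
    using assms by (intro eq_matI) (auto simp: char_matrix_def fmat_def nth_eq_iff_index_eq)
  then show ?thesis using char_poly_matrix[OF fmat_carrier] by metis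
qed

lemma fdet_eq:
  assumes "distinct vs" "set vs = V"
  shows "fdet V f = det (fmat vs f)"
proof -
  define ws where "ws = (SOME vs. distinct vs \<and> set vs = V)"
  have ws: "distinct ws \<and> set ws = V"
    unfolding ws_def by (rule someI[of _ vs]) (use assms in simp)
  \<comment> \<open>Independence of the enumeration is known for characteristic polynomials; a
    determinant is the value at 0 of that of the negated matrix.\<close>
  have eq: "det (fmat us f) = poly (char_poly (fmat us (\<lambda>u v. - f u v))) 0" if "distinct us" for us
    by (subst poly_char_poly_fmat[OF that]) (simp add: fmat_def)
  have "char_poly (fmat ws (\<lambda>u v. - f u v)) = char_poly (fmat vs (\<lambda>u v. - f u v))"
    unfolding fmat_def by (rule char_poly_mat_reindex) (use ws assms in auto)
  then show ?thesis
    using eq[of ws] eq[of vs] ws assms by (simp add: fdet_def ws_def)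
qed

lemma fdet_cong:
  assumes "finite V" "\<And>u v. u \<in> V \<Longrightarrow> v \<in> V \<Longrightarrow> f u v = g u v"
  shows "fdet V f = fdet V g"
proof -
  obtain vs where vs: "distinct vs" "set vs = V" using assms(1) finite_distinct_list by metis
  then show ?thesis using fmat_cong[of vs f g] assms(2) by (simp add: fdet_eq)
qed

lemma fdet_empty [simp]: "fdet {} f = 1"
  using fdet_eq[of "[]" "{}" f] by (simp add: fmat_def det_dim_zero)

lemma fdet_one: "finite V \<Longrightarrow> fdet V (\<lambda>u v. if u = v then 1 else 0) = 1"
  by (metis det_one fdet_eq finite_distinct_list fmat_one)

lemma fdet_mult: "finite V \<Longrightarrow> fdet V (fmul V f g) = fdet V f * fdet V g"
  by (metis det_mult fdet_eq finite_distinct_list fmat_carrier fmat_mult)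

lemma fdet_transpose: 
  assumes "finite V" shows "fdet V (\<lambda>u v. f v u) = fdet V f"
proof -
  obtain vs where vs: "distinct vs" "set vs = V" using assms(1) finite_distinct_list by metis
  have "fmat vs (\<lambda>u v. f v u) = transpose_mat (fmat vs f)"
    by (rule eq_matI) (auto simp: fmat_def)
  then show ?thesis using vs by (simp add: fdet_eq det_transpose[OF fmat_carrier])
qed

lemma fdet_uminus: 
  assumes "finite V" shows "fdet V (\<lambda>u v. - f u v) = (-1) ^ card V * fdet V f"
proof -
  obtain vs where vs: "distinct vs" "set vs = V" using assms(1) finite_distinct_list by metis
  have "fmat vs (\<lambda>u v. - f u v) = (-1) \<cdot>\<^sub>m fmat vs f"
    by (rule eq_matI) (auto simp: fmat_def)
  then show ?thesis using vs distinct_card[of vs]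
    by (simp add: fdet_eq det_smult) (simp add: fmat_def)
qed

lemma fdet_insert_zero_col:
  assumes U: "finite U" "v \<notin> U" and zero: "\<And>a. a \<in> U \<Longrightarrow> f a v = 0"
  shows "fdet (insert v U) f = f v v * fdet U f"
proof -
  obtain us where us: "distinct us" "set us = U" using assms(1) finite_distinct_list by metis
  have "fmat (v # us) f = four_block_mat (mat 1 1 (\<lambda>_. f v v))
      (mat 1 (length us) (\<lambda>(_, j). f v (us ! j))) (0\<^sub>m (length us) 1) (fmat us f)"
    using us(2) zero
    by (intro eq_matI) (auto simp: fmat_def nth_Cons' less_Suc_eq_0_disj)
  then have "det (fmat (v # us) f) = det (mat 1 1 (\<lambda>_. f v v)) * det (fmat us f)"
    by (simp add: det_four_block_mat_lower_left_zero_col[of _ _ "length us"])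
  also have "det (mat 1 1 (\<lambda>_. f v v)) = f v v"
    by (subst det_single) auto
  finally show ?thesis
    using us U fdet_eq[of "v # us" "insert v U" f] by (simp add: fdet_eq)
qed

text \<open>One step of Gaussian elimination, written as \<open>f = l g\<close>: \<open>l\<close> is
  unipotent and stores the multipliers \<open>f a v / f v v\<close>, and \<open>g\<close> has column
  \<open>v\<close> cleared off the pivot. Paths, triangles and the eigenvalue 0 are all eliminated
  in this way.\<close>

lemma fdet_schur:
  assumes U: "finite U" "v \<notin> U" and nz: "f v v \<noteq> 0"
  shows "fdet (insert v U) f = f v v * fdet U (\<lambda>a b. f a b - f a v * f v b / f v v)"
proof -
  define l where "l a b = (if a = b then 1 else if b = v then f a v / f v v else 0)" for a b
  define g where "g a b = (if a = v then f v b else if b = v then 0 else f a b - f a v * f v b / f v v)" for a b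
  let ?V = "insert v U"
  have fin: "finite ?V" using U by simp
  have prod: "fmul ?V l g a b = f a b" if "a \<in> ?V" "b \<in> ?V" for a b
  proof (cases "a = v")
    case True
    then have "fmul ?V l g a b = l v v * g v b + (\<Sum>w\<in>U. l v w * g w b)"
      using U by (simp add: fmul_def)
    also have "(\<Sum>w\<in>U. l v w * g w b) = 0" using U by (intro sum.neutral) (auto simp: l_def)
    also have "l v v * g v b + 0 = f v b" by (simp add: l_def g_def)
    finally show ?thesis using True by simp
  next
    case False
    then have "fmul ?V l g a b = l a v * g v b + (\<Sum>w\<in>U. l a w * g w b)"
      using U by (simp add: fmul_def)
    also have "(\<Sum>w\<in>U. l a w * g w b) = (\<Sum>w\<in>U. if a = w then g a b else 0)" 
      using U by (intro sum.cong) (auto simp: l_def)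
    also have "\<dots> = g a b" using U that False by simp
    also have "l a v * g v b + g a b = f a b" using False nz by (simp add: l_def g_def)
    finally show ?thesis .
  qed
  have "fdet ?V f = fdet ?V l * fdet ?V g"
    using fdet_cong[OF fin prod] fdet_mult[OF fin, of l g] by simp
  \<comment> \<open>\<open>l\<close> has its zeros in row \<open>v\<close>, while
    \<open>fdet_insert_zero_col\<close> expects them in column \<open>v\<close>.\<close>
  also have "fdet ?V l = fdet ?V (\<lambda>a b. l b a)" using fdet_transpose[OF fin, of l] by simp
  also have "\<dots> = fdet U (\<lambda>a b. l b a)"
    using U by (subst fdet_insert_zero_col) (auto simp: l_def)
  also have "\<dots> = fdet U (\<lambda>u v. if u = v then 1 else 0)"
    using U by (intro fdet_cong) (auto simp: l_def)
  also have "\<dots> = 1" using U fdet_one by blast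
  also have "fdet ?V g = f v v * fdet U g"
    using U by (subst fdet_insert_zero_col) (auto simp: g_def)
  also have "fdet U g = fdet U (\<lambda>a b. f a b - f a v * f v b / f v v)"
    using U by (intro fdet_cong) (auto simp: g_def)
  finally show ?thesis by simp
qed

text \<open>Both operations are multiplications by the unipotent matrix \<open>E\<close> with a row
  of ones at \<open>r\<close>: the right-hand side is \<open>E f E^T\<close>. For constant row sums
  this exposes the eigenvalue of the all-ones vector in row and column \<open>r\<close>.\<close>

lemma fdet_add_rows_cols:
  assumes V: "finite V" "r \<in> V"
  shows "fdet V f = fdet V (\<lambda>u v. if u = r then (if v = r then \<Sum>a\<in>V. \<Sum>b\<in>V. f a b else \<Sum>a\<in>V. f a v)
      else if v = r then \<Sum>b\<in>V. f u b else f u v)" (is "_ = fdet V ?g")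
proof -
  define E where "E a b = (if a = b \<or> a = r then 1 else 0 :: real)" for a b
  obtain U where U: "V = insert r U" "r \<notin> U" "finite U"
    using V by (metis finite_insert mk_disjoint_insert)
  have "fdet V E = E r r * fdet U E"
    unfolding U(1) using U by (intro fdet_insert_zero_col) (auto simp: E_def)
  also have "fdet U E = fdet U (\<lambda>u v. if u = v then 1 else 0)"
    using U by (intro fdet_cong) (auto simp: E_def)
  also have "\<dots> = 1" by (rule fdet_one[OF U(3)])
  also have "E r r * 1 = 1" by (simp add: E_def)
  finally have E: "fdet V E = 1" .
  have l: "fmul V E h a b = (if a = r then \<Sum>w\<in>V. h w b else h a b)" if "a \<in> V" for a b h
    using V(1) that by (auto simp: fmul_def E_def intro!: sum.cong)
     (simp add: if_distrib[of "\<lambda>x. x * _"] cong: if_cong)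
  have r: "fmul V h (\<lambda>a b. E b a) a b = (if b = r then \<Sum>w\<in>V. h a w else h a b)" if "b \<in> V" for a b h
    using V(1) that by (auto simp: fmul_def E_def intro!: sum.cong)
     (simp add: if_distrib[of "\<lambda>x. _ * x"] cong: if_cong)
  have "fdet V ?g = fdet V (fmul V (fmul V E f) (\<lambda>a b. E b a))"
    using V by (intro fdet_cong) (auto simp: l r intro: sum.swap)
  also have "\<dots> = fdet V f" 
    using V E fdet_transpose[of V E] by (simp add: fdet_mult)
  finally show ?thesis by simp
qed


text \<open>A complex eigenvector \<open>x + i y\<close> exists because the characteristic
  polynomial splits over the complex numbers. Evaluating \<open>y^T f x\<close> in two ways by
  symmetry gives \<open>Im a * (|x|^2 + |y|^2) = 0\<close>, so the eigenvalue is real and whichever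
  of \<open>x\<close>, \<open>y\<close> is nonzero is a real eigenvector.\<close>

lemma symmetric_eigenpair:
  assumes V: "finite V" "V \<noteq> {}" and sym: "\<And>u v. u \<in> V \<Longrightarrow> v \<in> V \<Longrightarrow> f u v = f v u"
  shows "\<exists>l x. (\<exists>u\<in>V. x u \<noteq> 0) \<and> (\<forall>u\<in>V. (\<Sum>v\<in>V. f u v * x v) = l * (x u :: real))"
proof -
  obtain vs where vs: "distinct vs" "set vs = V" using V(1) finite_distinct_list by metis
  define n where "n = length vs"
  have n: "n > 0" using vs V(2) by (cases vs) (auto simp: n_def)
  define A where "A = map_mat complex_of_real (fmat vs f)"
  have A: "A \<in> carrier_mat n n" by (simp add: A_def n_def)
  obtain as where as: "char_poly A = (\<Prod>a\<leftarrow>as. [:- a, 1:])" "length as = n"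
    using char_poly_factorized[OF A] by blast
  then obtain a as' where "as = a # as'" using n by (cases as) auto
  then have "eigenvalue A a" using as(1) by (simp add: eigenvalue_root_char_poly[OF A])
  then obtain z where z: "z \<in> carrier_vec n" "z \<noteq> 0\<^sub>v n" "A *\<^sub>v z = a \<cdot>\<^sub>v z"
    using A by (auto simp: eigenvalue_def eigenvector_def)
  define idx where "idx = the_inv_into {0..<n} ((!) vs)"
  have bij: "bij_betw ((!) vs) {0..<n} V"
    using vs by (simp add: bij_betw_nth n_def atLeast0LessThan)
  have idx: "idx (vs ! i) = i" if "i < n" for i
    using that bij by (auto simp: idx_def bij_betw_def intro!: the_inv_into_f_f)
  define x where "x v = Re (z $ idx v)" for v
  define y where "y v = Im (z $ idx v)" for v
  have eig: "(\<Sum>v\<in>V. complex_of_real (f u v) * (z $ idx v)) = a * (z $ idx u)" if uV: "u \<in> V" for u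
  proof -
    obtain i where i: "i < n" "u = vs ! i" using uV vs by (metis in_set_conv_nth n_def)
    have "(\<Sum>v\<in>V. complex_of_real (f u v) * (z $ idx v)) =
        (\<Sum>k\<in>{0..<n}. complex_of_real (f u (vs ! k)) * (z $ idx (vs ! k)))"
      by (rule sum.reindex_bij_betw[OF bij, symmetric])
    also have "\<dots> = (\<Sum>k\<in>{0..<n}. complex_of_real (f u (vs ! k)) * (z $ k))"
      by (intro sum.cong refl) (simp add: idx)
    also have "\<dots> = (\<Sum>k\<in>{0..<n}. row A i $ k * (z $ k))"
      using i by (intro sum.cong refl) (simp add: A_def fmat_def n_def)
    also have "\<dots> = (A *\<^sub>v z) $ i"
      using i z(1) A by (simp add: scalar_prod_def)
    also have "\<dots> = a * (z $ idx u)" using i z by (simp add: idx)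
    finally show ?thesis .
  qed
  have x: "(\<Sum>v\<in>V. f u v * x v) = Re a * x u - Im a * y u" if "u \<in> V" for u
    using arg_cong[OF eig[OF that], of Re] by (simp add: x_def y_def)
  have y: "(\<Sum>v\<in>V. f u v * y v) = Re a * y u + Im a * x u" if "u \<in> V" for u
    using arg_cong[OF eig[OF that], of Im] by (simp add: x_def y_def)
  have "(\<Sum>u\<in>V. y u * (\<Sum>v\<in>V. f u v * x v)) = (\<Sum>u\<in>V. \<Sum>v\<in>V. y u * f u v * x v)"
    by (simp add: sum_distrib_left mult.assoc)
  also have "\<dots> = (\<Sum>v\<in>V. \<Sum>u\<in>V. y u * f u v * x v)" by (rule sum.swap)
  also have "\<dots> = (\<Sum>v\<in>V. x v * (\<Sum>u\<in>V. f v u * y u))"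
    by (simp add: sum_distrib_left sym mult_ac)
  finally have "(\<Sum>u\<in>V. y u * (Re a * x u - Im a * y u)) = (\<Sum>u\<in>V. x u * (Re a * y u + Im a * x u))"
    by (simp add: x y)
  then have "(\<Sum>u\<in>V. x u * (Re a * y u + Im a * x u) - y u * (Re a * x u - Im a * y u)) = 0"
    by (simp add: sum_subtractf)
  then have 0: "Im a * (\<Sum>u\<in>V. (x u)\<^sup>2 + (y u)\<^sup>2) = 0"
    by (simp add: sum_distrib_left algebra_simps power2_eq_square)
  obtain i where i: "i < n" "z $ i \<noteq> 0"
  proof -
    have "\<exists>i<n. z $ i \<noteq> 0"
    proof (rule ccontr)
      assume "\<not> ?thesis"
      then have "z = 0\<^sub>v n" using z(1) by (intro eq_vecI) auto
      then show False using z(2) by simp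
    qed
    then show ?thesis using that by blast
  qed
  have wV: "vs ! i \<in> V" using i vs by (auto simp: n_def)
  have nz: "x (vs ! i) \<noteq> 0 \<or> y (vs ! i) \<noteq> 0"
    using i by (simp add: x_def y_def idx complex_eq_iff)
  then have "(x (vs ! i))\<^sup>2 + (y (vs ! i))\<^sup>2 > 0" by (simp add: sum_power2_gt_zero_iff)
  then have "(\<Sum>u\<in>V. (x u)\<^sup>2 + (y u)\<^sup>2) > 0"
    using V(1) wV by (intro sum_pos2[of _ "vs ! i"]) auto
  then have "Im a = 0" using 0 by simp
  then have "\<forall>u\<in>V. (\<Sum>v\<in>V. f u v * x v) = Re a * x u" "\<forall>u\<in>V. (\<Sum>v\<in>V. f u v * y v) = Re a * y u"
    using x y by simp_all
  then show ?thesis using nz wV by blast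
qed

subsection \<open>Spectral decomposition\<close>

text \<open>\<open>p i\<close> is the eigenvector for \<open>e i\<close>. The eigenvectors are
  indexed by \<open>V\<close> itself, which keeps all sums over one set; orthonormality of rows and
  of columns is recorded together, so that neither has to be derived from the other.\<close>

definition spectral_dec :: "'a set \<Rightarrow> ('a \<Rightarrow> 'a \<Rightarrow> real) \<Rightarrow> ('a \<Rightarrow> real) \<Rightarrow> ('a \<Rightarrow> 'a \<Rightarrow> real) \<Rightarrow> bool" where
  "spectral_dec V f e p \<longleftrightarrow>
    (\<forall>i\<in>V. \<forall>j\<in>V. (\<Sum>u\<in>V. p i u * p j u) = (if i = j then 1 else 0)) \<and>
    (\<forall>u\<in>V. \<forall>v\<in>V. (\<Sum>i\<in>V. p i u * p i v) = (if u = v then 1 else 0)) \<and>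
    (\<forall>u\<in>V. \<forall>v\<in>V. f u v = (\<Sum>i\<in>V. e i * (p i u * p i v)))"

text \<open>A symmetric involution \<open>h\<close> is orthogonal, so applying it to the
  eigenvectors of \<open>g\<close> keeps them orthonormal and makes them eigenvectors of
  \<open>h g h\<close>.\<close>

lemma spectral_dec_conj:
  fixes h :: "'a \<Rightarrow> 'a \<Rightarrow> real"
  assumes V: "finite V" and g: "spectral_dec V g e p"
    and sym: "\<And>u v. h u v = h v u"
    and inv: "\<And>x u. u \<in> V \<Longrightarrow> (\<Sum>w\<in>V. h u w * (\<Sum>z\<in>V. h w z * x z)) = x u"
    and f: "\<And>u v. u \<in> V \<Longrightarrow> v \<in> V \<Longrightarrow> f u v = (\<Sum>w\<in>V. h u w * (\<Sum>z\<in>V. h v z * g w z))"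
  shows "spectral_dec V f e (\<lambda>i u. \<Sum>w\<in>V. h u w * p i w)"
proof -
  have gen: "(\<Sum>i\<in>V. c i * ((\<Sum>w\<in>V. h u w * p i w) * (\<Sum>z\<in>V. h v z * p i z))) =
    (\<Sum>w\<in>V. h u w * (\<Sum>z\<in>V. h v z * (\<Sum>i\<in>V. c i * (p i w * p i z))))" for u v c
  proof -
    have "(\<Sum>i\<in>V. c i * ((\<Sum>w\<in>V. h u w * p i w) * (\<Sum>z\<in>V. h v z * p i z))) =
      (\<Sum>i\<in>V. \<Sum>w\<in>V. \<Sum>z\<in>V. h u w * (h v z * (c i * (p i w * p i z))))"
      unfolding sum_product by (simp add: sum_distrib_left mult_ac)
    also have "\<dots> = (\<Sum>w\<in>V. \<Sum>i\<in>V. \<Sum>z\<in>V. h u w * (h v z * (c i * (p i w * p i z))))"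
      by (rule sum.swap)
    also have "\<dots> = (\<Sum>w\<in>V. \<Sum>z\<in>V. \<Sum>i\<in>V. h u w * (h v z * (c i * (p i w * p i z))))"
      by (intro sum.cong refl sum.swap)
    finally show ?thesis by (simp add: sum_distrib_left)
  qed
  have 1: "(\<Sum>u\<in>V. (\<Sum>w\<in>V. h u w * p i w) * (\<Sum>w\<in>V. h u w * p j w)) = (if i = j then 1 else 0)"
    if "i \<in> V" "j \<in> V" for i j
  proof -
    have "(\<Sum>u\<in>V. (\<Sum>w\<in>V. h u w * p i w) * (\<Sum>w\<in>V. h u w * p j w)) =
       (\<Sum>u\<in>V. \<Sum>w\<in>V. p i w * (h w u * (\<Sum>w\<in>V. h u w * p j w)))"
      by (simp add: sum_distrib_right mult_ac sym)
    also have "\<dots> = (\<Sum>w\<in>V. p i w * (\<Sum>u\<in>V. h w u * (\<Sum>w\<in>V. h u w * p j w)))"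
      by (subst sum.swap) (simp add: sum_distrib_left)
    also have "\<dots> = (\<Sum>w\<in>V. p i w * p j w)" by (simp add: inv)
    finally show ?thesis using g that by (simp add: spectral_dec_def)
  qed
  have 2: "(\<Sum>i\<in>V. (\<Sum>w\<in>V. h u w * p i w) * (\<Sum>w\<in>V. h v w * p i w)) = (if u = v then 1 else 0)"
    if "u \<in> V" "v \<in> V" for u v
  proof -
    have "(\<Sum>i\<in>V. (\<Sum>w\<in>V. h u w * p i w) * (\<Sum>w\<in>V. h v w * p i w)) =
        (\<Sum>w\<in>V. h u w * (\<Sum>z\<in>V. h v z * (\<Sum>i\<in>V. p i w * p i z)))"
      using gen[of "\<lambda>_. 1" u v] by simp
    also have "\<dots> = (\<Sum>w\<in>V. h u w * (\<Sum>z\<in>V. h z v * (if w = z then 1 else 0)))"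
      using g by (simp add: spectral_dec_def sym[of v])
    also have "\<dots> = (\<Sum>w\<in>V. h u w * (\<Sum>z\<in>V. h w z * (if z = v then 1 else 0)))"
      using V that by (simp add: if_distrib[of "\<lambda>x. _ * x"] cong: if_cong)
    also have "\<dots> = (if u = v then 1 else 0)" using inv[OF that(1), of "\<lambda>z. if z = v then 1 else 0"] by simp
    finally show ?thesis .
  qed
  have 3: "f u v = (\<Sum>i\<in>V. e i * ((\<Sum>w\<in>V. h u w * p i w) * (\<Sum>w\<in>V. h v w * p i w)))"
    if "u \<in> V" "v \<in> V" for u v
    using g that by (simp add: gen f spectral_dec_def)
  show ?thesis unfolding spectral_dec_def using 1 2 3 by blast
qed

text \<open>The reflection along \<open>w = x - e\<close>, with \<open>e\<close> the basis vector at
  \<open>r\<close>, swaps \<open>e\<close> and \<open>x\<close>. Since \<open>x\<close> is a unit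
  vector, \<open>|w|^2 = 2 (1 - x r)\<close>, which turns the usual factor \<open>2 / |w|^2\<close>
  into \<open>1 / k\<close>.\<close>

lemma householder:
  fixes x :: "'a \<Rightarrow> real"
  assumes V: "finite V" "r \<in> V" and unit: "(\<Sum>u\<in>V. x u * x u) = 1"
  obtains h where "\<And>u v. h u v = (h v u :: real)"
    "\<And>y u. u \<in> V \<Longrightarrow> (\<Sum>w\<in>V. h u w * (\<Sum>z\<in>V. h w z * y z)) = y u"
    "\<And>u. u \<in> V \<Longrightarrow> h u r = x u"
proof -
  define w where "w u = x u - (if u = r then 1 else 0)" for u
  define k where "k = 1 - x r"
  \<comment> \<open>If \<open>x\<close> is already the basis vector at \<open>r\<close>, then \<open>k = 0\<close>, and since \<open>t / 0 = 0\<close> the map \<open>h\<close> is the identity.\<close>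
  define h where "h u v = (if u = v then 1 else 0) - w u * w v / k" for u v
  have h: "(\<Sum>v\<in>V. h u v * y v) = y u - w u / k * (\<Sum>v\<in>V. w v * y v)" if "u \<in> V" for u y
  proof -
    have "(\<Sum>v\<in>V. h u v * y v) = (\<Sum>v\<in>V. (if u = v then y v else 0) - w u / k * (w v * y v))"
      by (intro sum.cong) (auto simp: h_def algebra_simps)
    then show ?thesis using that V by (simp add: sum_subtractf sum_distrib_left)
  qed
  have "(\<Sum>u\<in>V. w u * w u) = (\<Sum>u\<in>V. x u * x u + (if u = r then 1 - 2 * x u else 0))"
    by (intro sum.cong) (auto simp: w_def algebra_simps)
  then have ww: "(\<Sum>u\<in>V. w u * w u) = 2 * k"
    using V unit by (simp add: sum.distrib k_def)
  have inv: "(\<Sum>v\<in>V. h u v * (\<Sum>z\<in>V. h v z * y z)) = y u" if "u \<in> V" for y u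
  proof -
    define s where "s = (\<Sum>v\<in>V. w v * y v)"
    have "(\<Sum>v\<in>V. h u v * (\<Sum>z\<in>V. h v z * y z)) = (\<Sum>v\<in>V. h u v * (y v - w v / k * s))"
      by (intro sum.cong) (auto simp: h s_def)
    also have "\<dots> = y u - w u / k * s - w u / k * (\<Sum>v\<in>V. w v * (y v - w v / k * s))"
      using that by (simp add: h)
    also have "(\<Sum>v\<in>V. w v * (y v - w v / k * s)) = (\<Sum>v\<in>V. w v * y v - s / k * (w v * w v))"
      by (intro sum.cong refl) (simp add: algebra_simps)
    also have "\<dots> = s - s / k * (\<Sum>v\<in>V. w v * w v)"
      unfolding sum_subtractf sum_distrib_left[symmetric] s_def ..
    also have "y u - w u / k * s - w u / k * (s - s / k * (\<Sum>v\<in>V. w v * w v)) = y u"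
      by (cases "k = 0") (simp_all add: ww field_simps)
    finally show ?thesis .
  qed
  have "h u r = x u" if "u \<in> V" for u
  proof (cases "k = 0")
    case True
    then have "(\<Sum>u\<in>V. w u * w u) = 0" using ww by simp
    then have "w u * w u = 0" using V that by (subst (asm) sum_nonneg_eq_0_iff) auto
    then show ?thesis using True by (simp add: h_def w_def split: if_splits)
  next
    case False
    have "w r = - k" by (simp add: w_def k_def)
    then show ?thesis using False by (auto simp: h_def) (auto simp: w_def)
  qed
  moreover have "h u v = h v u" for u v by (simp add: h_def mult.commute)
  ultimately show ?thesis using that inv by blast
qed

text \<open>Deflation: a Householder reflection moves the basis vector at \<open>r\<close> to a unit
  eigenvector, so in the conjugated matrix \<open>g\<close> row and column \<open>r\<close> vanish
  off the diagonal and the induction hypothesis decomposes the rest.\<close>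

theorem spectral_theorem:
  assumes "finite V" "\<And>u v. u \<in> V \<Longrightarrow> v \<in> V \<Longrightarrow> f u v = f v u"
  shows "\<exists>e p. spectral_dec V f e p"
  using assms
proof (induction V arbitrary: f rule: finite_induct)
  case empty
  then show ?case by (simp add: spectral_dec_def)
next
  case (insert r U)
  let ?V = "insert r U"
  have fin: "finite ?V" using insert by simp
  obtain l x0 where x0: "\<exists>u\<in>?V. x0 u \<noteq> 0" "\<And>u. u \<in> ?V \<Longrightarrow> (\<Sum>v\<in>?V. f u v * x0 v) = l * (x0 u :: real)"
  proof -
    have "\<exists>l x. (\<exists>u\<in>?V. x u \<noteq> 0) \<and> (\<forall>u\<in>?V. (\<Sum>v\<in>?V. f u v * x v) = l * (x u :: real))"
      by (rule symmetric_eigenpair[OF fin]) (use insert.prems in auto)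
    then show ?thesis using that by blast
  qed
  define N where "N = sqrt (\<Sum>u\<in>?V. x0 u * x0 u)"
  have "(\<Sum>u\<in>?V. x0 u * x0 u) > 0"
  proof -
    obtain u where u: "u \<in> ?V" "x0 u \<noteq> 0" using x0(1) by blast
    have "x0 u * x0 u > 0" using u(2) by (auto simp: zero_less_mult_iff)
    then show ?thesis by (intro sum_pos2[OF fin u(1)]) auto
  qed
  then have N: "N > 0" "N * N = (\<Sum>u\<in>?V. x0 u * x0 u)" by (simp_all add: N_def)
  define x where "x u = x0 u / N" for u
  have "(\<Sum>u\<in>?V. x u * x u) = (\<Sum>u\<in>?V. x0 u * x0 u) / (N * N)"
    unfolding x_def times_divide_times_eq by (rule sum_divide_distrib[symmetric])
  then have unit: "(\<Sum>u\<in>?V. x u * x u) = 1" using N(1) by (simp only: N(2)[symmetric]) simp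
  have eig: "(\<Sum>v\<in>?V. f u v * x v) = l * x u" if "u \<in> ?V" for u
    unfolding x_def times_divide_eq_right sum_divide_distrib[symmetric] x0(2)[OF that] ..
  obtain h where h: "\<And>u v. h u v = (h v u :: real)"
    "\<And>y u. u \<in> ?V \<Longrightarrow> (\<Sum>w\<in>?V. h u w * (\<Sum>z\<in>?V. h w z * y z)) = y u"
    "\<And>u. u \<in> ?V \<Longrightarrow> h u r = x u"
    by (rule householder[OF fin insertI1 unit]) blast
  define g where "g u v = (\<Sum>w\<in>?V. h u w * (\<Sum>z\<in>?V. h v z * f w z))" for u v
  have gsym: "g u v = g v u" for u v
  proof -
    have "g u v = (\<Sum>w\<in>?V. \<Sum>z\<in>?V. h u w * (h v z * f w z))"
      by (simp only: g_def sum_distrib_left)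
    also have "\<dots> = (\<Sum>z\<in>?V. \<Sum>w\<in>?V. h u w * (h v z * f w z))" by (rule sum.swap)
    also have "\<dots> = (\<Sum>z\<in>?V. \<Sum>w\<in>?V. h v z * (h u w * f z w))"
      by (intro sum.cong refl) (simp add: insert.prems mult_ac)
    also have "\<dots> = g v u" by (simp only: g_def sum_distrib_left)
    finally show ?thesis .
  qed
  have gr: "g u r = (if u = r then l else 0)" if "u \<in> ?V" for u
  proof -
    have "(\<Sum>z\<in>?V. h r z * f w z) = l * h w r" if "w \<in> ?V" for w
    proof -
      have "(\<Sum>z\<in>?V. h r z * f w z) = (\<Sum>z\<in>?V. f w z * x z)"
        by (intro sum.cong refl) (metis h(1,3) mult.commute)
      then show ?thesis using eig[OF that] h(3)[OF that] by simp
    qed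
    then have "g u r = (\<Sum>w\<in>?V. h u w * (l * h w r))"
      unfolding g_def by (intro sum.cong refl) simp
    also have "\<dots> = (\<Sum>w\<in>?V. h u w * (\<Sum>z\<in>?V. h w z * (if z = r then l else 0)))"
    proof (intro sum.cong refl)
      fix w
      have "(\<Sum>z\<in>?V. h w z * (if z = r then l else 0)) = (\<Sum>z\<in>?V. if z = r then h w z * l else 0)"
        by (intro sum.cong) auto
      also have "\<dots> = h w r * l" using fin by (subst sum.delta) auto
      finally show "h u w * (l * h w r) = h u w * (\<Sum>z\<in>?V. h w z * (if z = r then l else 0))"
        by simp
    qed
    also have "\<dots> = (if u = r then l else 0)" by (rule h(2)[OF that])
    finally show ?thesis .
  qed
  obtain e p where IH: "spectral_dec U g e p"
    using insert.IH[of g] gsym by blast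
  define e' where "e' i = (if i = r then l else e i)" for i
  define P where "P i w = (if i = r then (if w = r then 1 else 0) else if w = r then 0 else p i w)" for i w
  have sU: "(\<Sum>u\<in>U. F u) = (\<Sum>u\<in>U. F' u)" if "\<And>u. u \<in> U \<Longrightarrow> u \<noteq> r \<Longrightarrow> F u = F' u" for F F' :: "'a \<Rightarrow> real"
    using insert.hyps that by (intro sum.cong) auto
  have e'r: "e' r = l" and Prr: "P r r = 1" by (simp_all add: e'_def P_def)
  have 0: "P r w = 0" "P w r = 0" if "w \<noteq> r" for w using that by (simp_all add: P_def)
  have P0: "w \<in> U \<Longrightarrow> P r w = 0" "w \<in> U \<Longrightarrow> P w r = 0" for w using insert.hyps 0 by metis+
  have PU: "i \<in> U \<Longrightarrow> u \<in> U \<Longrightarrow> P i u = p i u" and eU: "i \<in> U \<Longrightarrow> e' i = e i" for i u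
    using insert.hyps by (auto simp: P_def e'_def)
  have dec: "spectral_dec ?V g e' P"
    unfolding spectral_dec_def
  proof (intro conjI ballI)
    fix i j assume "i \<in> ?V" "j \<in> ?V"
    then show "(\<Sum>u\<in>?V. P i u * P j u) = (if i = j then 1 else 0)"
      using IH insert.hyps by (auto simp: P0 Prr PU spectral_dec_def cong: sum.cong)
  next
    fix i j assume "i \<in> ?V" "j \<in> ?V"
    then show "(\<Sum>u\<in>?V. P u i * P u j) = (if i = j then 1 else 0)"
      using IH insert.hyps by (auto simp: P0 Prr PU spectral_dec_def cong: sum.cong)
  next
    fix u v assume uv: "u \<in> ?V" "v \<in> ?V"
    have "g r v = (if v = r then l else 0)" using gr[OF uv(2)] gsym by metis
    then show "g u v = (\<Sum>i\<in>?V. e' i * (P i u * P i v))"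
      using IH insert.hyps uv gr by (auto simp: P0 Prr PU eU e'r spectral_dec_def cong: sum.cong)
  qed
  \<comment> \<open>Conjugating twice by the involution \<open>h\<close> returns
    \<open>f\<close>.\<close>
  have fg: "f u v = (\<Sum>w\<in>?V. h u w * (\<Sum>z\<in>?V. h v z * g w z))" if uv: "u \<in> ?V" "v \<in> ?V" for u v
  proof -
    have "(\<Sum>z\<in>?V. h v z * g w z) = (\<Sum>a\<in>?V. h w a * f a v)" for w
    proof -
      have "g w z = (\<Sum>b\<in>?V. h z b * (\<Sum>a\<in>?V. h w a * f a b))" for z
      proof -
        have "g w z = (\<Sum>a\<in>?V. \<Sum>b\<in>?V. h w a * (h z b * f a b))"
          by (simp only: g_def sum_distrib_left)
        also have "\<dots> = (\<Sum>b\<in>?V. \<Sum>a\<in>?V. h w a * (h z b * f a b))" by (rule sum.swap)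
        also have "\<dots> = (\<Sum>b\<in>?V. h z b * (\<Sum>a\<in>?V. h w a * f a b))"
          by (simp only: sum_distrib_left mult.left_commute)
        finally show ?thesis .
      qed
      then show ?thesis using h(2)[OF uv(2), of "\<lambda>b. \<Sum>a\<in>?V. h w a * f a b"] by simp
    qed
    then show ?thesis using h(2)[OF uv(1), of "\<lambda>a. f a v"] by simp
  qed
  have "spectral_dec ?V f e' (\<lambda>i u. \<Sum>w\<in>?V. h u w * P i w)"
    by (rule spectral_dec_conj[OF fin dec]) (fact h(1) h(2) fg)+
  then show ?case by blast
qed

lemma spectral_dec_char_poly:
  assumes vs: "distinct vs" "set vs = V" and dec: "spectral_dec V f e p"
  shows "char_poly (fmat vs f) = (\<Prod>a\<leftarrow>map e vs. [:- a, 1:])"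
proof -
  let ?D = "fmat vs (\<lambda>i j. if i = j then e i else 0)"
  let ?P = "fmat vs (\<lambda>u i. p i u)" and ?Q = "fmat vs p"
  have V: "finite V" using vs by auto
  have PQ: "?P * ?Q = 1\<^sub>m (length vs)"
    unfolding fmat_mult[OF vs(1)] fmat_one[OF vs(1), symmetric]
    using dec vs by (intro fmat_cong) (auto simp: fmul_def spectral_dec_def)
  have QP: "?Q * ?P = 1\<^sub>m (length vs)"
    unfolding fmat_mult[OF vs(1)] fmat_one[OF vs(1), symmetric]
    using dec vs by (intro fmat_cong) (auto simp: fmul_def spectral_dec_def)
  have PD: "?P * ?D = fmat vs (\<lambda>u i. e i * p i u)"
    unfolding fmat_mult[OF vs(1)]
    using vs V by (intro fmat_cong)
      (simp add: fmul_def if_distrib[of "\<lambda>x. _ * x"] mult.commute cong: if_cong)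
  have PDQ: "?P * ?D * ?Q = fmat vs f"
    unfolding PD fmat_mult[OF vs(1)]
    using dec vs by (intro fmat_cong) (auto simp: fmul_def spectral_dec_def mult.assoc)
  have "similar_mat (fmat vs f) ?D"
    unfolding similar_mat_def similar_mat_wit_def Let_def
    by (intro exI[of _ ?P] exI[of _ ?Q]) (use PQ QP PDQ in \<open>simp add: fmat_def\<close>)
  then have "char_poly (fmat vs f) = char_poly ?D" by (rule char_poly_similar)
  also have "\<dots> = (\<Prod>a\<leftarrow>diag_mat ?D. [:- a, 1:])"
  proof (rule char_poly_upper_triangular[OF fmat_carrier])
    show "upper_triangular ?D"
      unfolding upper_triangular_def using vs(1) by (auto simp: fmat_def nth_eq_iff_index_eq)
  qed
  also have "diag_mat ?D = map e vs"
    by (rule nth_equalityI) (auto simp: diag_mat_def fmat_def)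
  finally show ?thesis .
qed

lemma proots_prod_linear: "proots (\<Prod>a\<leftarrow>xs. [:- a, 1:]) = mset (xs :: real list)"
proof (induction xs)
  case (Cons x xs)
  have "(\<Prod>a\<leftarrow>xs. [:- a, 1:]) \<noteq> 0" by (auto simp: prod_list_zero_iff)
  then have "proots ([:- x, 1:] * (\<Prod>a\<leftarrow>xs. [:- a, 1:])) = proots [:- x, 1:] + mset xs"
    by (subst proots_mult) (use Cons in auto)
  then show ?case by (simp del: mult_pCons_left)
qed simp

section \<open>Invariants shared by cospectral matrices\<close>

definition cospectral_dec where
  "cospectral_dec V f e p W g e' p' \<longleftrightarrow> finite V \<and> finite W \<and> spectral_dec V f e p \<and> spectral_dec W g e' p'
    \<and> image_mset e (mset_set V) = image_mset e' (mset_set W)"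

lemma cospectral_dec_exists:
  assumes vs: "distinct vs" "set vs = V" and ws: "distinct ws" "set ws = W"
    and f: "\<And>u v. u \<in> V \<Longrightarrow> v \<in> V \<Longrightarrow> f u v = f v u"
    and g: "\<And>u v. u \<in> W \<Longrightarrow> v \<in> W \<Longrightarrow> g u v = g v u"
    and eq: "proots (char_poly (fmat vs f)) = proots (char_poly (fmat ws g))"
  shows "\<exists>e p e' p'. cospectral_dec V f e p W g e' p'"
proof -
  have fin: "finite V" "finite W" using vs ws by auto
  obtain e p where 1: "spectral_dec V f e p"
    using spectral_theorem[of V f] fin f by blast
  obtain e' p' where 2: "spectral_dec W g e' p'"
    using spectral_theorem[of W g] fin g by blast
  have "mset (map e vs) = mset (map e' ws)"
    using eq spectral_dec_char_poly[OF vs 1] spectral_dec_char_poly[OF ws 2]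
    by (simp only: proots_prod_linear)
  then have "image_mset e (mset_set V) = image_mset e' (mset_set W)"
    using vs ws mset_set_set[of vs] mset_set_set[of ws] by simp
  then show ?thesis using 1 2 fin unfolding cospectral_dec_def by blast
qed

lemma spectral_dec_sum:
  assumes "finite V"
  shows "(\<Sum>i\<in>V. w i * ((\<Sum>u\<in>V. p i u * x u) * (\<Sum>u\<in>V. p i u * y u))) =
    (\<Sum>u\<in>V. \<Sum>v\<in>V. x u * y v * (\<Sum>i\<in>V. w i * (p i u * p i v :: real)))"
proof -
  have "(\<Sum>i\<in>V. w i * ((\<Sum>u\<in>V. p i u * x u) * (\<Sum>u\<in>V. p i u * y u))) =
    (\<Sum>i\<in>V. \<Sum>u\<in>V. \<Sum>v\<in>V. x u * y v * (w i * (p i u * p i v)))"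
    unfolding sum_product by (simp add: sum_distrib_left mult_ac)
  also have "\<dots> = (\<Sum>u\<in>V. \<Sum>i\<in>V. \<Sum>v\<in>V. x u * y v * (w i * (p i u * p i v)))"
    by (rule sum.swap)
  also have "\<dots> = (\<Sum>u\<in>V. \<Sum>v\<in>V. \<Sum>i\<in>V. x u * y v * (w i * (p i u * p i v)))"
    by (intro sum.cong refl sum.swap)
  finally show ?thesis by (simp add: sum_distrib_left)
qed

definition qform :: "'a set \<Rightarrow> ('a \<Rightarrow> 'a \<Rightarrow> real) \<Rightarrow> ('a \<Rightarrow> real) \<Rightarrow> real" where
  "qform V f x = (\<Sum>u\<in>V. \<Sum>v\<in>V. x u * x v * f u v)"

definition sqnorm :: "'a set \<Rightarrow> ('a \<Rightarrow> real) \<Rightarrow> real" where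
  "sqnorm V x = (\<Sum>u\<in>V. (x u)\<^sup>2)"

lemma qform_spectral_dec:
  assumes "finite V" "spectral_dec V f e p"
  shows "qform V f x = (\<Sum>i\<in>V. e i * (\<Sum>u\<in>V. p i u * x u)\<^sup>2)"
  unfolding power2_eq_square spectral_dec_sum[OF assms(1)] qform_def
  using assms(2) by (intro sum.cong refl) (simp add: spectral_dec_def)

lemma sqnorm_spectral_dec:
  assumes "finite V" "spectral_dec V f e p"
  shows "sqnorm V x = (\<Sum>i\<in>V. (\<Sum>u\<in>V. p i u * x u)\<^sup>2)"
proof -
  have "(\<Sum>i\<in>V. (\<Sum>u\<in>V. p i u * x u)\<^sup>2) = (\<Sum>u\<in>V. \<Sum>v\<in>V. x u * x v * (\<Sum>i\<in>V. p i u * p i v))"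
    using spectral_dec_sum[OF assms(1), of "\<lambda>_. 1" p x x] by (simp add: power2_eq_square)
  also have "\<dots> = (\<Sum>u\<in>V. \<Sum>v\<in>V. if u = v then x u * x v else 0)"
    using assms(2) by (intro sum.cong refl) (simp add: spectral_dec_def)
  also have "\<dots> = sqnorm V x" using assms(1) by (simp add: sqnorm_def power2_eq_square)
  finally show ?thesis by simp
qed

lemma sqnorm_pos: "finite V \<Longrightarrow> v \<in> V \<Longrightarrow> x v \<noteq> 0 \<Longrightarrow> sqnorm V x > 0"
  unfolding sqnorm_def by (rule sum_pos2[of _ v]) auto

lemma cospectral_dec_sum:
  assumes "cospectral_dec V f e p W g e' p'"
  shows "(\<Sum>i\<in>V. \<phi> (e i)) = (\<Sum>i\<in>W. (\<phi> (e' i) :: real))"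
proof -
  have "(\<Sum>i\<in>V. \<phi> (e i)) = sum_mset (image_mset \<phi> (image_mset e (mset_set V)))"
    by (simp add: sum_unfold_sum_mset multiset.map_comp comp_def)
  also have "\<dots> = sum_mset (image_mset \<phi> (image_mset e' (mset_set W)))"
    using assms by (simp add: cospectral_dec_def)
  also have "\<dots> = (\<Sum>i\<in>W. \<phi> (e' i))"
    by (simp add: sum_unfold_sum_mset multiset.map_comp comp_def)
  finally show ?thesis .
qed

lemma cospectral_dec_card: "cospectral_dec V f e p W g e' p' \<Longrightarrow> card V = card W"
  using cospectral_dec_sum[of V f e p W g e' p' "\<lambda>_. 1"] by simp

lemma cospectral_dec_count:
  assumes "cospectral_dec V f e p W g e' p'"
  shows "card {i \<in> V. c \<le> e i} = card {i \<in> W. c \<le> e' i}"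
proof -
  have fin: "finite V" "finite W" using assms by (simp_all add: cospectral_dec_def)
  have "real (card {i \<in> V. c \<le> e i}) = (\<Sum>i\<in>V. if c \<le> e i then 1 else 0)"
    using fin by (simp add: sum.If_cases Int_def)
  also have "\<dots> = (\<Sum>i\<in>W. if c \<le> e' i then 1 else 0)"
    by (rule cospectral_dec_sum[OF assms])
  also have "\<dots> = real (card {i \<in> W. c \<le> e' i})"
    using fin by (simp add: sum.If_cases Int_def)
  finally show ?thesis by simp
qed

lemma cospectral_dec_sym:
  "cospectral_dec V f e p W g e' p' \<Longrightarrow> cospectral_dec W g e' p' V f e p"
  by (auto simp: cospectral_dec_def)

lemma cospectral_dec_fdet:
  assumes "cospectral_dec V f e p W g e' p'"
  shows "fdet V (charmat x f) = fdet W (charmat x g)"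
proof -
  obtain vs ws where vs: "distinct vs" "set vs = V" "distinct ws" "set ws = W"
    using assms finite_distinct_list unfolding cospectral_dec_def by metis
  have "mset (map e vs) = mset (map e' ws)"
    using assms vs mset_set_set[of vs] mset_set_set[of ws] by (simp add: cospectral_dec_def)
  then have "mset (map (\<lambda>a. [:- a, 1:]) (map e vs)) = mset (map (\<lambda>a. [:- a, 1:]) (map e' ws))"
    by (metis mset_map)
  then have "char_poly (fmat vs f) = char_poly (fmat ws g)"
    using assms spectral_dec_char_poly vs unfolding cospectral_dec_def by (metis prod_mset_prod_list)
  then show ?thesis
    using poly_char_poly_fmat[OF vs(1), of f x] poly_char_poly_fmat[OF vs(3), of g x] vs
    by (simp add: fdet_eq)
qed

lemma spectral_dec_trace:
  assumes "finite V" "spectral_dec V f e p"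
  shows "(\<Sum>v\<in>V. f v v) = (\<Sum>i\<in>V. e i)"
proof -
  have "(\<Sum>v\<in>V. f v v) = (\<Sum>v\<in>V. \<Sum>i\<in>V. e i * (p i v * p i v))"
    using assms(2) by (intro sum.cong refl) (simp add: spectral_dec_def)
  also have "\<dots> = (\<Sum>i\<in>V. \<Sum>v\<in>V. e i * (p i v * p i v))" by (rule sum.swap)
  also have "\<dots> = (\<Sum>i\<in>V. e i * (\<Sum>v\<in>V. p i v * p i v))" by (simp add: sum_distrib_left)
  also have "\<dots> = (\<Sum>i\<in>V. e i)"
    using assms(2) by (intro sum.cong refl) (simp add: spectral_dec_def)
  finally show ?thesis .
qed

lemma spectral_dec_fmul:
  assumes V: "finite V" and f: "spectral_dec V f e p" and g: "spectral_dec V g e' p"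
  shows "spectral_dec V (fmul V f g) (\<lambda>i. e i * e' i) p"
proof -
  have "fmul V f g u v = (\<Sum>i\<in>V. e i * e' i * (p i u * p i v))" if uv: "u \<in> V" "v \<in> V" for u v
  proof -
    have "fmul V f g u v = (\<Sum>w\<in>V. (\<Sum>i\<in>V. e i * (p i u * p i w)) * (\<Sum>j\<in>V. e' j * (p j w * p j v)))"
      unfolding fmul_def using f g uv by (intro sum.cong refl) (simp add: spectral_dec_def)
    also have "\<dots> = (\<Sum>w\<in>V. \<Sum>i\<in>V. \<Sum>j\<in>V. e i * e' j * p i u * p j v * (p i w * p j w))"
      unfolding sum_product by (intro sum.cong refl) (simp add: mult_ac)
    also have "\<dots> = (\<Sum>i\<in>V. \<Sum>w\<in>V. \<Sum>j\<in>V. e i * e' j * p i u * p j v * (p i w * p j w))"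
      by (rule sum.swap)
    also have "\<dots> = (\<Sum>i\<in>V. \<Sum>j\<in>V. \<Sum>w\<in>V. e i * e' j * p i u * p j v * (p i w * p j w))"
      by (intro sum.cong refl sum.swap)
    also have "\<dots> = (\<Sum>i\<in>V. \<Sum>j\<in>V. e i * e' j * p i u * p j v * (\<Sum>w\<in>V. p i w * p j w))"
      by (simp add: sum_distrib_left)
    also have "\<dots> = (\<Sum>i\<in>V. \<Sum>j\<in>V. if i = j then e i * e' j * p i u * p j v else 0)"
      using f by (intro sum.cong refl) (simp add: spectral_dec_def)
    also have "\<dots> = (\<Sum>i\<in>V. e i * e' i * (p i u * p i v))"
      using V by (simp add: mult.assoc)
    finally show ?thesis .
  qed
  then show ?thesis using f unfolding spectral_dec_def by blast
qed

lemma cospectral_dec_traces: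
  assumes "cospectral_dec V f e p W g e' p'"
  shows "(\<Sum>v\<in>V. f v v) = (\<Sum>v\<in>W. g v v)"
    and "(\<Sum>v\<in>V. fmul V f f v v) = (\<Sum>v\<in>W. fmul W g g v v)"
    and "(\<Sum>v\<in>V. fmul V f (fmul V f f) v v) = (\<Sum>v\<in>W. fmul W g (fmul W g g) v v)"
proof -
  have fin: "finite V" "finite W" and f: "spectral_dec V f e p" and g: "spectral_dec W g e' p'"
    using assms by (simp_all add: cospectral_dec_def)
  note f2 = spectral_dec_fmul[OF fin(1) f f] and g2 = spectral_dec_fmul[OF fin(2) g g]
  note f3 = spectral_dec_fmul[OF fin(1) f f2] and g3 = spectral_dec_fmul[OF fin(2) g g2]
  show "(\<Sum>v\<in>V. f v v) = (\<Sum>v\<in>W. g v v)"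
    unfolding spectral_dec_trace[OF fin(1) f] spectral_dec_trace[OF fin(2) g]
    by (rule cospectral_dec_sum[OF assms])
  show "(\<Sum>v\<in>V. fmul V f f v v) = (\<Sum>v\<in>W. fmul W g g v v)"
    unfolding spectral_dec_trace[OF fin(1) f2] spectral_dec_trace[OF fin(2) g2]
    by (rule cospectral_dec_sum[OF assms, of "\<lambda>x. x * x"])
  show "(\<Sum>v\<in>V. fmul V f (fmul V f f) v v) = (\<Sum>v\<in>W. fmul W g (fmul W g g) v v)"
    unfolding spectral_dec_trace[OF fin(1) f3] spectral_dec_trace[OF fin(2) g3]
    by (rule cospectral_dec_sum[OF assms, of "\<lambda>x. x * (x * x)"])
qed

text \<open>If every eigenvalue of \<open>f\<close> were below \<open>c\<close>, the form of
  \<open>f\<close> would be strictly below \<open>c |x|^2\<close> at every nonzero \<open>x\<close>.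
  Hence some eigenvalue is at least \<open>c\<close>; \<open>g\<close> then has one as well, and its
  eigenvector serves as \<open>y\<close>.\<close>

lemma cospectral_dec_transfer_line:
  assumes cs: "cospectral_dec V f e p W g e' p'"
    and x: "v \<in> V" "x v \<noteq> 0" "c * sqnorm V x \<le> qform V f x"
  shows "\<exists>y. (\<exists>w\<in>W. y w \<noteq> 0) \<and> c * sqnorm W y \<le> qform W g y"
proof -
  have fin: "finite V" "finite W" and f: "spectral_dec V f e p" and g: "spectral_dec W g e' p'"
    using cs by (simp_all add: cospectral_dec_def)
  define k where "k i = (\<Sum>u\<in>V. p i u * x u)" for i
  have "{i \<in> V. c \<le> e i} \<noteq> {}"
  proof
    assume "{i \<in> V. c \<le> e i} = {}"
    then have lt: "e i < c" if "i \<in> V" for i using that by force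
    have N: "sqnorm V x = (\<Sum>i\<in>V. (k i)\<^sup>2)" using sqnorm_spectral_dec[OF fin(1) f] by (simp add: k_def)
    have "sqnorm V x > 0" using sqnorm_pos[of V v x] fin x by simp
    then have "\<exists>i\<in>V. k i \<noteq> 0" unfolding N by (metis (mono_tags, lifting) sum.neutral zero_power2 less_irrefl)
    then obtain i where i: "i \<in> V" "k i \<noteq> 0" by blast
    have "e i * (k i)\<^sup>2 < c * (k i)\<^sup>2" using i lt by (intro mult_strict_right_mono) auto
    moreover have "e i * (k i)\<^sup>2 \<le> c * (k i)\<^sup>2" if "i \<in> V" for i
      using lt[OF that] by (intro mult_right_mono) auto
    ultimately have "(\<Sum>i\<in>V. e i * (k i)\<^sup>2) < (\<Sum>i\<in>V. c * (k i)\<^sup>2)"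
      using fin i by (intro sum_strict_mono_ex1 ballI bexI[of _ i]) auto
    then show False using x(3) qform_spectral_dec[OF fin(1) f] N
      by (simp add: k_def sum_distrib_left)
  qed
  then have "card {i \<in> V. c \<le> e i} \<noteq> 0" using fin by simp
  then have "card {i \<in> W. c \<le> e' i} \<noteq> 0" using cospectral_dec_count[OF cs, of c] by simp
  then obtain j where j: "j \<in> W" "c \<le> e' j" by (metis (mono_tags, lifting) Collect_empty_eq card.empty)
  have k: "(\<Sum>u\<in>W. p' i u * p' j u) = (if i = j then 1 else 0)" if "i \<in> W" for i
    using g j that by (simp add: spectral_dec_def)
  have N: "sqnorm W (p' j) = 1"
    unfolding sqnorm_spectral_dec[OF fin(2) g] using fin j by (simp add: k if_distrib[of "\<lambda>x. x\<^sup>2"] cong: if_cong)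
  have Q: "qform W g (p' j) = e' j"
    unfolding qform_spectral_dec[OF fin(2) g] using fin j by (simp add: k if_distrib[of "\<lambda>x. _ * x\<^sup>2"] cong: if_cong)
  have "\<exists>w\<in>W. p' j w \<noteq> 0"
  proof (rule ccontr)
    assume "\<not> ?thesis"
    then have "sqnorm W (p' j) = 0" by (simp add: sqnorm_def)
    then show False using N by simp
  qed
  then show ?thesis using N Q j(2) by (intro exI[of _ "p' j"]) simp
qed

lemma ex_kernel_2d: "\<exists>a b. (a \<noteq> 0 \<or> b \<noteq> (0::real)) \<and> a * s + b * t = 0"
proof (cases "s = 0")
  case True
  then show ?thesis by (intro exI[of _ 1] exI[of _ 0]) simp
next
  case False
  then show ?thesis by (intro exI[of _ t] exI[of _ "- s"]) simp
qed

text \<open>Were there at most one eigenvalue \<open>\<ge> c\<close>, the plane spanned by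
  \<open>y\<close> and \<open>z\<close> would contain a nonzero vector orthogonal to its
  eigenvector, where the form is too small. So \<open>g\<close> also has two such eigenvectors, and
  some combination of them lies in the kernel of the functional \<open>l\<close>, later taken as
  evaluation at the center.\<close>

lemma cospectral_dec_transfer_plane:
  assumes cs: "cospectral_dec V f e p W g e' p'"
    and indep: "\<And>a b. a \<noteq> 0 \<or> b \<noteq> 0 \<Longrightarrow> \<exists>v\<in>V. a * y v + b * z v \<noteq> 0"
    and form: "\<And>a b. c * sqnorm V (\<lambda>v. a * y v + b * z v) \<le> qform V f (\<lambda>v. a * y v + b * z v)"
  shows "\<exists>x. (\<exists>w\<in>W. x w \<noteq> 0) \<and> (\<Sum>w\<in>W. l w * x w) = 0 \<and> c * sqnorm W x \<le> qform W g x"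
proof -
  have fin: "finite V" "finite W" and f: "spectral_dec V f e p" and g: "spectral_dec W g e' p'"
    using cs by (simp_all add: cospectral_dec_def)
  have "\<exists>i\<in>W. \<exists>j\<in>W. i \<noteq> j \<and> c \<le> e' i \<and> c \<le> e' j"
  proof (rule ccontr)
    assume neg: "\<not> ?thesis"
    have "card {i \<in> W. c \<le> e' i} \<le> Suc 0"
      by (subst card_le_Suc0_iff_eq) (use fin neg in auto)
    then have "card {i \<in> V. c \<le> e i} \<le> Suc 0" using cospectral_dec_count[OF cs, of c] by simp
    then have uniq: "\<And>i j. i \<in> V \<Longrightarrow> j \<in> V \<Longrightarrow> c \<le> e i \<Longrightarrow> c \<le> e j \<Longrightarrow> i = j"
      using card_le_Suc0_iff_eq[of "{i \<in> V. c \<le> e i}"] fin by auto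
    \<comment> \<open>If no eigenvalue reaches \<open>c\<close>, then \<open>i0\<close> is arbitrary
      and the argument below still applies.\<close>
    obtain i0 where i0: "\<And>i. i \<in> V \<Longrightarrow> c \<le> e i \<Longrightarrow> i = i0" using uniq by metis
    obtain a b where ab: "a \<noteq> 0 \<or> b \<noteq> 0"
      "a * (\<Sum>u\<in>V. p i0 u * y u) + b * (\<Sum>u\<in>V. p i0 u * z u) = 0"
      using ex_kernel_2d by blast
    define x where "x v = a * y v + b * z v" for v
    define k where "k i = (\<Sum>u\<in>V. p i u * x u)" for i
    have k0: "k i0 = 0"
    proof -
      have "k i0 = a * (\<Sum>u\<in>V. p i0 u * y u) + b * (\<Sum>u\<in>V. p i0 u * z u)"
        unfolding k_def x_def sum_distrib_left sum.distrib[symmetric]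
        by (intro sum.cong refl) (simp add: algebra_simps)
      then show ?thesis using ab(2) by simp
    qed
    obtain v where v: "v \<in> V" "x v \<noteq> 0" using indep[OF ab(1)] by (auto simp: x_def)
    have N: "sqnorm V x = (\<Sum>i\<in>V. (k i)\<^sup>2)" using sqnorm_spectral_dec[OF fin(1) f] by (simp add: k_def)
    have "sqnorm V x > 0" using sqnorm_pos[of V v x] fin v by simp
    then have "\<exists>i\<in>V. k i \<noteq> 0" unfolding N by (metis (mono_tags, lifting) sum.neutral zero_power2 less_irrefl)
    then obtain i where i: "i \<in> V" "k i \<noteq> 0" by blast
    have lt: "e i * (k i)\<^sup>2 \<le> c * (k i)\<^sup>2" if "i \<in> V" for i
      using i0[OF that] k0 by (cases "c \<le> e i") (auto intro!: mult_right_mono)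
    have "e i < c" using i0[OF i(1)] i(2) k0 by force
    then have "e i * (k i)\<^sup>2 < c * (k i)\<^sup>2" using i(2) by (intro mult_strict_right_mono) auto
    then have "(\<Sum>i\<in>V. e i * (k i)\<^sup>2) < (\<Sum>i\<in>V. c * (k i)\<^sup>2)"
      using fin i(1) lt by (intro sum_strict_mono_ex1 ballI bexI[of _ i]) auto
    moreover have "c * sqnorm V x \<le> qform V f x" using form[of a b] by (simp add: x_def[abs_def])
    ultimately show False using qform_spectral_dec[OF fin(1) f, of x] N
      by (simp add: k_def sum_distrib_left)
  qed
  then obtain i j where ij: "i \<in> W" "j \<in> W" "i \<noteq> j" "c \<le> e' i" "c \<le> e' j" by blast
  obtain a b where ab: "a \<noteq> 0 \<or> b \<noteq> 0"
      "a * (\<Sum>u\<in>W. l u * p' i u) + b * (\<Sum>u\<in>W. l u * p' j u) = 0"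
    using ex_kernel_2d by blast
  define x where "x v = a * p' i v + b * p' j v" for v
  have lx: "(\<Sum>w\<in>W. l w * x w) = 0"
  proof -
    have "(\<Sum>w\<in>W. l w * x w) = a * (\<Sum>u\<in>W. l u * p' i u) + b * (\<Sum>u\<in>W. l u * p' j u)"
      unfolding x_def sum_distrib_left sum.distrib[symmetric]
      by (intro sum.cong refl) (simp add: algebra_simps)
    then show ?thesis using ab(2) by simp
  qed
  have k: "(\<Sum>u\<in>W. p' m u * x u) = (if m = i then a else 0) + (if m = j then b else 0)" if "m \<in> W" for m
  proof -
    have "(\<Sum>u\<in>W. p' m u * x u) = a * (\<Sum>u\<in>W. p' m u * p' i u) + b * (\<Sum>u\<in>W. p' m u * p' j u)"
      unfolding x_def sum_distrib_left sum.distrib[symmetric]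
      by (intro sum.cong refl) (simp add: algebra_simps)
    then show ?thesis using g that ij by (simp add: spectral_dec_def)
  qed
  have K: "(\<Sum>m\<in>W. w m * ((if m = i then a else 0) + (if m = j then b else 0))\<^sup>2) = w i * a\<^sup>2 + w j * b\<^sup>2" for w
  proof -
    have "(\<Sum>m\<in>W. w m * ((if m = i then a else 0) + (if m = j then b else 0))\<^sup>2) =
      (\<Sum>m\<in>W. (if m = i then w i * a\<^sup>2 else 0) + (if m = j then w j * b\<^sup>2 else 0))"
      using ij(3) by (intro sum.cong) auto
    then show ?thesis using ij fin by (simp add: sum.distrib)
  qed
  have N: "sqnorm W x = a\<^sup>2 + b\<^sup>2"
    unfolding sqnorm_spectral_dec[OF fin(2) g] using K[of "\<lambda>_. 1"] by (simp add: k)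
  have Q: "qform W g x = e' i * a\<^sup>2 + e' j * b\<^sup>2"
    unfolding qform_spectral_dec[OF fin(2) g] using K[of e'] by (simp add: k)
  have "c * sqnorm W x \<le> qform W g x"
    unfolding N Q using ij by (simp add: distrib_left add_mono mult_right_mono)
  moreover have "\<exists>w\<in>W. x w \<noteq> 0"
  proof (rule ccontr)
    assume "\<not> ?thesis"
    then have "sqnorm W x = 0" by (simp add: sqnorm_def)
    then show False using N ab(1) by (simp add: sum_power2_eq_zero_iff)
  qed
  ultimately show ?thesis using lx by blast
qed

text \<open>Lets the transfer principles, which speak of eigenvalues at or above a threshold, be
  used for eigenvalues at or below one.\<close>

lemma cospectral_dec_uminus:
  assumes "cospectral_dec V f e p W g e' p'"
  shows "cospectral_dec V (\<lambda>u v. - f u v) (\<lambda>i. - e i) p W (\<lambda>u v. - g u v) (\<lambda>i. - e' i) p'"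
proof -
  have "image_mset uminus (image_mset e (mset_set V)) = image_mset uminus (image_mset e' (mset_set W))"
    using assms by (simp add: cospectral_dec_def)
  then show ?thesis
    using assms by (simp add: cospectral_dec_def spectral_dec_def sum_negf multiset.map_comp comp_def)
qed

section \<open>Grounded determinants as spectral invariants\<close>

lemma fdet_tendsto:
  assumes U: "finite U" and lim: "\<And>a b. a \<in> U \<Longrightarrow> b \<in> U \<Longrightarrow> ((\<lambda>x. F x a b) \<longlongrightarrow> L a b) net"
  shows "((\<lambda>x. fdet U (F x)) \<longlongrightarrow> fdet U L) net"
proof -
  obtain us where us: "distinct us" "set us = U" using U finite_distinct_list by metis
  have det: "fdet U h = (\<Sum>q | q permutes {0..<length us}. signof q * (\<Prod>i\<in>{0..<length us}. h (us ! i) (us ! q i)))" for h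
    unfolding fdet_eq[OF us] det_def'[OF fmat_carrier]
    by (intro sum.cong refl arg_cong2[where f = "(*)"] prod.cong) (auto simp: fmat_def permutes_in_image)
  show ?thesis unfolding det
  proof (intro tendsto_sum tendsto_mult tendsto_const tendsto_prod lim)
    fix q i assume q: "q \<in> {q. q permutes {0..<length us}}" and i: "i \<in> {0..<length us}"
    show "us ! i \<in> U" using i us(2) by auto
    have "q i < length us" using q i permutes_in_image[of q "{0..<length us}" i] by simp
    then show "us ! q i \<in> U" using us(2) by auto
  qed
qed

text \<open>After summing all rows and columns into \<open>r\<close>, the corner entry is
  \<open>card V * x\<close> and the rest of row and column \<open>r\<close> equals \<open>x\<close>.
  Taking the corner as pivot subtracts \<open>x * x / (card V * x) = x / card V\<close> everywhere
  else, and the factor \<open>x\<close> of the eigenvalue 0 stands in front.\<close>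

lemma fdet_zero_row_sums:
  fixes x :: real
  assumes V: "finite V" "r \<in> V" and sym: "\<And>u v. u \<in> V \<Longrightarrow> v \<in> V \<Longrightarrow> f u v = f v u"
    and zero: "\<And>u. u \<in> V \<Longrightarrow> (\<Sum>v\<in>V. f u v) = 0" and x: "x \<noteq> 0"
  shows "fdet V (charmat x f) =
    card V * x * fdet (V - {r}) (\<lambda>u v. (if u = v then x else 0) - f u v - x / card V)"
proof -
  define h where "h u v = (if u = v then x else 0) - f u v" for u v
  have row: "(\<Sum>v\<in>V. h u v) = x" if "u \<in> V" for u
    using that V zero by (simp add: h_def sum_subtractf)
  have col: "(\<Sum>u\<in>V. h u v) = x" if "v \<in> V" for v
  proof -
    have "(\<Sum>u\<in>V. h u v) = (\<Sum>u\<in>V. h v u)"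
      using that sym by (intro sum.cong) (auto simp: h_def)
    then show ?thesis using row[OF that] by simp
  qed
  let ?g = "\<lambda>u v. if u = r then (if v = r then \<Sum>a\<in>V. \<Sum>b\<in>V. h a b else \<Sum>a\<in>V. h a v)
      else if v = r then \<Sum>b\<in>V. h u b else h u v"
  have tot: "(\<Sum>a\<in>V. \<Sum>b\<in>V. h a b) = card V * x" by (simp add: row)
  have c: "card V > 0" using V by (simp add: card_gt_0_iff) blast
  have V': "insert r (V - {r}) = V" using V by blast
  have "fdet V h = fdet (insert r (V - {r})) ?g" unfolding V' by (rule fdet_add_rows_cols[OF V])
  also have "\<dots> = ?g r r * fdet (V - {r}) (\<lambda>a b. ?g a b - ?g a r * ?g r b / ?g r r)"
    by (rule fdet_schur) (use V c x tot in auto)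
  also have "fdet (V - {r}) (\<lambda>a b. ?g a b - ?g a r * ?g r b / ?g r r) =
      fdet (V - {r}) (\<lambda>u v. h u v - x / card V)"
    using V x c by (intro fdet_cong) (auto simp: row col tot)
  finally show ?thesis using tot by (simp add: h_def)
qed

text \<open>Cancelling \<open>card V * x\<close> in \<open>fdet_zero_row_sums\<close> leaves
  functions that agree for \<open>x \<noteq> 0\<close>; their limits at 0 are the two minors up to a
  common sign. For a Laplacian such a minor is the number of spanning trees.\<close>

lemma cospectral_dec_grounded_fdet:
  assumes cs: "cospectral_dec V f e p W g e' p'" and r: "r \<in> V" "s \<in> W"
    and f: "\<And>u v. u \<in> V \<Longrightarrow> v \<in> V \<Longrightarrow> f u v = f v u" "\<And>u. u \<in> V \<Longrightarrow> (\<Sum>v\<in>V. f u v) = 0"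
    and g: "\<And>u v. u \<in> W \<Longrightarrow> v \<in> W \<Longrightarrow> g u v = g v u" "\<And>u. u \<in> W \<Longrightarrow> (\<Sum>v\<in>W. g u v) = 0"
  shows "fdet (V - {r}) f = fdet (W - {s}) g"
proof -
  have fin: "finite V" "finite W" using cs by (simp_all add: cospectral_dec_def)
  note n = cospectral_dec_card[OF cs]
  have c: "card V > 0" using r(1) fin by (simp add: card_gt_0_iff) blast
  let ?F = "\<lambda>x. fdet (V - {r}) (\<lambda>u v. (if u = v then x else 0) - f u v - x / card V)"
  let ?G = "\<lambda>x. fdet (W - {s}) (\<lambda>u v. (if u = v then x else 0) - g u v - x / card V)"
  have "?F x = ?G x" if "x \<noteq> 0" for x
  proof -
    have "card V * x * ?F x = fdet V (charmat x f)"
      using fdet_zero_row_sums[OF fin(1) r(1) f that] by simp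
    also have "\<dots> = fdet W (charmat x g)" by (rule cospectral_dec_fdet[OF cs])
    also have "\<dots> = card V * x * ?G x"
      unfolding n by (rule fdet_zero_row_sums[OF fin(2) r(2) g that])
    finally have "card V * x * ?F x = card V * x * ?G x" .
    then show ?thesis using c that by simp
  qed
  then have ev: "eventually (\<lambda>x. ?F x = ?G x) (at 0)" by (auto simp: eventually_at_filter)
  have F: "(?F \<longlongrightarrow> fdet (V - {r}) (\<lambda>u v. - f u v)) (at 0)"
  proof (rule fdet_tendsto)
    show "((\<lambda>x. (if a = b then x else 0) - f a b - x / card V) \<longlongrightarrow> - f a b) (at 0)" for a b
      using c by (cases "a = b") (auto intro!: tendsto_eq_intros)
  qed (use fin in simp)
  have G: "(?G \<longlongrightarrow> fdet (W - {s}) (\<lambda>u v. - g u v)) (at 0)"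
  proof (rule fdet_tendsto)
    show "((\<lambda>x. (if a = b then x else 0) - g a b - x / card V) \<longlongrightarrow> - g a b) (at 0)" for a b
      using c by (cases "a = b") (auto intro!: tendsto_eq_intros)
  qed (use fin in simp)
  have "(?F \<longlongrightarrow> fdet (W - {s}) (\<lambda>u v. - g u v)) (at 0)"
    using G unfolding tendsto_cong[OF ev] .
  then have "fdet (V - {r}) (\<lambda>u v. - f u v) = fdet (W - {s}) (\<lambda>u v. - g u v)"
    by (rule tendsto_unique[OF at_neq_bot F])
  then show ?thesis using fin r n by (simp add: fdet_uminus card_Diff_singleton)
qed

subsection \<open>Graphs and path-friendship graphs\<close>

definition ugraph :: "'a set \<Rightarrow> ('a \<times> 'a) set \<Rightarrow> bool" where
  "ugraph V E \<longleftrightarrow> finite V \<and> E \<subseteq> V \<times> V \<and> sym E \<and> irrefl E"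

definition deg :: "('a \<times> 'a) set \<Rightarrow> 'a \<Rightarrow> nat" where
  "deg E v = card (E `` {v})"

text \<open>Phrased through sets closed under adjacency rather than walks: a property that
  propagates along arcs can serve directly as \<open>S\<close>, and failure yields a splitting of
  \<open>V\<close> without crossing arcs.\<close>

definition conn :: "'a set \<Rightarrow> ('a \<times> 'a) set \<Rightarrow> bool" where
  "conn V E \<longleftrightarrow> (\<forall>S. S \<subseteq> V \<longrightarrow> S \<noteq> {} \<longrightarrow> E `` S \<subseteq> S \<longrightarrow> S = V)"

definition lap :: "('a \<times> 'a) set \<Rightarrow> 'a \<Rightarrow> 'a \<Rightarrow> real" where
  "lap E u v = (if u = v then real (deg E u) else 0) - (if (u, v) \<in> E then 1 else 0)"

text \<open>Ordered triples: each triangle occurs six times, as in the trace of the cubed adjacency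
  matrix.\<close>

abbreviation closed_3_walks :: "('a \<times> 'a) set \<Rightarrow> ('a \<times> 'a \<times> 'a) set" where
  "closed_3_walks E \<equiv> {(u, v, w). (u, v) \<in> E \<and> (v, w) \<in> E \<and> (w, u) \<in> E}"

definition giso :: "('a \<Rightarrow> 'b) \<Rightarrow> 'a set \<Rightarrow> ('a \<times> 'a) set \<Rightarrow> 'b set \<Rightarrow> ('b \<times> 'b) set \<Rightarrow> bool" where
  "giso f V E W F \<longleftrightarrow> bij_betw f V W \<and> (\<forall>u\<in>V. \<forall>v\<in>V. (u, v) \<in> E \<longleftrightarrow> (f u, f v) \<in> F)"

lemma connD: "conn V E \<Longrightarrow> S \<subseteq> V \<Longrightarrow> v \<in> S \<Longrightarrow> (\<And>u w. u \<in> S \<Longrightarrow> (u, w) \<in> E \<Longrightarrow> w \<in> S) \<Longrightarrow> S = V"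
  unfolding conn_def by (metis ImageE empty_iff subsetI)

lemma ugraphD:
  assumes "ugraph V E"
  shows "finite V" "finite E" "(u, v) \<in> E \<Longrightarrow> u \<in> V" "(u, v) \<in> E \<Longrightarrow> v \<in> V"
    "(u, v) \<in> E \<Longrightarrow> (v, u) \<in> E" "(u, u) \<notin> E" "finite (E `` S)" "E `` S \<subseteq> V"
proof -
  show "finite V" "finite E" using assms finite_subset unfolding ugraph_def by blast+
  show 1: "(u, v) \<in> E \<Longrightarrow> u \<in> V" "(u, v) \<in> E \<Longrightarrow> v \<in> V" "(u, v) \<in> E \<Longrightarrow> (v, u) \<in> E" "(u, u) \<notin> E"
    "E `` S \<subseteq> V"
    using assms unfolding ugraph_def irrefl_def by (auto dest: symD)
  show "finite (E `` S)" using \<open>finite V\<close> 1(5) finite_subset by blast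
qed

lemma sum_deg:
  assumes "ugraph V E"
  shows "(\<Sum>v\<in>V. deg E v) = card E"
proof -
  have "E = Sigma V (\<lambda>v. E `` {v})" using ugraphD[OF assms] by auto
  then have "card E = card (Sigma V (\<lambda>v. E `` {v}))" by simp
  also have "\<dots> = (\<Sum>v\<in>V. deg E v)"
    unfolding deg_def using ugraphD[OF assms] by (intro card_SigmaI) auto
  finally show ?thesis by simp
qed

lemma deg_pos:
  assumes "ugraph V E" "conn V E" "v \<in> V" "w \<in> V" "v \<noteq> w"
  shows "deg E v \<ge> 1"
proof (rule ccontr)
  assume "\<not> deg E v \<ge> 1"
  then have "E `` {v} = {}" using ugraphD(7)[OF assms(1)] by (simp add: deg_def not_less_eq_eq)
  then have "{v} = V" using assms by (intro connD[of V E _ v]) auto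
  then show False using assms by blast
qed

lemma giso_bij: "giso f V E W F \<Longrightarrow> bij_betw f V W"
  by (simp add: giso_def)

lemma giso_sym:
  assumes "giso f V E W F"
  shows "giso (inv_into V f) W F V E"
proof -
  have b: "bij_betw f V W" and E: "\<And>u v. u \<in> V \<Longrightarrow> v \<in> V \<Longrightarrow> (u, v) \<in> E \<longleftrightarrow> (f u, f v) \<in> F"
    using assms by (simp_all add: giso_def)
  have "inv_into V f w \<in> V" "f (inv_into V f w) = w" if "w \<in> W" for w
    using that b bij_betw_apply[OF bij_betw_inv_into[OF b]] bij_betw_inv_into_right[OF b] by blast+
  then show ?thesis using bij_betw_inv_into[OF b] E by (simp add: giso_def)
qed

lemma giso_trans: "giso f V E W F \<Longrightarrow> giso g W F X G \<Longrightarrow> giso (g \<circ> f) V E X G"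
  by (simp add: giso_def bij_betw_trans[of f V W g X] bij_betw_apply[of f V W])

lemma giso_image:
  assumes iso: "giso f V E W F" and E: "ugraph V E" and F: "ugraph W F" and v: "v \<in> V"
  shows "F `` {f v} = f ` (E `` {v})"
proof (intro equalityI subsetI)
  fix y assume "y \<in> F `` {f v}"
  then have y: "(f v, y) \<in> F" by simp
  then obtain u where u: "u \<in> V" "y = f u"
    using ugraphD(4)[OF F] giso_bij[OF iso] by (metis bij_betw_imp_surj_on imageE)
  then have "(v, u) \<in> E" using iso v y unfolding giso_def by blast
  then show "y \<in> f ` (E `` {v})" using u by blast
next
  fix y assume "y \<in> f ` (E `` {v})"
  then obtain u where "(v, u) \<in> E" "y = f u" by blast
  then show "y \<in> F `` {f v}" using iso v ugraphD(4)[OF E] unfolding giso_def by blast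
qed

lemma giso_deg:
  assumes iso: "giso f V E W F" and E: "ugraph V E" and F: "ugraph W F" and v: "v \<in> V"
  shows "deg F (f v) = deg E v"
proof -
  have "inj_on f (E `` {v})"
    using giso_bij[OF iso] ugraphD(8)[OF E] inj_on_subset unfolding bij_betw_def by blast
  then show ?thesis unfolding deg_def giso_image[OF assms] by (rule card_image)
qed

lemma giso_extend_leaf:
  assumes iso: "giso f V E W F" and "E \<subseteq> V \<times> V" "F \<subseteq> W \<times> W" "u \<in> V" "v \<notin> V" "w \<notin> W"
  shows "giso (f(v := w)) (insert v V) (E \<union> {(u, v), (v, u)}) (insert w W) (F \<union> {(f u, w), (w, f u)})"
proof -
  have b: "bij_betw f V W" using iso by (simp add: giso_def)
  have "bij_betw (f(v := w)) V W"
    using b assms by (subst bij_betw_cong[of V _ f]) auto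
  then have "bij_betw (f(v := w)) (insert v V) (insert w W)"
    using assms notIn_Un_bij_betw[of v V "f(v := w)" W] by simp
  moreover have fW: "f a \<in> W" "f a \<noteq> w" if "a \<in> V" for a
    using that b assms(6) by (auto dest: bij_betw_apply)
  moreover have "f a = f u \<longleftrightarrow> a = u" if "a \<in> V" for a
    using that b assms(4) by (auto simp: bij_betw_def dest: inj_onD)
  ultimately show ?thesis
    using assms unfolding giso_def by auto
qed

text \<open>Collects what the inductions on paths, unicyclic graphs and path-friendship graphs need.
  Connectedness survives because a closed set of the smaller graph becomes closed in
  \<open>E\<close> after adding \<open>v\<close> if it contains \<open>u\<close>, and is closed in
  \<open>E\<close> already if it does not.\<close>

lemma leaf_removal:
  assumes E: "ugraph V E" and leaf: "E `` {v} = {u}" and v: "v \<in> V"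
  defines "V' \<equiv> V - {v}" and "E' \<equiv> E - {(u, v), (v, u)}"
  shows "ugraph V' E'" "conn V E \<Longrightarrow> conn V' E'" "E = E' \<union> {(u, v), (v, u)}" "V = insert v V'"
    "u \<in> V'" "card E = card E' + 2" "card V = Suc (card V')"
    "\<And>w. w \<in> V' \<Longrightarrow> E' `` {w} = E `` {w} - {v}"
    "\<And>w. w \<in> V' \<Longrightarrow> deg E w = deg E' w + (if w = u then 1 else 0)"
    "\<And>a b. a \<noteq> v \<Longrightarrow> b \<noteq> v \<Longrightarrow> (a, b) \<in> E \<longleftrightarrow> (a, b) \<in> E'"
proof -
  note D = ugraphD[OF E]
  have vu: "(v, u) \<in> E" "(u, v) \<in> E" "u \<noteq> v" "u \<in> V" using leaf D(4,5,6) by blast+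
  have only: "(v, w) \<in> E \<longleftrightarrow> w = u" "(w, v) \<in> E \<longleftrightarrow> w = u" for w using leaf D(5) by blast+
  show "ugraph V' E'"
    using E only unfolding ugraph_def V'_def E'_def irrefl_def sym_def by blast
  show im: "E' `` {w} = E `` {w} - {v}" if "w \<in> V'" for w
    using that only unfolding E'_def V'_def by auto
  show "E = E' \<union> {(u, v), (v, u)}" "V = insert v V'" "u \<in> V'"
    using vu v unfolding E'_def V'_def by auto
  have "card E = card E' + card {(u, v), (v, u)}"
    unfolding E'_def using vu D(2) card_mono[of E "{(u, v), (v, u)}"] by (subst card_Diff_subset) auto
  then show "card E = card E' + 2" using vu by auto
  show "card V = Suc (card V')"
    unfolding V'_def by (rule card.remove[OF D(1) v])
  show "deg E w = deg E' w + (if w = u then 1 else 0)" if "w \<in> V'" for w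
  proof (cases "w = u")
    case True
    have "card (E `` {u}) = Suc (card (E `` {u} - {v}))" using vu D(7) by (intro card.remove) auto
    then show ?thesis using im that True unfolding deg_def by simp
  next
    case False
    then have "E' `` {w} = E `` {w}" using im that only by auto
    then show ?thesis using False unfolding deg_def by simp
  qed
  show "(a, b) \<in> E \<longleftrightarrow> (a, b) \<in> E'" if "a \<noteq> v" "b \<noteq> v" for a b
    using that unfolding E'_def by auto
  assume c: "conn V E"
  show "conn V' E'" unfolding conn_def
  proof (intro allI impI)
    fix S assume S: "S \<subseteq> V'" "S \<noteq> {}" "E' `` S \<subseteq> S"
    then obtain w where w: "w \<in> S" by blast
    show "S = V'"
    proof (cases "u \<in> S")
      case True
      have "insert v S = V"
      proof (rule connD[OF c, of _ v])
        fix a b assume ab: "a \<in> insert v S" "(a, b) \<in> E"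
        show "b \<in> insert v S"
        proof (cases "a = v \<or> b = v")
          case False
          then have "(a, b) \<in> E'" using ab unfolding E'_def by auto
          then show ?thesis using S(3) ab(1) False by blast
        qed (use only(1) ab True in auto)
      qed (use S v in \<open>auto simp: V'_def\<close>)
      then show ?thesis using S(1) unfolding V'_def by auto
    next
      case False
      have "S = V"
      proof (rule connD[OF c _ w])
        fix a b assume ab: "a \<in> S" "(a, b) \<in> E"
        then have "a \<noteq> v" "a \<noteq> u" using S(1) False unfolding V'_def by auto
        then have "(a, b) \<in> E'" using ab only unfolding E'_def by auto
        then show "b \<in> S" using S(3) ab(1) by blast
      qed (use S in \<open>auto simp: V'_def\<close>)
      then show ?thesis using S(1) v unfolding V'_def by auto
    qed
  qed
qed

section \<open>The standard model: neighbours, degrees, counts\<close>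

abbreviation pf_arcs :: "nat \<Rightarrow> nat list \<Rightarrow> (pf_vertex \<times> pf_vertex) set" where
  "pf_arcs s ts \<equiv> pf_edges s ts \<union> (pf_edges s ts)\<inverse>"

lemma ugraph_pf: "ugraph (pf_verts s ts) (pf_arcs s ts)"
proof -
  interpret pair_graph "pf_graph s ts" by (rule pair_graph_pf_graph)
  have "finite (pf_verts s ts)" using pair_finite_verts by (simp add: pf_graph_def)
  moreover have "pf_edges s ts \<subseteq> pf_verts s ts \<times> pf_verts s ts"
    by (auto simp: pf_edges_def pf_verts_def)
  moreover have "(x, x) \<notin> pf_edges s ts" for x by (auto simp: pf_edges_def)
  ultimately show ?thesis unfolding ugraph_def irrefl_def by (auto intro: symI)
qed

lemma pf_nbrs:
  assumes "\<forall>t\<in>set ts. 1 \<le> t"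
  shows "pf_arcs s ts `` {Center} = {Tri i b | i b. i < s} \<union> {Pth i 0 | i. i < length ts}"
    and "i < s \<Longrightarrow> pf_arcs s ts `` {Tri i b} = {Center, Tri i (\<not> b)}"
    and "i < length ts \<Longrightarrow> j < ts ! i \<Longrightarrow> pf_arcs s ts `` {Pth i j} =
      insert (if j = 0 then Center else Pth i (j - 1)) (if Suc j < ts ! i then {Pth i (Suc j)} else {})"
proof -
  have pos: "0 < ts ! i" if "i < length ts" for i using assms that by (metis nth_mem less_eq_Suc_le One_nat_def)
  show "pf_arcs s ts `` {Center} = {Tri i b | i b. i < s} \<union> {Pth i 0 | i. i < length ts}"
    using pos by (auto simp: pf_edges_def)
  show "i < s \<Longrightarrow> pf_arcs s ts `` {Tri i b} = {Center, Tri i (\<not> b)}"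
    by (cases b) (auto simp: pf_edges_def)
  show "i < length ts \<Longrightarrow> j < ts ! i \<Longrightarrow> pf_arcs s ts `` {Pth i j} =
      insert (if j = 0 then Center else Pth i (j - 1)) (if Suc j < ts ! i then {Pth i (Suc j)} else {})"
    by (cases j) (auto simp: pf_edges_def)
qed

lemma card_tris: "card {Tri i b | i b. i < s} = 2 * s" "finite {Tri i b | i b. i < s}"
proof -
  have "{Tri i b | i b. i < s} = (\<lambda>(i, b). Tri i b) ` ({..<s} \<times> UNIV)" by auto
  moreover have "inj_on (\<lambda>(i, b). Tri i b) ({..<s} \<times> UNIV)" by (auto simp: inj_on_def)
  ultimately show "card {Tri i b | i b. i < s} = 2 * s" "finite {Tri i b | i b. i < s}"
    by (simp_all add: card_image card_cartesian_product)
qed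

lemma pf_deg:
  assumes "\<forall>t\<in>set ts. 1 \<le> t"
  shows "deg (pf_arcs s ts) Center = 2 * s + length ts"
    and "i < s \<Longrightarrow> deg (pf_arcs s ts) (Tri i b) = 2"
    and "i < length ts \<Longrightarrow> j < ts ! i \<Longrightarrow> deg (pf_arcs s ts) (Pth i j) = (if Suc j < ts ! i then 2 else 1)"
proof -
  have P: "{Pth i 0 | i. i < length ts} = (\<lambda>i. Pth i 0) ` {..<length ts}" by auto
  have "card {Pth i 0 | i. i < length ts} = length ts"
    unfolding P by (subst card_image) (auto simp: inj_on_def)
  then show "deg (pf_arcs s ts) Center = 2 * s + length ts"
    unfolding deg_def pf_nbrs(1)[OF assms]
    using card_tris[of s] P by (subst card_Un_disjoint) auto
  show "i < s \<Longrightarrow> deg (pf_arcs s ts) (Tri i b) = 2"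
    unfolding deg_def by (simp only: pf_nbrs(2)[OF assms]) simp
  show "i < length ts \<Longrightarrow> j < ts ! i \<Longrightarrow> deg (pf_arcs s ts) (Pth i j) = (if Suc j < ts ! i then 2 else 1)"
    unfolding deg_def by (simp only: pf_nbrs(3)[OF assms]) (auto simp: card_insert_if)
qed

lemma pf_deg_le:
  assumes "\<forall>t\<in>set ts. 1 \<le> t" "v \<in> pf_verts s ts" "v \<noteq> Center"
  shows "deg (pf_arcs s ts) v \<le> 2" "deg (pf_arcs s ts) v \<ge> 1"
proof -
  consider i b where "v = Tri i b" "i < s" | i j where "v = Pth i j" "i < length ts" "j < ts ! i"
    using assms(2,3) by (auto simp: pf_verts_def)
  then have "deg (pf_arcs s ts) v \<le> 2 \<and> deg (pf_arcs s ts) v \<ge> 1"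
    by cases (simp_all only: pf_deg[OF assms(1)], auto)
  then show "deg (pf_arcs s ts) v \<le> 2" "deg (pf_arcs s ts) v \<ge> 1" by auto
qed

lemma pf_sum:
  "(\<Sum>v\<in>pf_verts s ts. h v) = h Center + (\<Sum>i<s. h (Tri i False) + h (Tri i True))
    + (\<Sum>i<length ts. \<Sum>j<ts ! i. h (Pth i j))"
proof -
  let ?T = "(\<lambda>(i, b). Tri i b) ` ({..<s} \<times> UNIV)" and ?P = "(\<lambda>(i, j). Pth i j) ` (SIGMA i:{..<length ts}. {..<ts ! i})"
  have V: "pf_verts s ts = insert Center (?T \<union> ?P)" by (auto simp: pf_verts_def)
  have "(\<Sum>v\<in>pf_verts s ts. h v) = h Center + (\<Sum>v\<in>?T \<union> ?P. h v)"
    unfolding V by (subst sum.insert) auto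
  also have "(\<Sum>v\<in>?T \<union> ?P. h v) = (\<Sum>v\<in>?T. h v) + (\<Sum>v\<in>?P. h v)"
    by (subst sum.union_disjoint) auto
  also have "(\<Sum>v\<in>?T. h v) = (\<Sum>(i, b)\<in>{..<s} \<times> UNIV. h (Tri i b))"
    by (subst sum.reindex) (auto simp: inj_on_def case_prod_beta comp_def)
  also have "\<dots> = (\<Sum>i<s. \<Sum>b\<in>UNIV. h (Tri i b))" by (rule sum.cartesian_product[symmetric])
  also have "\<dots> = (\<Sum>i<s. h (Tri i False) + h (Tri i True))" by (simp add: UNIV_bool)
  also have "(\<Sum>v\<in>?P. h v) = (\<Sum>(i, j)\<in>(SIGMA i:{..<length ts}. {..<ts ! i}). h (Pth i j))"
    by (subst sum.reindex) (auto simp: inj_on_def case_prod_beta comp_def)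
  also have "\<dots> = (\<Sum>i<length ts. \<Sum>j<ts ! i. h (Pth i j))"
    by (rule sum.Sigma[symmetric]) auto
  finally show ?thesis by (simp add: add.assoc)
qed

lemma pf_card_verts: "card (pf_verts s ts) = 1 + 2 * s + sum_list ts"
proof -
  have "card (pf_verts s ts) = (\<Sum>v\<in>pf_verts s ts. 1)" by simp
  also have "\<dots> = 1 + 2 * s + (\<Sum>i<length ts. ts ! i)" unfolding pf_sum by simp
  finally show ?thesis by (simp add: sum_list_sum_nth atLeast0LessThan)
qed

lemma pf_card_arcs:
  assumes ts: "\<forall>t\<in>set ts. 1 \<le> t"
  shows "card (pf_arcs s ts) = 2 * (card (pf_verts s ts) - 1 + s)"
proof -
  have path: "(\<Sum>j<ts ! i. deg (pf_arcs s ts) (Pth i j)) + 1 = 2 * ts ! i" if i: "i < length ts" for i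
  proof -
    obtain m where m: "ts ! i = Suc m" using ts i by (metis nth_mem Suc_le_D One_nat_def)
    have "(\<Sum>j<ts ! i. deg (pf_arcs s ts) (Pth i j)) = (\<Sum>j<ts ! i. if Suc j < ts ! i then 2 else 1)"
      using i by (intro sum.cong) (auto simp: pf_deg[OF ts])
    also have "\<dots> = 2 * m + 1" unfolding m by simp
    finally show ?thesis using m by simp
  qed
  have "(\<Sum>i<length ts. \<Sum>j<ts ! i. deg (pf_arcs s ts) (Pth i j)) + length ts =
      (\<Sum>i<length ts. (\<Sum>j<ts ! i. deg (pf_arcs s ts) (Pth i j)) + 1)"
    by (simp only: sum.distrib) simp
  also have "\<dots> = (\<Sum>i<length ts. 2 * ts ! i)" by (intro sum.cong refl path) simp
  also have "\<dots> = 2 * sum_list ts"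
    by (simp add: sum_list_sum_nth atLeast0LessThan sum_distrib_left)
  finally have P: "(\<Sum>i<length ts. \<Sum>j<ts ! i. deg (pf_arcs s ts) (Pth i j)) + length ts = 2 * sum_list ts" .
  have "(\<Sum>i<s. deg (pf_arcs s ts) (Tri i False) + deg (pf_arcs s ts) (Tri i True)) = (\<Sum>i<s. 4)"
    by (intro sum.cong) (auto simp: pf_deg[OF ts])
  then show ?thesis
    using P unfolding sum_deg[OF ugraph_pf, symmetric] pf_sum pf_card_verts pf_deg(1)[OF ts] by simp
qed

lemma conn_pf:
  assumes ts: "\<forall>t\<in>set ts. 1 \<le> t"
  shows "conn (pf_verts s ts) (pf_arcs s ts)"
  unfolding conn_def
proof (intro allI impI)
  fix S assume S: "S \<subseteq> pf_verts s ts" "S \<noteq> {}" "pf_arcs s ts `` S \<subseteq> S"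
  have step: "w \<in> S" if "v \<in> S" "w \<in> pf_arcs s ts `` {v}" for v w using that S(3) by blast
  have down: "Center \<in> S" if "Pth i j \<in> S" "i < length ts" "j < ts ! i" for i j
    using that
  proof (induction j)
    case 0
    then show ?case using step[of "Pth i 0" Center] by (simp only: pf_nbrs(3)[OF ts]) simp
  next
    case (Suc j)
    then have "Pth i j \<in> S" using step[of "Pth i (Suc j)" "Pth i j"] by (simp only: pf_nbrs(3)[OF ts]) simp
    then show ?case using Suc by simp
  qed
  obtain v where v: "v \<in> S" using S(2) by blast
  have c: "Center \<in> S"
  proof (cases v)
    case (Tri i b)
    then have "i < s" using v S(1) by (auto simp: pf_verts_def)
    then show ?thesis using step[of "Tri i b" Center] v Tri by (simp only: pf_nbrs(2)[OF ts]) simp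
  next
    case (Pth i j)
    then show ?thesis using down[of i j] v S(1) by (auto simp: pf_verts_def)
  qed (use v in simp)
  have up: "Pth i j \<in> S" if "i < length ts" "j < ts ! i" for i j
    using that
  proof (induction j)
    case 0
    then show ?case using step[OF c, of "Pth i 0"] by (simp only: pf_nbrs(1)[OF ts]) simp
  next
    case (Suc j)
    then show ?case using step[of "Pth i j" "Pth i (Suc j)"] by (simp only: pf_nbrs(3)[OF ts]) simp
  qed
  have "Tri i b \<in> S" if "i < s" for i b
    using step[OF c, of "Tri i b"] that by (simp only: pf_nbrs(1)[OF ts]) simp
  then show "S = pf_verts s ts" using S(1) c up by (auto simp: pf_verts_def)
qed

section \<open>Triangles and the recognition of path-friendship graphs\<close>

definition center_triangles :: "('a \<times> 'a) set \<Rightarrow> 'a \<Rightarrow> ('a \<times> 'a) set" where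
  "center_triangles E c = {(u, v). (u, v) \<in> E \<and> (c, u) \<in> E \<and> (c, v) \<in> E}"

lemma pf_center_triangles:
  assumes ts: "\<forall>t\<in>set ts. 1 \<le> t"
  shows "card (center_triangles (pf_arcs s ts) Center) = 2 * s"
proof -
  have "center_triangles (pf_arcs s ts) Center = (\<lambda>(i, b). (Tri i b, Tri i (\<not> b))) ` ({..<s} \<times> UNIV)"
    by (auto simp: center_triangles_def pf_edges_def image_iff)
  moreover have "inj_on (\<lambda>(i, b). (Tri i b, Tri i (\<not> b))) ({..<s} \<times> UNIV)" by (auto simp: inj_on_def)
  ultimately show ?thesis by (simp add: card_image card_cartesian_product)
qed

text \<open>A triangle avoiding \<open>c\<close> would use up the degrees of its three vertices, so
  it would be closed under adjacency and, by connectedness, all of \<open>V\<close>. The factor 3 is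
  the position of \<open>c\<close> in the ordered triple; \<open>center_triangles\<close> already
  counts both orders of the other two vertices.\<close>

lemma card_triangles:
  assumes E: "ugraph V E" "conn V E" and c: "c \<in> V" and d: "\<And>v. v \<in> V \<Longrightarrow> v \<noteq> c \<Longrightarrow> deg E v \<le> 2"
  shows "card (closed_3_walks E) = 3 * card (center_triangles E c)"
proof -
  note D = ugraphD[OF E(1)]
  let ?A = "(\<lambda>(u, v). (c, u, v)) ` center_triangles E c" and ?B = "(\<lambda>(u, v). (u, c, v)) ` center_triangles E c"
    and ?C = "(\<lambda>(u, v). (u, v, c)) ` center_triangles E c"
  have has_c: "u = c \<or> v = c \<or> w = c" if t: "(u, v) \<in> E" "(v, w) \<in> E" "(w, u) \<in> E" for u v w
  proof (rule ccontr)
    assume neg: "\<not> ?thesis"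
    have two: "E `` {a} = {x, y}" if "a \<in> V" "a \<noteq> c" "(a, x) \<in> E" "(a, y) \<in> E" "x \<noteq> y" for a x y
    proof -
      have "card (E `` {a}) \<le> card {x, y}" using d[OF that(1,2)] that(5) by (simp add: deg_def)
      then show ?thesis using card_seteq[of "E `` {a}" "{x, y}"] D(7) that by auto
    qed
    have ne: "u \<noteq> v" "v \<noteq> w" "w \<noteq> u" using t D(6) by auto
    have "E `` {u} = {v, w}" "E `` {v} = {u, w}" "E `` {w} = {u, v}"
      using neg t ne D(3,4,5) by (intro two; blast)+
    then have "{u, v, w} = V" using t D(3,4) by (intro connD[OF E(2), of _ u]) blast+
    then show False using c neg by blast
  qed
  have eq: "(closed_3_walks E) = ?A \<union> ?B \<union> ?C" (is "?T = _")
  proof (intro equalityI subsetI)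
    fix x assume "x \<in> ?T"
    then obtain u v w where x: "x = (u, v, w)" "(u, v) \<in> E" "(v, w) \<in> E" "(w, u) \<in> E" by auto
    have "x \<in> ?A \<or> x \<in> ?B \<or> x \<in> ?C"
      using has_c[OF x(2-4)] x D(5) unfolding center_triangles_def by (auto simp: image_iff)
    then show "x \<in> ?A \<union> ?B \<union> ?C" by blast
  next
    fix x assume "x \<in> ?A \<union> ?B \<union> ?C"
    then show "x \<in> ?T" using D(5) unfolding center_triangles_def by auto
  qed
  have fin: "finite (center_triangles E c)" by (rule finite_subset[OF _ D(2)]) (auto simp: center_triangles_def)
  have disj: "?A \<inter> ?B = {}" "(?A \<union> ?B) \<inter> ?C = {}" using D(6) unfolding center_triangles_def by auto
  have "card ?A = card (center_triangles E c)" "card ?B = card (center_triangles E c)" "card ?C = card (center_triangles E c)"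
    by (intro card_image; auto simp: inj_on_def)+
  then show ?thesis unfolding eq using fin disj by (simp add: card_Un_disjoint)
qed

text \<open>Peels off one orbit \<open>{u, m u}\<close> at a time. This provides the labels
  \<open>Tri i b\<close> of a friendship graph: \<open>i\<close> numbers the triangles, and
  \<open>m\<close>, the partner within a triangle, flips \<open>b\<close>.\<close>

lemma involution_pairing:
  assumes "finite N" "card N = 2 * s" "\<And>u. u \<in> N \<Longrightarrow> m u \<in> N \<and> m (m u) = u \<and> m u \<noteq> u"
  shows "\<exists>g. bij_betw g N ({..<s} \<times> (UNIV :: bool set)) \<and> (\<forall>u\<in>N. g (m u) = (fst (g u), \<not> snd (g u)))"
  using assms
proof (induction s arbitrary: N)
  case 0
  then show ?case by (auto simp: bij_betw_def)
next
  case (Suc s)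
  then have "N \<noteq> {}" by auto
  then obtain u where u: "u \<in> N" by blast
  note m = Suc.prems(3)
  have mu: "m u \<in> N" "m (m u) = u" "m u \<noteq> u" using m[OF u] by auto
  define N' where "N' = N - {u, m u}"
  have N: "N = insert u (insert (m u) N')" "u \<notin> insert (m u) N'" "m u \<notin> N'"
    using u mu by (auto simp: N'_def)
  have N'm: "m w \<in> N' \<and> m (m w) = w \<and> m w \<noteq> w" if "w \<in> N'" for w
  proof -
    have w: "w \<in> N" "w \<noteq> u" "w \<noteq> m u" using that by (auto simp: N'_def)
    then have "m w \<noteq> u" "m w \<noteq> m u" using m[OF w(1)] mu(2) by metis+
    then show ?thesis using m[OF w(1)] by (simp add: N'_def)
  qed
  have fin: "finite N'" using Suc.prems(1) by (simp add: N'_def)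
  have "card N = Suc (Suc (card N'))" unfolding N(1) using N(2,3) fin by simp
  then have "card N' = 2 * s" using Suc.prems(2) by simp
  then obtain g where g: "bij_betw g N' ({..<s} \<times> (UNIV :: bool set))"
      "\<And>u. u \<in> N' \<Longrightarrow> g (m u) = (fst (g u), \<not> snd (g u))"
    using Suc.IH[OF fin _ N'm] by blast
  define g' where "g' = g(u := (s, False), m u := (s, True))"
  have g'N: "g' w = g w" if "w \<in> N'" for w using that N by (auto simp: g'_def)
  have g'u: "g' u = (s, False)" "g' (m u) = (s, True)" using mu(3) by (auto simp: g'_def)
  have "bij_betw g' N' ({..<s} \<times> UNIV)" using g(1) g'N bij_betw_cong[of N' g' g] by simp
  then have "bij_betw g' (insert (m u) N') (insert (s, True) ({..<s} \<times> UNIV))"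
    using notIn_Un_bij_betw[of "m u" N' g' "{..<s} \<times> UNIV"] N g'u by simp
  then have "bij_betw g' (insert u (insert (m u) N')) (insert (s, False) (insert (s, True) ({..<s} \<times> UNIV)))"
    using notIn_Un_bij_betw[of u "insert (m u) N'" g' "insert (s, True) ({..<s} \<times> UNIV)"] N g'u by simp
  moreover have "insert (s, False) (insert (s, True) ({..<s} \<times> UNIV)) = {..<Suc s} \<times> (UNIV :: bool set)"
    by (auto simp: less_Suc_eq)
  ultimately have "bij_betw g' N ({..<Suc s} \<times> UNIV)" using N(1) by simp
  moreover have "g' (m w) = (fst (g' w), \<not> snd (g' w))" if w: "w \<in> N" for w
  proof -
    consider "w = u" | "w = m u" | "w \<in> N'" using w N(1) by blast
    then show ?thesis
    proof cases
      case 3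
      then show ?thesis using g'N[OF 3] g'N[of "m w"] N'm[OF 3] g(2)[OF 3] by simp
    qed (use mu g'u in simp_all)
  qed
  ultimately show ?case by blast
qed

text \<open>Degree counting gives \<open>c\<close> exactly \<open>2 * s\<close> neighbours. Each of
  them has only one neighbour besides \<open>c\<close>, so the \<open>2 * s\<close> arcs counted by
  \<open>tri\<close> start at different neighbours and hence at all of them; the neighbours are
  matched in pairs and, together with \<open>c\<close>, exhaust \<open>V\<close>.\<close>

lemma friendship_structure:
  assumes E: "ugraph V E" "conn V E" and c: "c \<in> V"
    and d: "\<And>v. v \<in> V \<Longrightarrow> v \<noteq> c \<Longrightarrow> deg E v = 2"
    and arcs: "card E = 2 * (card V - 1 + s)" and tri: "card (center_triangles E c) = 2 * s"
  shows "\<exists>f. giso f V E (pf_verts s []) (pf_arcs s []) \<and> f c = Center"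
proof -
  note D = ugraphD[OF E(1)]
  define N where "N = E `` {c}"
  have N: "finite N" "N \<subseteq> V" "c \<notin> N" using D(7,8) D(6) by (auto simp: N_def)
  have V: "card V > 0" using c D(1) by (simp add: card_gt_0_iff) blast
  have "card E = (\<Sum>v\<in>V. deg E v)" using sum_deg[OF E(1)] by simp
  also have "\<dots> = deg E c + (\<Sum>v\<in>V - {c}. deg E v)" using D(1) c by (rule sum.remove)
  also have "(\<Sum>v\<in>V - {c}. deg E v) = (\<Sum>v\<in>V - {c}. 2)" by (intro sum.cong) (auto simp: d)
  also have "\<dots> = 2 * (card V - 1)" using c D(1) by simp
  finally have "deg E c = 2 * s" using arcs by simp
  then have cN: "card N = 2 * s" by (simp add: deg_def N_def)
  have two: "E `` {u} = {c, w}" if "u \<in> N" "(u, w) \<in> E" "w \<noteq> c" for u w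
  proof -
    have u: "u \<in> V" "u \<noteq> c" "(u, c) \<in> E" using that(1) N D(5) by (auto simp: N_def)
    have "card (E `` {u}) = card {c, w}" using d[OF u(1,2)] that(3) by (simp add: deg_def)
    then show ?thesis using card_seteq[of "E `` {u}" "{c, w}"] D(7) that u by auto
  qed
  have T: "center_triangles E c = {(u, v). (u, v) \<in> E \<and> u \<in> N \<and> v \<in> N}" by (auto simp: center_triangles_def N_def)
  have "inj_on fst (center_triangles E c)"
  proof (rule inj_onI)
    fix x y assume xy: "x \<in> center_triangles E c" "y \<in> center_triangles E c" "fst x = fst y"
    then have x: "(fst x, snd x) \<in> E" "fst x \<in> N" "snd x \<in> N" "(fst x, snd y) \<in> E" "snd y \<in> N"
      by (auto simp: T)
    then have "snd x \<noteq> c" "snd y \<noteq> c" using N(3) by auto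
    then have "{c, snd x} = {c, snd y}" using two[OF x(2,1)] two[OF x(2,4)] by simp
    then have "snd x = snd y" using \<open>snd x \<noteq> c\<close> \<open>snd y \<noteq> c\<close> by auto
    then show "x = y" using xy(3) by (simp add: prod_eq_iff)
  qed
  then have "card (fst ` center_triangles E c) = card N" using tri cN by (simp add: card_image)
  moreover have "fst ` center_triangles E c \<subseteq> N" by (auto simp: T)
  ultimately have fstN: "fst ` center_triangles E c = N" using N(1) card_subset_eq by blast
  have "\<exists>w. w \<in> N \<and> E `` {u} = {c, w}" if "u \<in> N" for u
  proof -
    have "u \<in> fst ` center_triangles E c" using that fstN by simp
    then obtain w where w: "(u, w) \<in> E" "w \<in> N" by (auto simp: T)
    then show ?thesis using two[OF that w(1)] N(3) by auto
  qed
  then obtain m where m: "\<And>u. u \<in> N \<Longrightarrow> m u \<in> N \<and> E `` {u} = {c, m u}" by metis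
  have mm: "m u \<in> N \<and> m (m u) = u \<and> m u \<noteq> u" if "u \<in> N" for u
  proof -
    have mu: "m u \<in> N" "(u, m u) \<in> E" using m[OF that] by auto
    then have "u \<in> E `` {m u}" using D(5) by simp
    then have "u = m (m u)" using m[OF mu(1)] that N(3) by auto
    then show ?thesis using mu D(6) by metis
  qed
  obtain g where g: "bij_betw g N ({..<s} \<times> (UNIV :: bool set))"
      "\<And>u. u \<in> N \<Longrightarrow> g (m u) = (fst (g u), \<not> snd (g u))"
    using involution_pairing[of N s m] N(1) cN mm by blast
  have V: "V = insert c N"
  proof (rule connD[OF E(2), symmetric, of _ c])
    fix u w assume "u \<in> insert c N" "(u, w) \<in> E"
    then show "w \<in> insert c N" using m by (auto simp: N_def)
  qed (use N c in auto)
  define f where "f v = (if v = c then Center else Tri (fst (g v)) (snd (g v)))" for v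
  have fN: "f v = Tri (fst (g v)) (snd (g v))" if "v \<in> N" for v using that N(3) by (auto simp: f_def)
  have gs: "fst (g v) < s" if "v \<in> N" for v using bij_betw_apply[OF g(1) that] by auto
  have "bij_betw (\<lambda>(i, b). Tri i b) ({..<s} \<times> UNIV) {Tri i b | i b. i < s}"
    by (auto simp: bij_betw_def inj_on_def)
  then have "bij_betw ((\<lambda>(i, b). Tri i b) \<circ> g) N {Tri i b | i b. i < s}"
    using g(1) bij_betw_trans by blast
  then have "bij_betw f N {Tri i b | i b. i < s}"
    using bij_betw_cong[of N f "(\<lambda>(i, b). Tri i b) \<circ> g"] fN by (simp add: case_prod_beta)
  then have "bij_betw f (insert c N) (insert Center {Tri i b | i b. i < s})"
    using notIn_Un_bij_betw[of c N f "{Tri i b | i b. i < s}"] N(3) by (simp add: f_def)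
  moreover have "pf_verts s [] = insert Center {Tri i b | i b. i < s}" by (auto simp: pf_verts_def)
  ultimately have bij: "bij_betw f V (pf_verts s [])" using V by simp
  have nb: "pf_arcs s [] `` {Center} = {Tri i b | i b. i < s}"
    "\<And>i b. i < s \<Longrightarrow> pf_arcs s [] `` {Tri i b} = {Center, Tri i (\<not> b)}"
  proof -
    show "pf_arcs s [] `` {Center} = {Tri i b | i b. i < s}" using pf_nbrs(1)[of "[]" s] by simp
    show "pf_arcs s [] `` {Tri i b} = {Center, Tri i (\<not> b)}" if "i < s" for i b
      by (rule pf_nbrs(2)) (use that in simp_all)
  qed
  have "(u, v) \<in> E \<longleftrightarrow> (f u, f v) \<in> pf_arcs s []" if uv: "u \<in> V" "v \<in> V" for u v
  proof -
    have "v \<in> E `` {u} \<longleftrightarrow> f v \<in> pf_arcs s [] `` {f u}"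
    proof (cases "u = c")
      case True
      have "f v \<in> {Tri i b | i b. i < s} \<longleftrightarrow> v \<in> N"
        using V uv(2) fN gs N(3) by (auto simp: f_def)
      then show ?thesis using True nb(1) by (simp add: f_def N_def)
    next
      case False
      then have u: "u \<in> N" using V uv by auto
      have "f v = f (m u) \<longleftrightarrow> v = m u"
        using bij uv u mm[OF u] N(2) by (auto simp: bij_betw_def dest: inj_onD)
      moreover have "f (m u) = Tri (fst (g u)) (\<not> snd (g u))" using fN mm[OF u] g(2)[OF u] by auto
      moreover have "f v = Center \<longleftrightarrow> v = c" by (simp add: f_def)
      ultimately show ?thesis
        using m[OF u] nb(2)[OF gs[OF u], of "snd (g u)"] fN[OF u] by simp
    qed
    then show ?thesis by simp
  qed
  then show ?thesis using bij by (intro exI[of _ f]) (simp add: giso_def f_def)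
qed

lemma pf_append_path:
  "pf_verts s (ts @ [1]) = insert (Pth (length ts) 0) (pf_verts s ts)"
  "pf_arcs s (ts @ [1]) = pf_arcs s ts \<union> {(Center, Pth (length ts) 0), (Pth (length ts) 0, Center)}"
proof -
  show "pf_verts s (ts @ [1]) = insert (Pth (length ts) 0) (pf_verts s ts)"
    by (auto simp: pf_verts_def nth_append less_Suc_eq split: if_splits)
  have "pf_edges s (ts @ [1]) = insert (Center, Pth (length ts) 0) (pf_edges s ts)"
    by (auto simp: pf_edges_def nth_append less_Suc_eq split: if_splits)
  then show "pf_arcs s (ts @ [1]) = pf_arcs s ts \<union> {(Center, Pth (length ts) 0), (Pth (length ts) 0, Center)}"
    by auto
qed

lemma pf_extend_path:
  assumes i: "i < length ts" "ts ! i = Suc j"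
  shows "pf_verts s (ts[i := Suc (Suc j)]) = insert (Pth i (Suc j)) (pf_verts s ts)"
    "pf_arcs s (ts[i := Suc (Suc j)]) = pf_arcs s ts \<union> {(Pth i j, Pth i (Suc j)), (Pth i (Suc j), Pth i j)}"
proof -
  show "pf_verts s (ts[i := Suc (Suc j)]) = insert (Pth i (Suc j)) (pf_verts s ts)"
  proof (rule Set.set_eqI)
    fix v show "v \<in> pf_verts s (ts[i := Suc (Suc j)]) \<longleftrightarrow> v \<in> insert (Pth i (Suc j)) (pf_verts s ts)"
      using i by (cases v) (auto simp: pf_verts_def nth_list_update less_Suc_eq)
  qed
  have "(u, v) \<in> pf_edges s (ts[i := Suc (Suc j)]) \<longleftrightarrow> (u, v) \<in> insert (Pth i j, Pth i (Suc j)) (pf_edges s ts)" for u v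
    using i by (cases u; cases v) (auto simp: pf_edges_def nth_list_update less_Suc_eq)
  then have "pf_edges s (ts[i := Suc (Suc j)]) = insert (Pth i j, Pth i (Suc j)) (pf_edges s ts)"
    by (auto simp del: insert_iff)
  then show "pf_arcs s (ts[i := Suc (Suc j)]) = pf_arcs s ts \<union> {(Pth i j, Pth i (Suc j)), (Pth i (Suc j), Pth i j)}"
    by auto
qed

text \<open>Deleting a leaf other than \<open>c\<close> keeps the cyclomatic number and the
  triangles at \<open>c\<close>, and without such leaves all degrees off \<open>c\<close> are 2.
  Going back, the leaf opens a new path at the center or prolongs an old one; carrying
  \<open>f c = Center\<close> through the induction tells these cases apart.\<close>

theorem path_friendship_structure:
  assumes "ugraph V E" "conn V E" "c \<in> V"
    and "\<And>v. v \<in> V \<Longrightarrow> v \<noteq> c \<Longrightarrow> deg E v \<le> 2"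
    and "card E = 2 * (card V - 1 + s)" "card (center_triangles E c) = 2 * s"
  shows "\<exists>ts f. (\<forall>t\<in>set ts. 1 \<le> t) \<and> giso f V E (pf_verts s ts) (pf_arcs s ts) \<and> f c = Center"
  using assms
proof (induction "card V" arbitrary: V E rule: less_induct)
  case less
  note E = less.prems(1,2) and c = less.prems(3) and d = less.prems(4) and arcs = less.prems(5)
    and tri = less.prems(6)
  note D = ugraphD[OF E(1)]
  show ?case
  proof (cases "\<exists>v\<in>V. v \<noteq> c \<and> deg E v = 1")
    case False
    have "deg E v = 2" if "v \<in> V" "v \<noteq> c" for v
    proof -
      have "deg E v \<noteq> 1" using False that by blast
      then show ?thesis using d[OF that] deg_pos[OF E that(1) c that(2)] by linarith
    qed
    then obtain f where "giso f V E (pf_verts s []) (pf_arcs s [])" "f c = Center"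
      using friendship_structure[OF E c _ arcs tri] by blast
    then show ?thesis by (intro exI[of _ "[]"] exI[of _ f]) simp
  next
    case True
    then obtain v u where v: "v \<in> V" "v \<noteq> c" "E `` {v} = {u}"
      by (auto simp: deg_def card_1_singleton_iff)
    define V' where "V' = V - {v}"
    define E' where "E' = E - {(u, v), (v, u)}"
    note L = leaf_removal[OF E(1) v(3,1), folded V'_def E'_def]
    have c': "c \<in> V'" using c v(2) by (simp add: V'_def)
    have d': "deg E' w \<le> 2" if "w \<in> V'" "w \<noteq> c" for w
      using L(9)[OF that(1)] d[of w] that by (simp add: V'_def split: if_splits)
    have "card V' > 0" using c' ugraphD(1)[OF L(1)] by (simp add: card_gt_0_iff) blast
    then have arcs': "card E' = 2 * (card V' - 1 + s)" using arcs L(6,7) by simp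
    have "(v, a) \<in> E \<longleftrightarrow> a = u" "(a, v) \<in> E \<longleftrightarrow> a = u" for a using v(3) D(5) by blast+
    then have "center_triangles E' c = center_triangles E c" using D(6) v(2) unfolding center_triangles_def E'_def by auto
    then have tri': "card (center_triangles E' c) = 2 * s" using tri by simp
    obtain ts f where f: "\<forall>t\<in>set ts. 1 \<le> t" "giso f V' E' (pf_verts s ts) (pf_arcs s ts)" "f c = Center"
      using less.hyps[OF _ L(1) L(2)[OF E(2)] c' d' arcs' tri'] L(7) by auto
    have sub: "E' \<subseteq> V' \<times> V'" "pf_arcs s ts \<subseteq> pf_verts s ts \<times> pf_verts s ts"
      using L(1) ugraph_pf[of s ts] by (simp_all add: ugraph_def)
    have vV': "v \<notin> V'" by (simp add: V'_def)
    have fu: "f u \<in> pf_verts s ts" by (rule bij_betw_apply[OF giso_bij[OF f(2)] L(5)])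
    have ext: "giso (f(v := w)) V E (insert w (pf_verts s ts)) (pf_arcs s ts \<union> {(f u, w), (w, f u)})"
      if "w \<notin> pf_verts s ts" for w
      using giso_extend_leaf[OF f(2) sub L(5) vV' that] unfolding L(3)[symmetric] L(4)[symmetric] .
    show ?thesis
    proof (cases "u = c")
      case True
      let ?w = "Pth (length ts) 0"
      have "?w \<notin> pf_verts s ts" by (auto simp: pf_verts_def)
      from ext[OF this] have "giso (f(v := ?w)) V E (pf_verts s (ts @ [1])) (pf_arcs s (ts @ [1]))"
        unfolding pf_append_path True f(3) .
      then show ?thesis using f(1,3) v(2) by (intro exI[of _ "ts @ [1]"] exI[of _ "f(v := ?w)"]) auto
    next
      case False
      have "f u \<noteq> Center"
      proof
        assume "f u = Center"
        then have "f u = f c" using f(3) by simp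
        then show False using giso_bij[OF f(2)] L(5) c' False by (auto simp: bij_betw_def dest: inj_onD)
      qed
      \<comment> \<open>\<open>u\<close> has degree at most 2 and has lost the arc to
        \<open>v\<close>, so its image is the free end of a path.\<close>
      moreover have "deg (pf_arcs s ts) (f u) \<le> 1"
        using giso_deg[OF f(2) L(1) ugraph_pf L(5)] L(9)[OF L(5)] d[of u] False L(5) by (simp add: V'_def)
      ultimately obtain i j where ij: "f u = Pth i j" "i < length ts" "j < ts ! i" "\<not> Suc j < ts ! i"
      proof -
        consider i b where "f u = Tri i b" "i < s" | i j where "f u = Pth i j" "i < length ts" "j < ts ! i"
          using fu \<open>f u \<noteq> Center\<close> by (auto simp: pf_verts_def)
        then show ?thesis
        proof cases
          case (1 i b)
          then show ?thesis using \<open>deg (pf_arcs s ts) (f u) \<le> 1\<close> pf_deg(2)[OF f(1)] by simp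
        next
          case (2 i j)
          then show ?thesis using \<open>deg (pf_arcs s ts) (f u) \<le> 1\<close> pf_deg(3)[OF f(1) 2(2,3), of s] that
            by (simp split: if_splits)
        qed
      qed
      then have tsi: "ts ! i = Suc j" by simp
      let ?w = "Pth i (Suc j)"
      have "?w \<notin> pf_verts s ts" using tsi by (auto simp: pf_verts_def)
      from ext[OF this] have "giso (f(v := ?w)) V E (pf_verts s (ts[i := Suc (Suc j)])) (pf_arcs s (ts[i := Suc (Suc j)]))"
        unfolding pf_extend_path[OF ij(2) tsi] ij(1) .
      moreover have "\<forall>t\<in>set (ts[i := Suc (Suc j)]). 1 \<le> t"
        using f(1) set_update_subset_insert[of ts i "Suc (Suc j)"] by auto
      ultimately show ?thesis using f(3) v(2)
        by (intro exI[of _ "ts[i := Suc (Suc j)]"] exI[of _ "f(v := ?w)"]) auto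
    qed
  qed
qed

subsection \<open>The Laplacian form\<close>

lemma lap_sym: "ugraph V E \<Longrightarrow> lap E u v = lap E v u"
  using ugraphD(5)[of V E] by (auto simp: lap_def)

lemma sum_nbrs:
  assumes "ugraph V E"
  shows "(\<Sum>v\<in>V. if (u, v) \<in> E then h v else 0) = (\<Sum>v\<in>E `` {u}. h v)"
proof -
  have "E `` {u} = {v \<in> V. (u, v) \<in> E}" using ugraphD[OF assms] by auto
  then show ?thesis using ugraphD(1)[OF assms] by (simp add: sum.inter_filter)
qed

lemma fmul_lap:
  assumes E: "ugraph V E" and u: "u \<in> V"
  shows "fmul V (lap E) g u v = real (deg E u) * g u v - (\<Sum>w\<in>E `` {u}. g w v)"
proof -
  have "fmul V (lap E) g u v = (\<Sum>w\<in>V. (if u = w then real (deg E u) * g w v else 0) - (if (u, w) \<in> E then g w v else 0))"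
    unfolding fmul_def lap_def by (intro sum.cong) (auto simp: algebra_simps)
  then show ?thesis using u ugraphD(1)[OF E] by (simp add: sum_subtractf sum_nbrs[OF E])
qed

lemma lap_row_sum:
  assumes E: "ugraph V E" and u: "u \<in> V"
  shows "(\<Sum>v\<in>V. lap E u v) = 0"
  using fmul_lap[OF assms, of "\<lambda>_ _. 1" u] by (simp add: fmul_def deg_def)

lemma sum_arcs:
  assumes "ugraph V E"
  shows "(\<Sum>(u, v)\<in>E. h u v) = (\<Sum>u\<in>V. \<Sum>v\<in>E `` {u}. h u v)"
proof -
  have "E = Sigma V (\<lambda>v. E `` {v})" using ugraphD[OF assms] by auto
  then have "(\<Sum>(u, v)\<in>E. h u v) = (\<Sum>(u, v)\<in>Sigma V (\<lambda>v. E `` {v}). h u v)" by simp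
  also have "\<dots> = (\<Sum>u\<in>V. \<Sum>v\<in>E `` {u}. h u v)"
    using ugraphD[OF assms] by (intro sum.Sigma[symmetric]) auto
  finally show ?thesis .
qed

lemma sum_arcs_swap:
  assumes "ugraph V E"
  shows "(\<Sum>(u, v)\<in>E. h u v) = (\<Sum>(u, v)\<in>E. h v u)"
  by (rule sum.reindex_bij_witness[of _ prod.swap prod.swap]) (auto dest: ugraphD(5)[OF assms])

lemma sum_arcs_fst:
  assumes "ugraph V E"
  shows "(\<Sum>(u, v)\<in>E. h u) = (\<Sum>u\<in>V. real (deg E u) * h u)"
  unfolding sum_arcs[OF assms] by (simp add: deg_def)

text \<open>Covers two forms at once: \<open>s = -1\<close> gives the Laplacian form and
  \<open>s = 1\<close> its signless counterpart, which yields the bound 4. Summing over arcs counts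
  each edge twice.\<close>

lemma sum_arcs_quadratic:
  assumes E: "ugraph V E"
  shows "(\<Sum>(u, v)\<in>E. (x u + s * x v)\<^sup>2) =
    (1 + s\<^sup>2) * (\<Sum>u\<in>V. real (deg E u) * (x u)\<^sup>2) + 2 * s * (\<Sum>(u, v)\<in>E. x u * x v)" 
proof -
  have "(\<Sum>(u, v)\<in>E. (x u + s * x v)\<^sup>2) = (\<Sum>e\<in>E. (case e of (u, v) \<Rightarrow> (x u)\<^sup>2) +
      s\<^sup>2 * (case e of (u, v) \<Rightarrow> (x v)\<^sup>2) + 2 * s * (case e of (u, v) \<Rightarrow> x u * x v))"
    by (intro sum.cong) (auto simp: power2_eq_square algebra_simps)
  also have "\<dots> = (\<Sum>(u, v)\<in>E. (x u)\<^sup>2) + s\<^sup>2 * (\<Sum>(u, v)\<in>E. (x v)\<^sup>2) + 2 * s * (\<Sum>(u, v)\<in>E. x u * x v)"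
    by (simp only: sum.distrib sum_distrib_left)
  also have "(\<Sum>(u, v)\<in>E. (x v)\<^sup>2) = (\<Sum>(u, v)\<in>E. (x u)\<^sup>2)" by (rule sum_arcs_swap[OF E])
  finally show ?thesis unfolding sum_arcs_fst[OF E] by (simp add: algebra_simps)
qed

lemma qform_lap:
  assumes E: "ugraph V E"
  shows "qform V (lap E) x = (\<Sum>u\<in>V. real (deg E u) * (x u)\<^sup>2) - (\<Sum>(u, v)\<in>E. x u * x v)"
proof -
  have "qform V (lap E) x = (\<Sum>u\<in>V. x u * fmul V (lap E) (\<lambda>v _. x v) u undefined)"
    unfolding qform_def fmul_def by (simp add: sum_distrib_left mult_ac)
  also have "\<dots> = (\<Sum>u\<in>V. real (deg E u) * (x u)\<^sup>2 - (\<Sum>v\<in>E `` {u}. x u * x v))"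
    by (intro sum.cong refl)
      (simp add: fmul_lap[OF E] right_diff_distrib sum_distrib_left power2_eq_square mult_ac)
  finally show ?thesis unfolding sum_arcs[OF E] by (simp add: sum_subtractf)
qed

lemma qform_lap_arcs:
  assumes E: "ugraph V E"
  shows "2 * qform V (lap E) x = (\<Sum>(u, v)\<in>E. (x u - x v)\<^sup>2)"
  using sum_arcs_quadratic[OF E, of x "-1"] qform_lap[OF E, of x] by simp

lemma lap_traces:
  assumes E: "ugraph V E"
  shows "(\<Sum>v\<in>V. lap E v v) = (\<Sum>v\<in>V. real (deg E v))"
    and "(\<Sum>v\<in>V. fmul V (lap E) (lap E) v v) = (\<Sum>v\<in>V. real (deg E v) ^ 2) + (\<Sum>v\<in>V. real (deg E v))"
    and "(\<Sum>v\<in>V. fmul V (lap E) (fmul V (lap E) (lap E)) v v) =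
      (\<Sum>v\<in>V. real (deg E v) ^ 3) + 3 * (\<Sum>v\<in>V. real (deg E v) ^ 2)
      - card (closed_3_walks E)"
proof -
  note D = ugraphD[OF E]
  let ?d = "\<lambda>v. real (deg E v)"
  have diag: "lap E v v = ?d v" for v using D(6) by (simp add: lap_def)
  show "(\<Sum>v\<in>V. lap E v v) = (\<Sum>v\<in>V. ?d v)" by (simp add: diag)
  have adj: "lap E w v = -1" if "(w, v) \<in> E" for w v using that D(6) by (auto simp: lap_def)
  have 2: "fmul V (lap E) (lap E) v v = (?d v)\<^sup>2 + ?d v" if "v \<in> V" for v
  proof -
    have "(\<Sum>w\<in>E `` {v}. lap E w v) = (\<Sum>w\<in>E `` {v}. -1)" using D(5) by (intro sum.cong) (auto simp: adj)
    then show ?thesis using fmul_lap[OF E that] by (simp add: diag deg_def power2_eq_square)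
  qed
  show "(\<Sum>v\<in>V. fmul V (lap E) (lap E) v v) = (\<Sum>v\<in>V. ?d v ^ 2) + (\<Sum>v\<in>V. ?d v)"
    by (simp add: 2 sum.distrib)
  \<comment> \<open>For adjacent \<open>v\<close> and \<open>w\<close>, the diagonal entries
    contribute minus the degrees and the common neighbours contribute the triangles through this
    edge.\<close>
  have 3: "fmul V (lap E) (lap E) w v = - ?d w - ?d v + card (E `` {w} \<inter> E `` {v})" if wv: "(v, w) \<in> E" for v w
  proof -
    have w: "w \<in> V" "(w, v) \<in> E" using wv D(4,5) by auto
    have "(\<Sum>z\<in>E `` {w}. lap E z v) = (\<Sum>z\<in>E `` {w}. (if z = v then ?d v else 0) - (if z \<in> E `` {v} then 1 else 0))"
      using D(5) by (intro sum.cong) (auto simp: lap_def)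
    also have "\<dots> = ?d v - card (E `` {w} \<inter> E `` {v})"
    proof -
      have "{z. (v, z) \<in> E} = E `` {v}" by auto
      then show ?thesis using D(7) w(2) by (simp add: sum_subtractf sum.If_cases)
    qed
    finally show ?thesis using fmul_lap[OF E w(1)] adj[OF w(2)] by simp
  qed
  let ?T = "(closed_3_walks E)"
  have "?T = (SIGMA u:V. SIGMA v:E `` {u}. E `` {v} \<inter> E `` {u})" using D(3,5) by auto
  then have T: "card ?T = (\<Sum>u\<in>V. \<Sum>v\<in>E `` {u}. card (E `` {v} \<inter> E `` {u}))"
    using D(1,7) by (simp add: card_SigmaI)
  have "fmul V (lap E) (fmul V (lap E) (lap E)) v v =
      ?d v ^ 3 + 2 * ?d v ^ 2 + (\<Sum>w\<in>E `` {v}. ?d w) - (\<Sum>w\<in>E `` {v}. real (card (E `` {w} \<inter> E `` {v})))"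
    if "v \<in> V" for v
  proof -
    have "(\<Sum>w\<in>E `` {v}. fmul V (lap E) (lap E) w v) =
        (\<Sum>w\<in>E `` {v}. - ?d w - ?d v + card (E `` {w} \<inter> E `` {v}))"
      by (intro sum.cong) (auto simp: 3)
    also have "\<dots> = - (\<Sum>w\<in>E `` {v}. ?d w) - ?d v * ?d v + (\<Sum>w\<in>E `` {v}. real (card (E `` {w} \<inter> E `` {v})))"
      by (simp add: sum.distrib sum_subtractf sum_negf deg_def)
    finally show ?thesis
      using fmul_lap[OF E that, of "fmul V (lap E) (lap E)" v] 2[OF that]
      by (simp add: power2_eq_square power3_eq_cube algebra_simps)
  qed
  then have "(\<Sum>v\<in>V. fmul V (lap E) (fmul V (lap E) (lap E)) v v) =
      (\<Sum>v\<in>V. ?d v ^ 3) + 2 * (\<Sum>v\<in>V. ?d v ^ 2) + (\<Sum>v\<in>V. \<Sum>w\<in>E `` {v}. ?d w) - card ?T"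
    unfolding T by (simp add: sum.distrib sum_subtractf sum_distrib_left)
  moreover have "(\<Sum>v\<in>V. \<Sum>w\<in>E `` {v}. ?d w) = (\<Sum>v\<in>V. ?d v ^ 2)"
  proof -
    have "(\<Sum>v\<in>V. \<Sum>w\<in>E `` {v}. ?d w) = (\<Sum>(v, w)\<in>E. ?d w)" by (rule sum_arcs[OF E, symmetric])
    also have "\<dots> = (\<Sum>(v, w)\<in>E. ?d v)" by (rule sum_arcs_swap[OF E])
    finally show ?thesis unfolding sum_arcs_fst[OF E] by (simp add: power2_eq_square)
  qed
  ultimately show "(\<Sum>v\<in>V. fmul V (lap E) (fmul V (lap E) (lap E)) v v) =
      (\<Sum>v\<in>V. ?d v ^ 3) + 3 * (\<Sum>v\<in>V. ?d v ^ 2) - card ?T" by simp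
qed

section \<open>Bounds for the Laplacian form\<close>

lemma conn_propagate:
  assumes E: "ugraph V E" "conn V E" and c: "c \<in> V" "P c" and v: "v \<in> V"
    and step: "\<And>u v. (u, v) \<in> E \<Longrightarrow> P u \<Longrightarrow> P v"
  shows "P v"
proof -
  have "{v \<in> V. P v} = V"
    using c by (intro connD[OF E(2), of _ c]) (auto dest: step ugraphD(4)[OF E(1)])
  then show ?thesis using v by blast
qed

text \<open>Laplacian and signless form add up to twice the degree form. The hypothesis therefore
  bounds the sum of \<open>(x u + x v)^2\<close> over all arcs by the sum of
  \<open>4 (deg u - 2) (x u)^2\<close>, which is at most 0 because \<open>x\<close> vanishes at
  \<open>c\<close>. So \<open>x\<close> only changes sign along arcs, and its zero at
  \<open>c\<close> spreads to all of \<open>V\<close>.\<close>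

lemma qform_lap_lt_4:
  assumes E: "ugraph V E" "conn V E" and c: "c \<in> V" and d: "\<And>v. v \<in> V \<Longrightarrow> v \<noteq> c \<Longrightarrow> deg E v \<le> 2"
    and x: "x c = 0" "4 * sqnorm V x \<le> qform V (lap E) x" and v: "v \<in> V"
  shows "x v = 0"
proof -
  note D = ugraphD[OF E(1)]
  have "(\<Sum>(u, v)\<in>E. (x u + x v)\<^sup>2) = 4 * (\<Sum>u\<in>V. real (deg E u) * (x u)\<^sup>2) - 2 * qform V (lap E) x"
    using sum_arcs_quadratic[OF E(1), of x 1] qform_lap[OF E(1), of x] by simp
  also have "\<dots> \<le> 4 * (\<Sum>u\<in>V. real (deg E u) * (x u)\<^sup>2) - 8 * sqnorm V x" using x(2) by simp
  also have "\<dots> = (\<Sum>u\<in>V. 4 * ((real (deg E u) - 2) * (x u)\<^sup>2))"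
    by (simp add: sqnorm_def sum_distrib_left left_diff_distrib sum_subtractf right_diff_distrib)
  also have "\<dots> \<le> 0"
  proof (rule sum_nonpos)
    fix u assume u: "u \<in> V"
    have "(real (deg E u) - 2) * (x u)\<^sup>2 \<le> 0"
    proof (cases "u = c")
      case False
      then show ?thesis using d[OF u] by (intro mult_nonpos_nonneg) auto
    qed (simp add: x(1))
    then show "4 * ((real (deg E u) - 2) * (x u)\<^sup>2) \<le> 0" by (rule mult_nonneg_nonpos[rotated]) simp
  qed
  finally have "(\<Sum>e\<in>E. case e of (u, v) \<Rightarrow> (x u + x v)\<^sup>2) \<le> 0" .
  moreover have "(\<Sum>e\<in>E. case e of (u, v) \<Rightarrow> (x u + x v)\<^sup>2) \<ge> 0" by (rule sum_nonneg) auto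
  ultimately have "(\<Sum>e\<in>E. case e of (u, v) \<Rightarrow> (x u + x v)\<^sup>2) = 0" by simp
  then have "\<forall>e\<in>E. (case e of (u, v) \<Rightarrow> (x u + x v)\<^sup>2) = 0"
    using D(2) by (subst (asm) sum_nonneg_eq_0_iff) auto
  note h = bspec[OF this]
  have "x v = 0" if "(u, v) \<in> E" "x u = 0" for u v using h[OF that(1)] that(2) by simp
  then show ?thesis using conn_propagate[OF E c, of "\<lambda>v. x v = 0", OF x(1) v] by blast
qed

lemma qform_lap_0:
  assumes E: "ugraph V E" "conn V E" and c: "c \<in> V" and x: "x c = 0" "qform V (lap E) x \<le> 0" and v: "v \<in> V"
  shows "x v = 0"
proof -
  have "(\<Sum>e\<in>E. case e of (u, v) \<Rightarrow> (x u - x v)\<^sup>2) \<le> 0" using x(2) qform_lap_arcs[OF E(1), of x] by simp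
  moreover have "(\<Sum>e\<in>E. case e of (u, v) \<Rightarrow> (x u - x v)\<^sup>2) \<ge> 0" by (rule sum_nonneg) auto
  ultimately have "(\<Sum>e\<in>E. case e of (u, v) \<Rightarrow> (x u - x v)\<^sup>2) = 0" by simp
  then have "\<forall>e\<in>E. (case e of (u, v) \<Rightarrow> (x u - x v)\<^sup>2) = 0"
    using ugraphD(2)[OF E(1)] by (subst (asm) sum_nonneg_eq_0_iff) auto
  note h = bspec[OF this]
  have "x v = 0" if "(u, v) \<in> E" "x u = 0" for u v using h[OF that(1)] that(2) by simp
  then show ?thesis using conn_propagate[OF E c, of "\<lambda>v. x v = 0", OF x(1) v] by blast
qed

text \<open>A disconnected graph has a two-dimensional kernel, spanned by the indicators of a closed
  set and of its complement. Transferred with reversed sign and threshold 0, it gives a nonzero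
  vector on \<open>W\<close> that vanishes at \<open>c\<close> and has form at most 0, which is
  impossible on a connected graph.\<close>

lemma cospectral_conn:
  assumes cs: "cospectral_dec V (lap E) e p W (lap F) e' p'" and E: "ugraph V E"
    and F: "ugraph W F" "conn W F" and c: "c \<in> W"
  shows "conn V E"
proof (rule ccontr)
  note D = ugraphD[OF E]
  assume "\<not> conn V E"
  then obtain S where S: "S \<subseteq> V" "S \<noteq> {}" "E `` S \<subseteq> S" "S \<noteq> V" unfolding conn_def by blast
  define y where "y v = (if v \<in> S then 1 else 0 :: real)" for v
  define z where "z v = (if v \<in> S then 0 else 1 :: real)" for v
  have cross: "u \<in> S \<longleftrightarrow> v \<in> S" if "(u, v) \<in> E" for u v using that S(3) D(5) by blast
  have form: "qform V (lap E) (\<lambda>v. a * y v + b * z v) = 0" for a b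
  proof -
    have "2 * qform V (lap E) (\<lambda>v. a * y v + b * z v) = 0"
      unfolding qform_lap_arcs[OF E] using cross by (intro sum.neutral) (auto simp: y_def z_def)
    then show ?thesis by simp
  qed
  have "\<exists>x. (\<exists>w\<in>W. x w \<noteq> 0) \<and> (\<Sum>w\<in>W. (if w = c then 1 else 0) * x w) = 0 \<and>
      0 * sqnorm W x \<le> qform W (\<lambda>u v. - lap F u v) x"
  proof (rule cospectral_dec_transfer_plane[OF cospectral_dec_uminus[OF cs]])
    fix a b :: real
    assume ab: "a \<noteq> 0 \<or> b \<noteq> 0"
    obtain v w where "v \<in> S" "w \<in> V" "w \<notin> S" using S by blast
    then show "\<exists>v\<in>V. a * y v + b * z v \<noteq> 0"
      using ab S(1) by (auto simp: y_def z_def intro: bexI[of _ v] bexI[of _ w])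
  next
    fix a b :: real
    show "0 * sqnorm V (\<lambda>v. a * y v + b * z v) \<le> qform V (\<lambda>u v. - lap E u v) (\<lambda>v. a * y v + b * z v)"
      using form[of a b] by (simp add: qform_def sum_negf)
  qed
  then obtain x where x: "\<exists>w\<in>W. x w \<noteq> 0" "(\<Sum>w\<in>W. (if w = c then 1 else 0) * x w) = 0"
      "0 \<le> qform W (\<lambda>u v. - lap F u v) x" by auto
  have "x c = 0" using x(2) c ugraphD(1)[OF F(1)] by (simp add: if_distrib[of "\<lambda>t. t * _"] cong: if_cong)
  moreover have "qform W (lap F) x \<le> 0" using x(3) by (simp add: qform_def sum_negf)
  ultimately show False using qform_lap_0[OF F c] x(1) by blast
qed

section \<open>Two vertices of degree at least 4\<close>

lemma qform_lap_ge_star: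
  assumes E: "ugraph V E" and uw: "u \<in> V" "w \<in> V" "u \<noteq> w"
  shows "qform V (lap E) x \<ge> (if (u, w) \<in> E then (x u - x w)\<^sup>2 else 0) +
    (\<Sum>v\<in>V - {u, w}. (if (u, v) \<in> E then (x u - x v)\<^sup>2 else 0) + (if (w, v) \<in> E then (x w - x v)\<^sup>2 else 0))"
proof -
  note D = ugraphD[OF E]
  let ?h = "\<lambda>e. case e of (a, b) \<Rightarrow> (x a - x b)\<^sup>2"
  let ?M = "V - {u, w}"
  let ?A = "Pair u ` (E `` {u} - {w})" and ?B = "Pair w ` (E `` {w} - {u})"
  let ?C = "(if (u, w) \<in> E then {(u, w)} else {})"
  have fin: "finite ?A" "finite ?B" "finite ?C" using D(7) by auto
  have sub: "?A \<union> ?B \<union> ?C \<subseteq> E" by auto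
  \<comment> \<open>\<open>?A\<close>, \<open>?B\<close> and \<open>?C\<close> hold one orientation
    of each edge at \<open>u\<close> or \<open>w\<close>, the edge between them being only in
    \<open>?C\<close>. The converses account for the factor 2 of
    \<open>qform_lap_arcs\<close>.\<close>
  have disj: "(?A \<union> ?B \<union> ?C) \<inter> (?A \<union> ?B \<union> ?C)\<inverse> = {}" using uw D(6) by (auto split: if_splits)
  have "sum ?h (?A \<union> ?B \<union> ?C) + sum ?h ((?A \<union> ?B \<union> ?C)\<inverse>) = sum ?h ((?A \<union> ?B \<union> ?C) \<union> (?A \<union> ?B \<union> ?C)\<inverse>)"
    by (rule sum.union_disjoint[symmetric]) (use fin disj in auto)
  also have "\<dots> \<le> sum ?h E"
    by (rule sum_mono2) (use D(2,5) sub in auto)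
  also have "sum ?h ((?A \<union> ?B \<union> ?C)\<inverse>) = sum ?h (?A \<union> ?B \<union> ?C)"
    by (rule sum.reindex_bij_witness[of _ prod.swap prod.swap]) (auto simp: power2_commute)
  finally have "sum ?h (?A \<union> ?B \<union> ?C) \<le> qform V (lap E) x" using qform_lap_arcs[OF E, of x] by simp
  moreover have "sum ?h (?A \<union> ?B \<union> ?C) = sum ?h ?A + sum ?h ?B + sum ?h ?C"
    using fin uw by (subst sum.union_disjoint; (subst sum.union_disjoint)?; auto split: if_splits)
  moreover have "sum ?h ?A = (\<Sum>v\<in>?M. if (u, v) \<in> E then (x u - x v)\<^sup>2 else 0)"
  proof -
    have "E `` {u} - {w} = {v \<in> ?M. (u, v) \<in> E}" using D(4,6) by auto
    then have "sum ?h (Pair u ` (E `` {u} - {w})) = (\<Sum>v\<in>{v \<in> ?M. (u, v) \<in> E}. (x u - x v)\<^sup>2)"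
      by (simp only:) (subst sum.reindex, auto simp: inj_on_def)
    also have "\<dots> = (\<Sum>v\<in>?M. if (u, v) \<in> E then (x u - x v)\<^sup>2 else 0)"
      by (rule sum.inter_filter) (simp add: D(1))
    finally show ?thesis .
  qed
  moreover have "sum ?h ?B = (\<Sum>v\<in>?M. if (w, v) \<in> E then (x w - x v)\<^sup>2 else 0)"
  proof -
    have "E `` {w} - {u} = {v \<in> ?M. (w, v) \<in> E}" using D(4,6) by auto
    then have "sum ?h (Pair w ` (E `` {w} - {u})) = (\<Sum>v\<in>{v \<in> ?M. (w, v) \<in> E}. (x w - x v)\<^sup>2)"
      by (simp only:) (subst sum.reindex, auto simp: inj_on_def)
    also have "\<dots> = (\<Sum>v\<in>?M. if (w, v) \<in> E then (x w - x v)\<^sup>2 else 0)"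
      by (rule sum.inter_filter) (simp add: D(1))
    finally show ?thesis .
  qed
  moreover have "sum ?h ?C = (if (u, w) \<in> E then (x u - x w)\<^sup>2 else 0)" by simp
  ultimately show ?thesis by (simp add: sum.distrib)
qed

text \<open>\<open>\<alpha>\<close> and \<open>\<beta>\<close> tell whether a further vertex is
  adjacent to \<open>u\<close> and to \<open>w\<close>. A private neighbour contributes exactly
  \<open>4/3\<close> of the square; a common one has the value \<open>- (a + b) / 3\<close> and may
  contribute less when \<open>a\<close> and \<open>b\<close> have opposite signs. The allowance
  \<open>\<theta>\<close> covers this loss.\<close>

lemma star_term_bound:
  fixes a b \<theta> :: real
  assumes \<alpha>: "\<alpha> = 0 \<or> \<alpha> = 1" and \<beta>: "\<beta> = 0 \<or> \<beta> = (1::real)"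
    and \<theta>: "0 \<le> \<theta>" "(4/3 - \<theta>) * (a\<^sup>2 + b\<^sup>2) \<le> a\<^sup>2 + b\<^sup>2 + 4/9 * (a + b)\<^sup>2"
  shows "\<alpha> * (a + (\<alpha> * a + \<beta> * b) / 3)\<^sup>2 + \<beta> * (b + (\<alpha> * a + \<beta> * b) / 3)\<^sup>2 - 4 * ((\<alpha> * a + \<beta> * b) / 3)\<^sup>2
    \<ge> (4/3 - \<theta>) * (\<alpha> * a\<^sup>2 + \<beta> * b\<^sup>2)"
proof -
  have 1: "(a + a / 3)\<^sup>2 - 4 * (a / 3)\<^sup>2 = 4/3 * a\<^sup>2" for a :: real by (simp add: power2_eq_square field_simps)
  have 2: "(a + (a + b) / 3)\<^sup>2 + (b + (a + b) / 3)\<^sup>2 - 4 * ((a + b) / 3)\<^sup>2 = a\<^sup>2 + b\<^sup>2 + 4/9 * (a + b)\<^sup>2"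
    by (simp add: power2_eq_square field_simps)
  have 3: "(4/3 - \<theta>) * t\<^sup>2 \<le> 4/3 * t\<^sup>2" for t using \<theta>(1) by (intro mult_right_mono) auto
  show ?thesis using \<alpha> \<beta> 1[of a] 1[of b] 2 3[of a] 3[of b] \<theta>(2) by auto
qed

text \<open>
  The values \<open>-1/3\<close> on the neighbours maximise \<open>(1 - y)\<^sup>2 - 4y\<^sup>2\<close>, the contribution of an edge from a
  vertex of value \<open>1\<close> to a neighbour of value \<open>y\<close> in the form \<open>L - 4\<close>.
\<close>

lemma two_large_degrees_qform:
  assumes E: "ugraph V E" and uw: "u \<in> V" "w \<in> V" "u \<noteq> w" and d: "deg E u \<ge> 4" "deg E w \<ge> 4"
  defines "y \<equiv> \<lambda>v. if v = u then 1 else if v = w then 0 else if (u, v) \<in> E then - 1/3 else 0"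
    and "z \<equiv> \<lambda>v. if v = w then 1 else if v = u then 0 else if (w, v) \<in> E then - 1/3 else 0"
  shows "4 * sqnorm V (\<lambda>v. a * y v + b * z v) \<le> qform V (lap E) (\<lambda>v. a * y v + b * z v)"
proof -
  note D = ugraphD[OF E]
  let ?M = "V - {u, w}"
  define x where "x v = a * y v + b * z v" for v
  define \<alpha> where "\<alpha> v = (if (u, v) \<in> E then 1 else 0 :: real)" for v
  define \<beta> where "\<beta> v = (if (w, v) \<in> E then 1 else 0 :: real)" for v
  have \<alpha>\<beta>: "\<alpha> v = 0 \<or> \<alpha> v = 1" "\<beta> v = 0 \<or> \<beta> v = 1" for v by (auto simp: \<alpha>_def \<beta>_def)
  have xu: "x u = a" "x w = b" using uw(3) by (auto simp: x_def y_def z_def)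
  have xM: "x v = - (\<alpha> v * a + \<beta> v * b) / 3" if "v \<in> ?M" for v
    using that by (auto simp: x_def y_def z_def \<alpha>_def \<beta>_def)
  define k where "k = (if (u, w) \<in> E then 1 else 0 :: real)"
  have "(\<Sum>v\<in>?M. \<alpha> v) = real (card {v \<in> ?M. (u, v) \<in> E})"
    using D(1) by (simp add: \<alpha>_def sum.If_cases Int_def)
  also have "{v \<in> ?M. (u, v) \<in> E} = E `` {u} - {w}" using D(4,6) by auto
  also have "real (card (E `` {u} - {w})) = deg E u - k"
    using D(7) d(1) by (auto simp: deg_def k_def card_Diff_singleton_if of_nat_diff)
  finally have S\<alpha>: "(\<Sum>v\<in>?M. \<alpha> v) \<ge> 4 - k" using d(1) by simp
  have "(\<Sum>v\<in>?M. \<beta> v) = real (card {v \<in> ?M. (w, v) \<in> E})"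
    using D(1) by (simp add: \<beta>_def sum.If_cases Int_def)
  also have "{v \<in> ?M. (w, v) \<in> E} = E `` {w} - {u}" using D(4,6) by auto
  also have "real (card (E `` {w} - {u})) = deg E w - k"
  proof -
    have "u \<in> E `` {w} \<longleftrightarrow> (u, w) \<in> E" using D(5) by blast
    then show ?thesis using D(7) d(2) by (auto simp: deg_def k_def card_Diff_singleton_if of_nat_diff)
  qed
  finally have S\<beta>: "(\<Sum>v\<in>?M. \<beta> v) \<ge> 4 - k" using d(2) by simp
  \<comment> \<open>Without the edge between \<open>u\<close> and \<open>w\<close>, each has four
    further neighbours and a loss of \<open>1/3\<close> is affordable:
    \<open>4 * (4/3 - 1/3) = 4\<close>. With the edge only three are guaranteed,
    \<open>3 * 4/3 = 4\<close> has no slack, and the edge term \<open>(a - b)^2\<close> must pay for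
    the loss, which fixes \<open>\<theta>\<close>. The value 0 covers
    \<open>a = b = 0\<close>.\<close>
  define \<theta> where "\<theta> = (if k = 0 then 1/3 else if a\<^sup>2 + b\<^sup>2 = 0 then 0 else (a - b)\<^sup>2 / (3 * (a\<^sup>2 + b\<^sup>2)))"
  have ab: "(a - b)\<^sup>2 + (a + b)\<^sup>2 = 2 * (a\<^sup>2 + b\<^sup>2)" by (simp add: power2_eq_square algebra_simps)
  have \<theta>0: "0 \<le> \<theta>" by (simp add: \<theta>_def)
  have \<theta>1: "3 * \<theta> * (a\<^sup>2 + b\<^sup>2) = (a - b)\<^sup>2" if "k = 1"
  proof (cases "a\<^sup>2 + b\<^sup>2 = 0")
    case True
    then show ?thesis by (auto simp: sum_power2_eq_zero_iff)
  next
    case False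
    have "3 * (t / (3 * S)) * S = t" if "S \<noteq> 0" for t S :: real using that by simp
    from this[OF False] show ?thesis using False \<open>k = 1\<close> by (simp only: \<theta>_def) simp
  qed
  have \<theta>2: "\<theta> \<le> 4/3"
  proof -
    have "(a - b)\<^sup>2 \<le> 2 * (a\<^sup>2 + b\<^sup>2)" using ab zero_le_power2[of "a + b"] by linarith
    have bound: "t / (3 * S) \<le> 4/3" if "t \<le> 2 * S" "0 < S" for t S :: real
      using that by (simp add: divide_le_eq)
    consider "k = 0" | "k \<noteq> 0" "a\<^sup>2 + b\<^sup>2 = 0" | "k \<noteq> 0" "a\<^sup>2 + b\<^sup>2 \<noteq> 0" by blast
    then show ?thesis
    proof cases
      case 3
      then have "\<theta> = (a - b)\<^sup>2 / (3 * (a\<^sup>2 + b\<^sup>2))" unfolding \<theta>_def by (simp only: if_False)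
      moreover have "0 < a\<^sup>2 + b\<^sup>2" using 3(2) sum_power2_ge_zero[of a b] by linarith
      ultimately show ?thesis using bound \<open>(a - b)\<^sup>2 \<le> 2 * (a\<^sup>2 + b\<^sup>2)\<close> by (simp only:)
    qed (simp_all add: \<theta>_def)
  qed
  have k01: "k = 0 \<or> k = 1" by (auto simp: k_def)
  have \<theta>3: "(4/3 - \<theta>) * (a\<^sup>2 + b\<^sup>2) \<le> a\<^sup>2 + b\<^sup>2 + 4/9 * (a + b)\<^sup>2"
  proof (cases "k = 0")
    case True
    then show ?thesis by (simp add: \<theta>_def)
  next
    case False
    then have "3 * \<theta> * (a\<^sup>2 + b\<^sup>2) = (a - b)\<^sup>2" using k01 \<theta>1 by simp
    moreover have "0 \<le> 3 * (a\<^sup>2 + b\<^sup>2) + (a + b)\<^sup>2" by simp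
    ultimately show ?thesis using ab by (simp add: left_diff_distrib power2_eq_square algebra_simps)
  qed
  have "4 * sqnorm V x = 4 * a\<^sup>2 + 4 * b\<^sup>2 + (\<Sum>v\<in>?M. 4 * (x v)\<^sup>2)"
  proof -
    have "V = insert u (insert w ?M)" using uw by auto
    then have "sqnorm V x = (\<Sum>v\<in>insert u (insert w ?M). (x v)\<^sup>2)" by (simp add: sqnorm_def)
    also have "\<dots> = (x u)\<^sup>2 + ((x w)\<^sup>2 + (\<Sum>v\<in>?M. (x v)\<^sup>2))" using D(1) uw by simp
    finally show ?thesis by (simp add: xu sum_distrib_left)
  qed
  also have "\<dots> \<le> k * (a - b)\<^sup>2 + (\<Sum>v\<in>?M. \<alpha> v * (a - x v)\<^sup>2 + \<beta> v * (b - x v)\<^sup>2)"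
  proof -
    have "(\<Sum>v\<in>?M. (4/3 - \<theta>) * (\<alpha> v * a\<^sup>2 + \<beta> v * b\<^sup>2)) \<le>
        (\<Sum>v\<in>?M. \<alpha> v * (a - x v)\<^sup>2 + \<beta> v * (b - x v)\<^sup>2 - 4 * (x v)\<^sup>2)"
    proof (rule sum_mono)
      fix v assume v: "v \<in> ?M"
      let ?t = "(\<alpha> v * a + \<beta> v * b) / 3"
      have "x v = - ?t" unfolding xM[OF v] by (rule minus_divide_left[symmetric])
      then have x: "a - x v = a + ?t" "b - x v = b + ?t" "(x v)\<^sup>2 = ?t\<^sup>2" by simp_all
      show "(4/3 - \<theta>) * (\<alpha> v * a\<^sup>2 + \<beta> v * b\<^sup>2) \<le> \<alpha> v * (a - x v)\<^sup>2 + \<beta> v * (b - x v)\<^sup>2 - 4 * (x v)\<^sup>2"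
        unfolding x by (rule star_term_bound[OF \<alpha>\<beta> \<theta>0 \<theta>3])
    qed
    moreover have "(\<Sum>v\<in>?M. (4/3 - \<theta>) * (\<alpha> v * a\<^sup>2 + \<beta> v * b\<^sup>2)) \<ge> (4/3 - \<theta>) * ((4 - k) * a\<^sup>2 + (4 - k) * b\<^sup>2)"
    proof -
      have "(4 - k) * a\<^sup>2 + (4 - k) * b\<^sup>2 \<le> (\<Sum>v\<in>?M. \<alpha> v) * a\<^sup>2 + (\<Sum>v\<in>?M. \<beta> v) * b\<^sup>2"
        using S\<alpha> S\<beta> by (intro add_mono mult_right_mono) auto
      also have "\<dots> = (\<Sum>v\<in>?M. \<alpha> v * a\<^sup>2 + \<beta> v * b\<^sup>2)" by (simp add: sum_distrib_right sum.distrib)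
      finally show ?thesis unfolding sum_distrib_left[symmetric] by (rule mult_left_mono) (use \<theta>2 in auto)
    qed
    moreover have "k * (a - b)\<^sup>2 + (4/3 - \<theta>) * ((4 - k) * a\<^sup>2 + (4 - k) * b\<^sup>2) \<ge> 4 * a\<^sup>2 + 4 * b\<^sup>2"
    proof (cases "k = 0")
      case True
      then show ?thesis by (simp add: \<theta>_def)
    next
      case False
      then have "k = 1" using k01 by simp
      then have "(4/3 - \<theta>) * ((4 - k) * a\<^sup>2 + (4 - k) * b\<^sup>2) = 4 * a\<^sup>2 + 4 * b\<^sup>2 - 3 * \<theta> * (a\<^sup>2 + b\<^sup>2)"
        by (simp add: algebra_simps)
      then show ?thesis using \<theta>1 \<open>k = 1\<close> by simp
    qed
    ultimately show ?thesis unfolding sum_subtractf by linarith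
  qed
  also have "\<dots> \<le> qform V (lap E) x"
    using qform_lap_ge_star[OF E uw, of x] unfolding xu \<alpha>_def \<beta>_def k_def
    by (simp add: if_distrib[of "\<lambda>t. t * _"] cong: if_cong)
  finally show ?thesis by (simp add: x_def[abs_def])
qed

lemma cospectral_one_large_degree:
  assumes cs: "cospectral_dec V (lap E) e p W (lap F) e' p'" and E: "ugraph V E"
    and F: "ugraph W F" "conn W F" and c: "c \<in> W" and d: "\<And>v. v \<in> W \<Longrightarrow> v \<noteq> c \<Longrightarrow> deg F v \<le> 2"
    and uw: "u \<in> V" "w \<in> V" "u \<noteq> w" and du: "deg E u \<ge> 4"
  shows "deg E w \<le> 3"
proof (rule ccontr)
  assume "\<not> deg E w \<le> 3"
  then have dw: "deg E w \<ge> 4" by simp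
  let ?y = "\<lambda>v. if v = u then 1 else if v = w then 0 else if (u, v) \<in> E then - 1/3 else 0 :: real"
  let ?z = "\<lambda>v. if v = w then 1 else if v = u then 0 else if (w, v) \<in> E then - 1/3 else 0 :: real"
  \<comment> \<open>The functional is evaluation at \<open>c\<close>, so that the transferred vector
    falls under \<open>qform_lap_lt_4\<close>.\<close>
  have "\<exists>x. (\<exists>w\<in>W. x w \<noteq> 0) \<and> (\<Sum>w\<in>W. (if w = c then 1 else 0) * x w) = 0 \<and>
      4 * sqnorm W x \<le> qform W (lap F) x"
  proof (rule cospectral_dec_transfer_plane[OF cs])
    fix a b :: real
    assume "a \<noteq> 0 \<or> b \<noteq> 0"
    then show "\<exists>v\<in>V. a * ?y v + b * ?z v \<noteq> 0"
    proof
      assume "a \<noteq> 0"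
      then show ?thesis using uw by (intro bexI[of _ u]) auto
    next
      assume "b \<noteq> 0"
      then show ?thesis using uw by (intro bexI[of _ w]) auto
    qed
  next
    fix a b :: real
    show "4 * sqnorm V (\<lambda>v. a * ?y v + b * ?z v) \<le> qform V (lap E) (\<lambda>v. a * ?y v + b * ?z v)"
      by (rule two_large_degrees_qform[OF E uw du dw])
  qed
  then obtain x where x: "\<exists>w\<in>W. x w \<noteq> 0" "(\<Sum>w\<in>W. (if w = c then 1 else 0) * x w) = 0"
      "4 * sqnorm W x \<le> qform W (lap F) x" by auto
  have "x c = 0" using x(2) c ugraphD(1)[OF F(1)] by (simp add: if_distrib[of "\<lambda>t. t * _"] cong: if_cong)
  then show False using qform_lap_lt_4[OF F c d] x(1,3) by blast
qed

text \<open>\<open>x\<close> is the column of the Laplacian at \<open>c\<close>. As constants lie in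
  the kernel, \<open>L x = card V * L e = card V * x\<close> for the basis vector \<open>e\<close>
  at \<open>c\<close>, so the order is an eigenvalue.\<close>

lemma dominating_vertex_qform:
  assumes E: "ugraph V E" and c: "c \<in> V" "\<And>v. v \<in> V \<Longrightarrow> v \<noteq> c \<Longrightarrow> (v, c) \<in> E"
  defines "x \<equiv> \<lambda>v. (if v = c then real (card V) else 0) - 1"
  shows "qform V (lap E) x = card V * sqnorm V x"
proof -
  note D = ugraphD[OF E]
  have "v \<in> E `` {c} \<longleftrightarrow> v \<in> V - {c}" for v using c(2)[of v] D(4)[of c v] D(5)[of v c] D(6)[of c] by auto
  then have "E `` {c} = V - {c}" by blast
  then have dc: "real (deg E c) = real (card V) - 1"
    using card.remove[OF D(1) c(1)] by (simp add: deg_def)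
  have lc: "lap E u c = x u" if "u \<in> V" for u
    using that c(2)[OF that] dc D(6) by (auto simp: lap_def x_def)
  have "(\<Sum>v\<in>V. lap E u v * x v) = card V * x u" if "u \<in> V" for u
  proof -
    have "(\<Sum>v\<in>V. lap E u v * x v) = (\<Sum>v\<in>V. (if v = c then lap E u v * card V else 0) - lap E u v)"
      unfolding x_def by (intro sum.cong) (auto simp: algebra_simps)
    also have "\<dots> = lap E u c * card V" using D(1) c(1) lap_row_sum[OF E that] by (simp add: sum_subtractf)
    finally show ?thesis using lc[OF that] by simp
  qed
  moreover have "qform V (lap E) x = (\<Sum>u\<in>V. x u * (\<Sum>v\<in>V. lap E u v * x v))"
    unfolding qform_def by (simp add: sum_distrib_left mult_ac)
  ultimately show ?thesis by (simp add: sqnorm_def sum_distrib_left power2_eq_square mult_ac)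
qed

text \<open>\<open>card V * |x|^2\<close> minus the Laplacian form is the form of the complement
  plus the square of the sum of \<open>x\<close>. Both must vanish, so \<open>x\<close> is constant
  along non-edges and has sum 0. The complement is connected, because the leaf \<open>l\<close> is
  adjacent to nothing but \<open>b\<close>, and \<open>b\<close> misses some further vertex.\<close>

lemma qform_lt_order:
  assumes E: "ugraph V E" and l: "l \<in> V" "E `` {l} = {b}" and b: "deg E b < card V - 1"
    and x: "card V * sqnorm V x \<le> qform V (lap E) x" and v: "v \<in> V"
  shows "x v = 0"
proof -
  note D = ugraphD[OF E]
  let ?h = "\<lambda>e. case e of (a, b) \<Rightarrow> (x a - x b)\<^sup>2"
  let ?n = "real (card V)" and ?s = "\<Sum>v\<in>V. x v"
  have tot: "sum ?h (V \<times> V) = 2 * ?n * sqnorm V x - 2 * ?s\<^sup>2"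
  proof -
    have "sum ?h (V \<times> V) = (\<Sum>u\<in>V. \<Sum>v\<in>V. (x u - x v)\<^sup>2)" by (rule sum.cartesian_product[symmetric])
    also have "\<dots> = (\<Sum>u\<in>V. \<Sum>v\<in>V. (x u)\<^sup>2 + (x v)\<^sup>2 - 2 * (x u * x v))"
      by (intro sum.cong refl) (simp add: power2_eq_square algebra_simps)
    also have "\<dots> = (\<Sum>u\<in>V. ?n * (x u)\<^sup>2) + (\<Sum>u\<in>V. \<Sum>v\<in>V. (x v)\<^sup>2) - 2 * (\<Sum>u\<in>V. \<Sum>v\<in>V. x u * x v)"
      by (simp add: sum.distrib sum_subtractf sum_distrib_left)
    also have "(\<Sum>u\<in>V. \<Sum>v\<in>V. x u * x v) = ?s\<^sup>2" by (simp add: power2_eq_square sum_product)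
    finally show ?thesis by (simp add: sqnorm_def sum_distrib_left mult.assoc)
  qed
  have "sum ?h (V \<times> V - E) = sum ?h (V \<times> V) - sum ?h E"
    using E D(1) by (intro sum_diff) (auto simp: ugraph_def)
  then have le: "sum ?h (V \<times> V - E) + 2 * ?s\<^sup>2 \<le> 0" using tot x qform_lap_arcs[OF E, of x] by simp
  have nn: "sum ?h (V \<times> V - E) \<ge> 0" by (rule sum_nonneg) auto
  have s0: "?s = 0" using le nn zero_le_power2[of ?s] by (smt (verit) power2_less_0 zero_eq_power2)
  have "sum ?h (V \<times> V - E) = 0" using le nn zero_le_power2[of ?s] by linarith
  then have "\<forall>e\<in>V \<times> V - E. ?h e = 0" using D(1) by (subst (asm) sum_nonneg_eq_0_iff) auto
  note h = bspec[OF this]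
  have eq: "x u = x w" if "u \<in> V" "w \<in> V" "(u, w) \<notin> E" for u w
    using h[of "(u, w)"] that by simp
  have bV: "b \<in> V" "b \<noteq> l" using l D(4,6) by blast+
  have 1: "x w = x l" if "w \<in> V" "w \<noteq> b" for w
  proof -
    have "(l, w) \<notin> E" using l(2) that by blast
    then show ?thesis using eq[OF l(1) that(1)] by simp
  qed
  have "\<exists>y\<in>V. y \<noteq> b \<and> (b, y) \<notin> E"
  proof (rule ccontr)
    assume "\<not> ?thesis"
    then have "V - {b} \<subseteq> E `` {b}" by auto
    then have "card (V - {b}) \<le> deg E b" unfolding deg_def using D(7) by (rule card_mono[rotated])
    then show False using b bV(1) D(1) by simp
  qed
  then obtain y where y: "y \<in> V" "y \<noteq> b" "(b, y) \<notin> E" by blast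
  then have "x b = x l" using eq[OF bV(1) y(1,3)] 1[OF y(1,2)] by simp
  then have all: "x w = x l" if "w \<in> V" for w using 1 that by blast
  then have "?s = ?n * x l" by simp
  then have "x l = 0" using s0 l(1) D(1) by auto
  then show ?thesis using all[OF v] by simp
qed

subsection \<open>Grounded Laplacians of unicyclic graphs\<close>

lemma fdet_singleton: "fdet {a} f = f a a"
  using fdet_insert_zero_col[of "{}" a f] by simp

lemma handshake_even:
  assumes "finite S" "sym E" "irrefl E"
  shows "even (\<Sum>u\<in>S. card (E `` {u} \<inter> S))"
  using assms(1)
proof (induction S rule: finite_induct)
  case (insert x S)
  have x: "card (E `` {x} \<inter> insert x S) = card (E `` {x} \<inter> S)"
    using assms(3) by (simp add: irrefl_def)
  have u: "card (E `` {u} \<inter> insert x S) = card (E `` {u} \<inter> S) + (if u \<in> E `` {x} then 1 else 0)" if "u \<in> S" for u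
  proof (cases "u \<in> E `` {x}")
    case True
    then have "E `` {u} \<inter> insert x S = insert x (E `` {u} \<inter> S)" using assms(2) by (auto dest: symD)
    then show ?thesis using True insert.hyps by simp
  next
    case False
    then have "E `` {u} \<inter> insert x S = E `` {u} \<inter> S" using assms(2) by (auto dest: symD)
    then show ?thesis using False by simp
  qed
  have "(\<Sum>u\<in>S. if u \<in> E `` {x} then 1 else 0) = (\<Sum>u\<in>S \<inter> E `` {x}. 1 :: nat)"
    by (rule sum.inter_restrict[OF insert.hyps(1), symmetric])
  then have "(\<Sum>u\<in>insert x S. card (E `` {u} \<inter> insert x S)) =
      card (E `` {x} \<inter> S) + ((\<Sum>u\<in>S. card (E `` {u} \<inter> S)) + card (S \<inter> E `` {x}))"
    using insert.hyps x u by (simp add: sum.distrib del: Image_singleton_iff)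
  then have "(\<Sum>u\<in>insert x S. card (E `` {u} \<inter> insert x S)) =
      2 * card (E `` {x} \<inter> S) + (\<Sum>u\<in>S. card (E `` {u} \<inter> S))"
    by (simp add: Int_commute)
  then show ?case using insert.IH by simp
qed simp

text \<open>The end \<open>a\<close> has pivot \<open>(k + 1) / k\<close>, and eliminating it
  changes the 2 at its neighbour into \<open>2 - k / (k + 1) = 1 + 1 / (k + 1)\<close>: the same
  shape with \<open>k + 1\<close>. The pivots telescope; \<open>k = 1\<close> is the case with 2 on
  the whole diagonal.\<close>

lemma grounded_path_fdet:
  fixes k :: real
  assumes "ugraph U E" "conn U E" "a \<in> U" "deg E a \<le> 1" "\<And>v. v \<in> U \<Longrightarrow> deg E v \<le> 2" "k > 0"
  shows "fdet U (\<lambda>u v. if u = v then (if u = a then 1 + 1 / k else 2) else if (u, v) \<in> E then - 1 else 0)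
    = (card U + k) / k"
  using assms
proof (induction "card U" arbitrary: U E a k rule: less_induct)
  case less
  note E = less.prems(1,2) and a = less.prems(3,4) and d = less.prems(5) and k = less.prems(6)
  note D = ugraphD[OF E(1)]
  let ?f = "\<lambda>u v. if u = v then (if u = a then 1 + 1 / k else 2) else if (u, v) \<in> E then - 1 else 0 :: real"
  show ?case
  proof (cases "U = {a}")
    case True
    then show ?thesis using k by (simp add: fdet_singleton field_simps)
  next
    case False
    then obtain b where b: "b \<in> U" "b \<noteq> a" using a by blast
    then have "deg E a = 1" using deg_pos[OF E a(1) b(1)] a(2) by simp
    then obtain c where c: "E `` {a} = {c}" by (auto simp: deg_def card_1_singleton_iff)
    define U' where "U' = U - {a}"
    define E' where "E' = E - {(c, a), (a, c)}"
    note L = leaf_removal[OF E(1) c a(1), folded U'_def E'_def]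
    have only: "(u, a) \<in> E \<longleftrightarrow> u = c" "(a, u) \<in> E \<longleftrightarrow> u = c" for u using c D(5) by blast+
    have aU': "a \<notin> U'" by (simp add: U'_def)
    have fin: "finite U'" using ugraphD(1)[OF L(1)] .
    have IH: "fdet U' (\<lambda>u v. if u = v then (if u = c then 1 + 1 / (k + 1) else 2) else if (u, v) \<in> E' then - 1 else 0)
        = (card U' + (k + 1)) / (k + 1)"
    proof (rule less.hyps)
      show "card U' < card U" using L(7) by simp
      show "deg E' c \<le> 1" using L(9)[OF L(5)] d[of c] L(5) by (simp add: U'_def)
      show "deg E' v \<le> 2" if "v \<in> U'" for v using L(9)[OF that] d[of v] that by (simp add: U'_def)
    qed (use L(1,2,5) E(2) k in auto)
    have p: "1 + 1 / k \<noteq> 0" "2 - 1 / (1 + 1 / k) = 1 + 1 / (k + 1)" using k by (auto simp: field_simps)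
    have "fdet U ?f = fdet (insert a U') ?f" using L(4) by simp
    also have "\<dots> = ?f a a * fdet U' (\<lambda>u v. ?f u v - ?f u a * ?f a v / ?f a a)"
      by (rule fdet_schur[OF fin aU']) (use p(1) in simp)
    also have "fdet U' (\<lambda>u v. ?f u v - ?f u a * ?f a v / ?f a a) =
        fdet U' (\<lambda>u v. if u = v then (if u = c then 1 + 1 / (k + 1) else 2) else if (u, v) \<in> E' then - 1 else 0)"
    proof (rule fdet_cong[OF fin])
      fix u v assume uv: "u \<in> U'" "v \<in> U'"
      then have ne: "u \<noteq> a" "v \<noteq> a" using aU' by auto
      show "?f u v - ?f u a * ?f a v / ?f a a =
        (if u = v then (if u = c then 1 + 1 / (k + 1) else 2) else if (u, v) \<in> E' then - 1 else 0)"
        using ne only p(2) L(10)[OF ne] by auto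
    qed
    also have "\<dots> = (card U' + (k + 1)) / (k + 1)" by (rule IH)
    also have "?f a a * ((card U' + (k + 1)) / (k + 1)) = (card U + k) / k"
    proof -
      have "1 + 1 / k = (k + 1) / k" using k by (simp add: field_simps)
      then have "?f a a = (k + 1) / k" by simp
      then show ?thesis using k L(7) by simp
    qed
    finally show ?thesis .
  qed
qed

text \<open>A graph is cospectral with itself, and \<open>cospectral_dec_grounded_fdet\<close> lets
  the two grounded vertices differ.\<close>

lemma lap_grounded_indep:
  assumes E: "ugraph V E" and r: "r \<in> V" "s \<in> V"
  shows "fdet (V - {r}) (lap E) = fdet (V - {s}) (lap E)"
proof -
  obtain e p where "spectral_dec V (lap E) e p"
    using spectral_theorem[of V "lap E"] ugraphD(1)[OF E] lap_sym[OF E] by blast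
  then have "cospectral_dec V (lap E) e p V (lap E) e p"
    using ugraphD(1)[OF E] by (simp add: cospectral_dec_def)
  then show ?thesis
    by (rule cospectral_dec_grounded_fdet[OF _ r]) (use lap_sym[OF E] lap_row_sum[OF E] in auto)
qed

definition has_triangle :: "('a \<times> 'a) set \<Rightarrow> bool" where
  "has_triangle E \<longleftrightarrow> (\<exists>u v w. (u, v) \<in> E \<and> (v, w) \<in> E \<and> (w, u) \<in> E)"

text \<open>Removing \<open>r\<close> leaves a path with ends \<open>a\<close> and \<open>b\<close>.
  Its connectedness comes from parity: on a closed set \<open>S\<close> the degree sum
  \<open>2 * card S - card (S \<inter> {a, b})\<close> is even, so \<open>S\<close> contains both
  ends or neither, and \<open>insert r S\<close> or \<open>S\<close> itself is closed in the
  cycle.\<close>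

lemma cycle_grounded_fdet:
  assumes E: "ugraph V E" "conn V E" and d: "\<And>v. v \<in> V \<Longrightarrow> deg E v = 2" and r: "r \<in> V"
  shows "fdet (V - {r}) (lap E) = card V"
proof -
  note D = ugraphD[OF E(1)]
  have "card (E `` {r}) = 2" using d[OF r] by (simp add: deg_def)
  then obtain a b where ab: "E `` {r} = {a, b}" "a \<noteq> b" by (auto simp: card_2_iff)
  define U where "U = V - {r}"
  define F where "F = E \<inter> U \<times> U"
  have aU: "a \<in> U" "b \<in> U" "r \<notin> U" using ab D(4,6) by (auto simp: U_def)
  have F: "ugraph U F" using E(1) unfolding ugraph_def F_def U_def irrefl_def sym_def by blast
  have nr: "(x, r) \<in> E \<longleftrightarrow> x = a \<or> x = b" "(r, x) \<in> E \<longleftrightarrow> x = a \<or> x = b" for x using ab(1) D(5) by blast+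
  have dF: "deg F x + (if x \<in> {a, b} then 1 else 0) = 2" if x: "x \<in> U" for x
  proof (cases "x \<in> {a, b}")
    case True
    have "F `` {x} = E `` {x} - {r}" using x D(4) by (auto simp: F_def U_def)
    moreover have "card (E `` {x}) = Suc (card (E `` {x} - {r}))"
      using True nr D(7) by (intro card.remove) auto
    ultimately show ?thesis using True d[of x] x by (simp add: deg_def U_def)
  next
    case False
    have "F `` {x} = E `` {x}" using x D(4) nr False by (auto simp: F_def U_def)
    then show ?thesis using False d[of x] x by (simp add: deg_def U_def)
  qed
  have "conn U F" unfolding conn_def
  proof (intro allI impI)
    fix S assume S: "S \<subseteq> U" "S \<noteq> {}" "F `` S \<subseteq> S"
    then obtain w where w: "w \<in> S" by blast
    have finS: "finite S" using S(1) ugraphD(1)[OF F] finite_subset by blast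
    have "card (F `` {x} \<inter> S) = deg F x" if "x \<in> S" for x
    proof -
      have "F `` {x} \<inter> S = F `` {x}" using S(3) that by blast
      then show ?thesis by (simp add: deg_def)
    qed
    then have "even (\<Sum>x\<in>S. deg F x)"
      using handshake_even[OF finS, of F] F by (simp add: ugraph_def)
    moreover have "(\<Sum>x\<in>S. deg F x) + card (S \<inter> {a, b}) = 2 * card S"
    proof -
      have "(\<Sum>x\<in>S. deg F x) + (\<Sum>x\<in>S. if x \<in> {a, b} then 1 else 0) = (\<Sum>x\<in>S. 2)"
        unfolding sum.distrib[symmetric]
      proof (intro sum.cong refl)
        fix x assume "x \<in> S"
        then show "deg F x + (if x \<in> {a, b} then 1 else 0) = 2" using S(1) by (intro dF) blast
      qed
      moreover have "(\<Sum>x\<in>S. if x \<in> {a, b} then 1 else 0) = (\<Sum>x\<in>S \<inter> {a, b}. 1 :: nat)"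
        by (rule sum.inter_restrict[OF finS, symmetric])
      ultimately show ?thesis by simp
    qed
    ultimately have ev: "even (card (S \<inter> {a, b}))" by (metis even_add dvd_triv_left)
    have iff: "a \<in> S \<longleftrightarrow> b \<in> S"
    proof (rule ccontr)
      assume "\<not> ?thesis"
      then have "S \<inter> {a, b} = {a} \<or> S \<inter> {a, b} = {b}" by blast
      then show False using ev by auto
    qed
    have step: "y \<in> S \<or> y = r" if "x \<in> S" "(x, y) \<in> E" for x y
    proof (cases "y = r")
      case False
      then have "(x, y) \<in> F" using that S(1) D(4) by (auto simp: F_def U_def)
      then show ?thesis using S(3) that by blast
    qed simp
    show "S = U"
    proof (cases "a \<in> S")
      case True
      then have "insert r S = V"
        using iff nr step S(1) r by (intro connD[OF E(2), of _ r]) (auto simp: U_def)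
      then show ?thesis using S(1) aU(3) by (auto simp: U_def)
    next
      case False
      have "S = V"
      proof (rule connD[OF E(2) _ w])
        fix x y assume xy: "x \<in> S" "(x, y) \<in> E"
        then have "y \<noteq> r" using nr False iff by auto
        then show "y \<in> S" using step[OF xy] by simp
      qed (use S(1) in \<open>auto simp: U_def\<close>)
      then show ?thesis using S(1) aU(3) r by auto
    qed
  qed
  moreover have "deg F a \<le> 1" using dF[OF aU(1)] by simp
  moreover have "deg F v \<le> 2" if "v \<in> U" for v using dF[OF that] by simp
  ultimately have "fdet U (\<lambda>u v. if u = v then (if u = a then 1 + 1 / 1 else 2) else if (u, v) \<in> F then - 1 else 0)
      = (real (card U) + 1) / 1"
    using aU(1) by (intro grounded_path_fdet[OF F, of a 1]) simp_all
  moreover have "fdet U (\<lambda>u v. if u = v then (if u = a then 1 + 1 / 1 else 2) else if (u, v) \<in> F then - 1 else 0)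
      = fdet U (lap E)"
    using D(1,6) d by (intro fdet_cong) (auto simp: ugraphD(1)[OF F] lap_def F_def U_def)
  moreover have "card V = Suc (card U)" unfolding U_def by (rule card.remove[OF D(1) r])
  ultimately show ?thesis by (simp add: U_def)
qed

text \<open>The determinant is the number of spanning trees, which for a unicyclic graph is the
  length of its cycle. Leaves do not affect it, and a leafless connected graph with as many edges as
  vertices is 2-regular.\<close>

lemma unicyclic_grounded_fdet:
  assumes "ugraph V E" "conn V E" "card E = 2 * card V" "r \<in> V"
  shows "fdet (V - {r}) (lap E) = 3 \<longleftrightarrow> has_triangle E"
  using assms
proof (induction "card V" arbitrary: V E r rule: less_induct)
  case less
  note E = less.prems(1,2) and r = less.prems(4) and c = less.prems(3)
  note D = ugraphD[OF E(1)]
  show ?case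
  proof (cases "\<exists>v\<in>V. deg E v = 1")
    case True
    then obtain v u where v: "v \<in> V" "E `` {v} = {u}" by (auto simp: deg_def card_1_singleton_iff)
    define V' where "V' = V - {v}"
    define E' where "E' = E - {(u, v), (v, u)}"
    note L = leaf_removal[OF E(1) v(2,1), folded V'_def E'_def]
    have only: "(w, v) \<in> E \<longleftrightarrow> w = u" "(v, w) \<in> E \<longleftrightarrow> w = u" for w using v D(5) by blast+
    have uV: "u \<in> V" "u \<noteq> v" using L(5) by (auto simp: V'_def)
    have fin: "finite (V' - {u})" "v \<notin> V' - {u}" using ugraphD(1)[OF L(1)] by (auto simp: V'_def)
    \<comment> \<open>Grounding at the neighbour \<open>u\<close> of the leaf isolates the row of
      the leaf, with diagonal entry 1, and hides the only remaining vertex whose degree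
      changes.\<close>
    have "fdet (V - {r}) (lap E) = fdet (V - {u}) (lap E)" by (rule lap_grounded_indep[OF E(1) r uV(1)])
    also have "V - {u} = insert v (V' - {u})" using v(1) uV by (auto simp: V'_def)
    also have "fdet (insert v (V' - {u})) (lap E) = lap E v v * fdet (V' - {u}) (lap E)"
      by (rule fdet_insert_zero_col[OF fin]) (use only in \<open>auto simp: lap_def V'_def\<close>)
    also have "lap E v v = 1" using v(2) D(6) by (simp add: lap_def deg_def)
    also have "fdet (V' - {u}) (lap E) = fdet (V' - {u}) (lap E')"
    proof (rule fdet_cong[OF fin(1)])
      fix a b assume ab: "a \<in> V' - {u}" "b \<in> V' - {u}"
      then have "deg E a = deg E' a" using L(9)[of a] by simp
      moreover have "(a, b) \<in> E \<longleftrightarrow> (a, b) \<in> E'" using ab by (intro L(10)) (auto simp: V'_def)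
      ultimately show "lap E a b = lap E' a b" unfolding lap_def by (simp only:)
    qed
    finally have "fdet (V - {r}) (lap E) = fdet (V' - {u}) (lap E')" by simp
    moreover have "fdet (V' - {u}) (lap E') = 3 \<longleftrightarrow> has_triangle E'"
      by (rule less.hyps) (use L(1,2,5,6,7) E(2) c in auto)
    moreover have "has_triangle E \<longleftrightarrow> has_triangle E'"
    proof
      assume "has_triangle E"
      then obtain x y z where t: "(x, y) \<in> E" "(y, z) \<in> E" "(z, x) \<in> E" by (auto simp: has_triangle_def)
      then have "x \<noteq> v" "y \<noteq> v" "z \<noteq> v" using only D(6) by metis+
      then have "(x, y) \<in> E'" "(y, z) \<in> E'" "(z, x) \<in> E'" using t L(10) by auto
      then show "has_triangle E'" by (auto simp: has_triangle_def)
    next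
      assume "has_triangle E'"
      then show "has_triangle E" unfolding has_triangle_def E'_def by blast
    qed
    ultimately show ?thesis by simp
  next
    case False
    have "card E > 0" using c r D(1) by (simp add: card_gt_0_iff) blast
    then obtain x0 y0 where xy0: "(x0, y0) \<in> E" by (metis card_gt_0_iff equals0I surj_pair)
    then have ne: "x0 \<noteq> y0" "x0 \<in> V" "y0 \<in> V" using D(3,4,6) by auto
    have ge: "2 \<le> deg E v" if v: "v \<in> V" for v
    proof -
      obtain w where "w \<in> V" "v \<noteq> w" using ne by metis
      then have "deg E v \<ge> 1" using deg_pos[OF E v] by blast
      moreover have "deg E v \<noteq> 1" using False v by blast
      ultimately show ?thesis by simp
    qed
    have "(\<Sum>v\<in>V. deg E v) = (\<Sum>v\<in>V. 2)" using sum_deg[OF E(1)] c by simp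
    then have "(\<Sum>v\<in>V. deg E v - 2) = 0" using ge by (simp add: sum_subtractf_nat)
    then have d: "deg E v = 2" if "v \<in> V" for v using that ge[OF that] D(1) by (simp add: le_antisym)
    have "card V = 3 \<longleftrightarrow> has_triangle E"
    proof
      assume V3: "card V = 3"
      have "card (E `` {r}) = 2" using d[OF r] by (simp add: deg_def)
      then obtain a b where ab: "E `` {r} = {a, b}" "a \<noteq> b" by (auto simp: card_2_iff)
      have arb: "(r, a) \<in> E" "(r, b) \<in> E" "a \<in> V" "b \<in> V" "a \<noteq> r" "b \<noteq> r" using ab(1) D(4,6) by blast+
      have "{r, a, b} = V" using arb ab(2) r V3 D(1) by (intro card_subset_eq) auto
      then have "E `` {a} \<subseteq> {r, b}" using D(4,6) by blast
      moreover have "card (E `` {a}) = card {r, b}" using d[OF arb(3)] arb(6) by (simp add: deg_def)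
      ultimately have "E `` {a} = {r, b}" by (intro card_subset_eq) auto
      then have "(a, b) \<in> E" by blast
      then show "has_triangle E" using arb(1,2) D(5) unfolding has_triangle_def by blast
    next
      assume "has_triangle E"
      then obtain x y z where t: "(x, y) \<in> E" "(y, z) \<in> E" "(z, x) \<in> E" by (auto simp: has_triangle_def)
      have xyz: "x \<noteq> y" "y \<noteq> z" "z \<noteq> x" "x \<in> V" "y \<in> V" "z \<in> V" using t D(3,6) by auto
      have two: "E `` {u} = {v, w}" if "u \<in> V" "(u, v) \<in> E" "(u, w) \<in> E" "v \<noteq> w" for u v w
      proof -
        have "card {v, w} = card (E `` {u})" using d[OF that(1)] that(4) by (simp add: deg_def)
        moreover have "{v, w} \<subseteq> E `` {u}" using that by blast
        ultimately show ?thesis using card_subset_eq[OF D(7), of "{v, w}" "{u}"] by simp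
      qed
      have "E `` {x} = {y, z}" "E `` {y} = {x, z}" "E `` {z} = {x, y}"
        using t xyz D(5) by (intro two; blast)+
      then have "{x, y, z} = V" using xyz by (intro connD[OF E(2), of _ x]) blast+
      then show "card V = 3" using xyz by auto
    qed
    then show ?thesis using cycle_grounded_fdet[OF E d r] by simp
  qed
qed

subsection \<open>Recovering the path lengths\<close>

text \<open>The path hangs at \<open>c\<close> by \<open>w 0\<close> and is eliminated from its free
  end. After one step the shorter path has end pivot \<open>p (m + 1)\<close> by the recurrence; the
  offset \<open>m\<close> exists for this induction. Only the last pivot reaches
  \<open>c\<close>.\<close>

lemma fdet_pendant_path:
  fixes p :: "nat \<Rightarrow> real"
  assumes p: "\<And>j. p j \<noteq> 0" "\<And>j. p (Suc j) = \<alpha> - 1 / p j"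
    and U: "finite U" "c \<in> U"
  shows "t \<ge> 1 \<Longrightarrow> inj_on w {..<t} \<Longrightarrow> w ` {..<t} \<inter> U = {} \<Longrightarrow>
    (\<And>j. j < t \<Longrightarrow> f (w j) (w j) = (if Suc j = t then p m else \<alpha>)) \<Longrightarrow>
    (\<And>i j. i < t \<Longrightarrow> j < t \<Longrightarrow> i \<noteq> j \<Longrightarrow> f (w i) (w j) = (if i = Suc j \<or> j = Suc i then 1 else 0)) \<Longrightarrow>
    (\<And>j u. j < t \<Longrightarrow> u \<in> U \<Longrightarrow> f (w j) u = (if j = 0 \<and> u = c then 1 else 0)) \<Longrightarrow>
    (\<And>j u. j < t \<Longrightarrow> u \<in> U \<Longrightarrow> f u (w j) = (if j = 0 \<and> u = c then 1 else 0)) \<Longrightarrow>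
    fdet (U \<union> w ` {..<t}) f =
      (\<Prod>j<t. p (m + j)) * fdet U (\<lambda>a b. f a b - (if a = c \<and> b = c then 1 / p (m + t - 1) else 0))"
proof (induction t arbitrary: f m)
  case 0
  then show ?case by simp
next
  case (Suc t)
  note inj = Suc.prems(2) and disj = Suc.prems(3) and diag = Suc.prems(4) and off = Suc.prems(5)
    and fw = Suc.prems(6,7)
  let ?X = "U \<union> w ` {..<t}" and ?v = "w t"
  define g where "g a b = f a b - f a ?v * f ?v b / f ?v ?v" for a b
  have fin: "finite ?X" using U by simp
  have v: "?v \<notin> ?X"
  proof -
    have "?v \<notin> w ` {..<t}"
    proof
      assume "?v \<in> w ` {..<t}"
      then obtain j where "j < t" "w t = w j" by auto
      then show False using inj_onD[OF inj, of t j] by simp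
    qed
    then show ?thesis using disj by auto
  qed
  have fv: "f ?v ?v = p m" using diag[of t] by simp
  have "U \<union> w ` {..<Suc t} = insert ?v ?X" by (auto simp: lessThan_Suc)
  then have S: "fdet (U \<union> w ` {..<Suc t}) f = p m * fdet ?X g"
    using fdet_schur[OF fin v, of f] fv p(1) by (simp add: g_def[abs_def])
  show ?case
  proof (cases "t = 0")
    case True
    have "fdet ?X g = fdet U (\<lambda>a b. f a b - (if a = c \<and> b = c then 1 / p m else 0))"
      using True U(1) fw fv by (simp, intro fdet_cong) (auto simp: g_def)
    moreover have "m + Suc t - 1 = m" using True by simp
    ultimately show ?thesis using S True by (simp only: prod.lessThan_Suc) simp
  next
    case False
    have gU: "g a b = f a b" if "a \<in> U" "b \<in> U" for a b
      using fw(2)[of t a] that False by (simp add: g_def)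
    have "fdet ?X g = (\<Prod>j<t. p (Suc m + j)) *
        fdet U (\<lambda>a b. g a b - (if a = c \<and> b = c then 1 / p (Suc m + t - 1) else 0))"
    proof (rule Suc.IH)
      show "1 \<le> t" using False by simp
      show "inj_on w {..<t}" using inj by (rule inj_on_subset) auto
      show "w ` {..<t} \<inter> U = {}" using disj unfolding lessThan_Suc by blast
      show "g (w j) (w j) = (if Suc j = t then p (Suc m) else \<alpha>)" if "j < t" for j
        using that diag[of j] off[of j t] off[of t j] by (auto simp: g_def fv p(2))
      show "g (w i) (w j) = (if i = Suc j \<or> j = Suc i then 1 else 0)" if "i < t" "j < t" "i \<noteq> j" for i j
        using that off[of i j] off[of i t] off[of t j] by (auto simp: g_def)
      show "g (w j) u = (if j = 0 \<and> u = c then 1 else 0)" if "j < t" "u \<in> U" for j u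
        using that fw(1)[of j u] fw(1)[of t u] False by (simp add: g_def)
      show "g u (w j) = (if j = 0 \<and> u = c then 1 else 0)" if "j < t" "u \<in> U" for j u
        using that fw(2)[of j u] fw(2)[of t u] False by (simp add: g_def)
    qed
    also have "fdet U (\<lambda>a b. g a b - (if a = c \<and> b = c then 1 / p (Suc m + t - 1) else 0)) =
        fdet U (\<lambda>a b. f a b - (if a = c \<and> b = c then 1 / p (m + Suc t - 1) else 0))"
      using U(1) gU by (intro fdet_cong) auto
    also have "(\<Prod>j<t. p (Suc m + j)) = (\<Prod>j<t. p (m + Suc j))" by simp
    finally show ?thesis unfolding S prod.lessThan_Suc_shift by simp
  qed
qed

text \<open>The block of \<open>a\<close> and \<open>b\<close> has determinant
  \<open>\<alpha>^2 - 1\<close>, and the entries of its inverse add up to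
  \<open>2 / (\<alpha> + 1)\<close>, which is what the elimination takes off at
  \<open>c\<close>.\<close>

lemma fdet_pendant_triangle:
  fixes \<alpha> :: real
  assumes U: "finite U" "c \<in> U" "a \<notin> U" "b \<notin> U" "a \<noteq> b" and \<alpha>: "\<alpha> > 1"
    and f: "f a a = \<alpha>" "f b b = \<alpha>" "f a b = 1" "f b a = 1"
      "\<And>u. u \<in> U \<Longrightarrow> f u a = (if u = c then 1 else 0)" "\<And>u. u \<in> U \<Longrightarrow> f a u = (if u = c then 1 else 0)"
      "\<And>u. u \<in> U \<Longrightarrow> f u b = (if u = c then 1 else 0)" "\<And>u. u \<in> U \<Longrightarrow> f b u = (if u = c then 1 else 0)"
  shows "fdet (insert a (insert b U)) f =
    (\<alpha>\<^sup>2 - 1) * fdet U (\<lambda>u v. f u v - (if u = c \<and> v = c then 2 / (\<alpha> + 1) else 0))"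
proof -
  define g where "g u v = f u v - f u a * f a v / f a a" for u v
  have gbb: "g b b = \<alpha> - 1 / \<alpha>" using f by (simp add: g_def)
  have "\<alpha> * \<alpha> > 1 * 1" using \<alpha> by (intro mult_strict_mono) auto
  then have nz: "\<alpha> - 1 / \<alpha> \<noteq> 0" "\<alpha> * \<alpha> - 1 \<noteq> 0" using \<alpha> by (auto simp: field_simps)
  have "fdet (insert a (insert b U)) f = \<alpha> * fdet (insert b U) g"
    using fdet_schur[of "insert b U" a f] U f \<alpha> by (simp add: g_def[abs_def])
  also have "fdet (insert b U) g = (\<alpha> - 1 / \<alpha>) * fdet U (\<lambda>u v. g u v - g u b * g b v / g b b)"
    using fdet_schur[of U b g] U gbb nz by simp
  also have "fdet U (\<lambda>u v. g u v - g u b * g b v / g b b) =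
      fdet U (\<lambda>u v. f u v - (if u = c \<and> v = c then 2 / (\<alpha> + 1) else 0))"
  proof (rule fdet_cong[OF U(1)])
    fix u v assume uv: "u \<in> U" "v \<in> U"
    have gub: "g u b = (if u = c then 1 - 1 / \<alpha> else 0)" "g b v = (if v = c then 1 - 1 / \<alpha> else 0)"
      "g u v = f u v - (if u = c \<and> v = c then 1 / \<alpha> else 0)"
      using uv f by (auto simp: g_def)
    have "1 / \<alpha> + (1 - 1 / \<alpha>) * (1 - 1 / \<alpha>) / (\<alpha> - 1 / \<alpha>) = 2 / (\<alpha> + 1)"
    proof -
      have 1: "1 - 1 / \<alpha> = (\<alpha> - 1) / \<alpha>" "\<alpha> - 1 / \<alpha> = (\<alpha> - 1) * (\<alpha> + 1) / \<alpha>"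
        using \<alpha> by (auto simp: field_simps)
      have "(1 - 1 / \<alpha>) * (1 - 1 / \<alpha>) / (\<alpha> - 1 / \<alpha>) = (\<alpha> - 1) / (\<alpha> * (\<alpha> + 1))"
        unfolding 1 using \<alpha> by simp
      also have "1 / \<alpha> + (\<alpha> - 1) / (\<alpha> * (\<alpha> + 1)) = 2 / (\<alpha> + 1)"
        using \<alpha> by (simp add: divide_simps)
      finally show ?thesis .
    qed
    then show "g u v - g u b * g b v / g b b = f u v - (if u = c \<and> v = c then 2 / (\<alpha> + 1) else 0)"
      unfolding gub gbb by auto
  qed
  also have "\<alpha> * ((\<alpha> - 1 / \<alpha>) * fdet U (\<lambda>u v. f u v - (if u = c \<and> v = c then 2 / (\<alpha> + 1) else 0))) =
     (\<alpha>\<^sup>2 - 1) * fdet U (\<lambda>u v. f u v - (if u = c \<and> v = c then 2 / (\<alpha> + 1) else 0))"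
    using \<alpha> by (simp add: algebra_simps power2_eq_square)
  finally show ?thesis .
qed

text \<open>The matrix \<open>x I - L\<close> of a path-friendship graph, with the entry at the center replaced by \<open>z\<close>.\<close>

definition pf_mat :: "real \<Rightarrow> real \<Rightarrow> nat \<Rightarrow> nat list \<Rightarrow> pf_vertex \<Rightarrow> pf_vertex \<Rightarrow> real" where
  "pf_mat x z s ts u v = (if u = v then
      (case u of Center \<Rightarrow> z | Tri i b \<Rightarrow> x - 2 | Pth i j \<Rightarrow> if Suc j = ts ! i then x - 1 else x - 2)
    else if (u, v) \<in> pf_arcs s ts then 1 else 0)"

lemma pf_mat_lap:
  assumes ts: "\<forall>t\<in>set ts. 1 \<le> t"
  shows "fdet (pf_verts s ts) (charmat x (lap (pf_arcs s ts))) =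
    fdet (pf_verts s ts) (pf_mat x (x - (2 * s + length ts)) s ts)"
proof (rule fdet_cong)
  note D = ugraphD[OF ugraph_pf[of s ts]]
  show "finite (pf_verts s ts)" by (rule D(1))
  fix u v assume u: "u \<in> pf_verts s ts" and "v \<in> pf_verts s ts"
  show "(if u = v then x else 0) - lap (pf_arcs s ts) u v = pf_mat x (x - (2 * s + length ts)) s ts u v"
  proof (cases "u = v")
    case False
    then show ?thesis by (simp add: lap_def pf_mat_def)
  next
    case True
    have "(u, u) \<notin> pf_arcs s ts" by (rule D(6))
    then have l: "lap (pf_arcs s ts) u u = deg (pf_arcs s ts) u" by (simp add: lap_def)
    consider "u = Center" | i b where "u = Tri i b" "i < s" | i j where "u = Pth i j" "i < length ts" "j < ts ! i"
      using u by (auto simp: pf_verts_def)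
    then show ?thesis
    proof cases
      case 1
      then show ?thesis unfolding True[symmetric] l using pf_deg(1)[OF ts, of s] by (simp add: pf_mat_def)
    next
      case (2 i b)
      then show ?thesis unfolding True[symmetric] l using pf_deg(2)[OF ts, of i s b] by (simp add: pf_mat_def)
    next
      case (3 i j)
      then show ?thesis unfolding True[symmetric] l using pf_deg(3)[OF ts 3(2,3), of s] by (auto simp: pf_mat_def)
    qed
  qed
qed

text \<open>Every triangle removed lowers the center entry by \<open>2 / (x - 1)\<close>, hence the
  free parameter \<open>z\<close>; \<open>x > 3\<close> makes the pivot \<open>x - 2\<close> exceed
  1.\<close>

lemma pf_mat_friendship:
  assumes x: "x > 3"
  shows "fdet (pf_verts s []) (pf_mat x z s []) = ((x - 2)\<^sup>2 - 1) ^ s * (z - 2 * real s / (x - 1))"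
proof (induction s arbitrary: z)
  case 0
  have "pf_verts 0 [] = {Center}" by (auto simp: pf_verts_def)
  then show ?case by (simp add: fdet_singleton pf_mat_def)
next
  case (Suc s)
  have V: "pf_verts (Suc s) [] = insert (Tri s False) (insert (Tri s True) (pf_verts s []))"
    by (auto simp: pf_verts_def less_Suc_eq)
  have "fdet (pf_verts (Suc s) []) (pf_mat x z (Suc s) []) =
    ((x - 2)\<^sup>2 - 1) * fdet (pf_verts s []) (\<lambda>u v. pf_mat x z (Suc s) [] u v -
      (if u = Center \<and> v = Center then 2 / ((x - 2) + 1) else 0))"
    unfolding V
  proof (rule fdet_pendant_triangle)
    show "finite (pf_verts s [])" by (rule ugraphD(1)[OF ugraph_pf])
  qed (use x in \<open>auto simp: pf_mat_def pf_verts_def pf_edges_def\<close>)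
  also have "fdet (pf_verts s []) (\<lambda>u v. pf_mat x z (Suc s) [] u v -
      (if u = Center \<and> v = Center then 2 / ((x - 2) + 1) else 0)) =
      fdet (pf_verts s []) (pf_mat x (z - 2 / (x - 1)) s [])"
  proof (rule fdet_cong[OF ugraphD(1)[OF ugraph_pf]])
    fix u v assume uv: "u \<in> pf_verts s []" "v \<in> pf_verts s []"
    then have "(u, v) \<in> pf_arcs (Suc s) [] \<longleftrightarrow> (u, v) \<in> pf_arcs s []"
      by (cases u; cases v) (auto simp: pf_edges_def pf_verts_def)
    then show "pf_mat x z (Suc s) [] u v - (if u = Center \<and> v = Center then 2 / ((x - 2) + 1) else 0) =
        pf_mat x (z - 2 / (x - 1)) s [] u v"
      using uv by (cases u) (auto simp: pf_mat_def pf_verts_def simp del: Un_iff)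
  qed
  also have "\<dots> = ((x - 2)\<^sup>2 - 1) ^ s * (z - 2 / (x - 1) - 2 * real s / (x - 1))" by (rule Suc.IH)
  finally show ?case by (simp add: add_divide_distrib diff_diff_eq)
qed

lemma pf_mat_fdet:
  fixes p :: "nat \<Rightarrow> real"
  assumes x: "x > 3" and p: "p 0 = x - 1" "\<And>j. p j \<noteq> 0" "\<And>j. p (Suc j) = x - 2 - 1 / p j"
  shows "\<forall>t\<in>set ts. 1 \<le> t \<Longrightarrow> fdet (pf_verts s ts) (pf_mat x z s ts) =
    (\<Prod>t\<leftarrow>ts. \<Prod>j<t. p j) * (((x - 2)\<^sup>2 - 1) ^ s * (z - (\<Sum>t\<leftarrow>ts. 1 / p (t - 1)) - 2 * real s / (x - 1)))"
proof (induction ts arbitrary: z rule: rev_induct)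
  case Nil
  then show ?case using pf_mat_friendship[OF x] by simp
next
  case (snoc t ts)
  let ?U = "pf_verts s ts" and ?w = "Pth (length ts)" and ?f = "pf_mat x z s (ts @ [t])"
  have t: "1 \<le> t" and ts: "\<forall>t\<in>set ts. 1 \<le> t" using snoc.prems by auto
  have V: "pf_verts s (ts @ [t]) = ?U \<union> ?w ` {..<t}"
    by (auto simp: pf_verts_def nth_append less_Suc_eq split: if_splits)
  have fin: "finite ?U" by (rule ugraphD(1)[OF ugraph_pf])
  have "fdet (?U \<union> ?w ` {..<t}) ?f =
      (\<Prod>j<t. p (0 + j)) * fdet ?U (\<lambda>a b. ?f a b - (if a = Center \<and> b = Center then 1 / p (0 + t - 1) else 0))"
  proof (rule fdet_pendant_path[where \<alpha> = "x - 2"])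
    show "inj_on ?w {..<t}" by (auto simp: inj_on_def)
    show "?w ` {..<t} \<inter> ?U = {}" by (auto simp: pf_verts_def)
    show "Center \<in> ?U" by (simp add: pf_verts_def)
    show "?f (?w j) (?w j) = (if Suc j = t then p 0 else x - 2)" for j
      by (simp add: pf_mat_def p(1))
    show "?f (?w i) (?w j) = (if i = Suc j \<or> j = Suc i then 1 else 0)" if "i < t" "j < t" "i \<noteq> j" for i j
      using that by (auto simp: pf_mat_def pf_edges_def nth_append)
    show "?f (?w j) u = (if j = 0 \<and> u = Center then 1 else 0)" if "j < t" "u \<in> ?U" for j u
      using that by (cases u) (auto simp: pf_mat_def pf_edges_def nth_append pf_verts_def)
    show "?f u (?w j) = (if j = 0 \<and> u = Center then 1 else 0)" if "j < t" "u \<in> ?U" for j u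
      using that by (cases u) (auto simp: pf_mat_def pf_edges_def nth_append pf_verts_def)
  qed (use p t fin in auto)
  also have "fdet ?U (\<lambda>a b. ?f a b - (if a = Center \<and> b = Center then 1 / p (0 + t - 1) else 0)) =
      fdet ?U (pf_mat x (z - 1 / p (t - 1)) s ts)"
  proof (rule fdet_cong[OF fin])
    fix a b assume ab: "a \<in> ?U" "b \<in> ?U"
    have "(a, b) \<in> pf_arcs s (ts @ [t]) \<longleftrightarrow> (a, b) \<in> pf_arcs s ts"
      using ab by (cases a; cases b) (auto simp: pf_edges_def nth_append pf_verts_def)
    then show "?f a b - (if a = Center \<and> b = Center then 1 / p (0 + t - 1) else 0) = pf_mat x (z - 1 / p (t - 1)) s ts a b"
      using ab by (cases a) (auto simp: pf_mat_def nth_append pf_verts_def simp del: Un_iff)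
  qed
  also have "\<dots> = (\<Prod>t\<leftarrow>ts. \<Prod>j<t. p j) *
     (((x - 2)\<^sup>2 - 1) ^ s * (z - 1 / p (t - 1) - (\<Sum>t\<leftarrow>ts. 1 / p (t - 1)) - 2 * real s / (x - 1)))"
    by (rule snoc.IH[OF ts])
  finally show ?case unfolding V by (simp add: algebra_simps)
qed

text \<open>
  Gaussian elimination along a path starts with the pivot \<open>x - 1\<close> and continues by
  \<open>p \<mapsto> x - 2 - 1/p\<close>; the substitution \<open>x = 2 + q + 1/q\<close> makes the pivots rational in \<open>q\<close>.
\<close>

lemma pf_lengths_identity:
  fixes q x :: real
  assumes ts: "\<forall>t\<in>set ts. 1 \<le> t" and q: "0 < q" "q < 1" and x_def: "x = 2 + q + 1 / q"
  shows "fdet (pf_verts s ts) (charmat x (lap (pf_arcs s ts))) =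
    ((x - 2)\<^sup>2 - 1) ^ s / (q ^ sum_list ts * (1 - q) ^ length ts) *
    ((\<Prod>t\<leftarrow>ts. 1 - q ^ (2 * t + 1)) *
     (x - (2 * s + length ts) - 2 * real s / (x - 1) - length ts * q + (1 - q\<^sup>2) * (\<Sum>t\<leftarrow>ts. q ^ (2 * t) / (1 - q ^ (2 * t + 1)))))"
proof -
  \<comment> \<open>With \<open>x - 2 = q + 1/q\<close>, the recurrence for
    \<open>p j = r (j + 1) / r j\<close> is linear in \<open>r\<close>; the solution with
    \<open>p 0 = x - 1\<close> is \<open>r j = q^(-j) - q^(j + 1)\<close>.\<close>
  define p where "p j = (1 - q ^ (2 * j + 3)) / (q * (1 - q ^ (2 * j + 1)))" for j
  have nz: "1 - q ^ n \<noteq> 0" if "n \<ge> 1" for n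
    using power_Suc_less_one[OF q, of "n - 1"] that by (cases n) auto
  have q0: "q \<noteq> 0" using q by simp
  have "1 / q > 1" using q by simp
  then have x3: "x > 3" unfolding x_def using q by linarith
  have pnz: "p j \<noteq> 0" for j unfolding p_def using q0 nz[of "2 * j + 3"] nz[of "2 * j + 1"] by simp
  have p0: "p 0 = x - 1"
  proof -
    have "p 0 = ((1 - q) * (1 + q + q * q)) / ((1 - q) * q)"
      by (simp add: p_def algebra_simps power3_eq_cube)
    also have "\<dots> = (1 + q + q * q) / q" using q by simp
    also have "\<dots> = x - 1" using q by (simp add: x_def add_divide_distrib)
    finally show ?thesis .
  qed
  have pS: "p (Suc j) = x - 2 - 1 / p j" for j
  proof -
    define a where "a = q ^ (2 * j + 1)"
    define D where "D = 1 - q\<^sup>2 * a"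
    have e: "2 * j + 3 = 2 + (2 * j + 1)" "2 * Suc j + 3 = 4 + (2 * j + 1)" "2 * Suc j + 1 = 2 + (2 * j + 1)" by simp_all
    have a: "q ^ (2 * j + 3) = q\<^sup>2 * a" "q ^ (2 * Suc j + 3) = q ^ 4 * a" "q ^ (2 * Suc j + 1) = q\<^sup>2 * a"
      unfolding e power_add a_def by (rule refl)+
    have n: "D \<noteq> 0" using nz[of "2 * j + 3"] unfolding a D_def by simp
    have "p (Suc j) = (1 - q ^ 4 * a) / (q * D)" unfolding p_def a D_def ..
    also have "1 - q ^ 4 * a = (q * q + 1) * D - q * q * (1 - a)"
      by (simp add: D_def algebra_simps power2_eq_square power4_eq_xxxx)
    also have "((q * q + 1) * D - q * q * (1 - a)) / (q * D) = q + 1 / q - q * (1 - a) / D"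
      using q0 n by (simp add: field_simps)
    also have "q * (1 - a) / D = 1 / p j" unfolding p_def a D_def a_def by simp
    finally show ?thesis by (simp add: x_def)
  qed
  \<comment> \<open>The ratios telescope to \<open>r t / r 0\<close>, in the notation above.\<close>
  have prod: "(\<Prod>j<t. p j) = (1 - q ^ (2 * t + 1)) / (q ^ t * (1 - q))" for t
  proof (induction t)
    case 0
    then show ?case using q by simp
  next
    case (Suc t)
    have gen: "X / B * (Y / (q * X)) = Y / (q * B)" if "X \<noteq> 0" for X Y B :: real using that by simp
    have e: "2 * Suc t + 1 = 2 * t + 3" by simp
    have "(\<Prod>j<Suc t. p j) = (1 - q ^ (2 * t + 1)) / (q ^ t * (1 - q)) * p t" using Suc by simp
    also have "\<dots> = (1 - q ^ (2 * t + 3)) / (q * (q ^ t * (1 - q)))"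
      unfolding p_def by (rule gen[OF nz]) simp
    finally show ?case unfolding e power_Suc mult.assoc .
  qed
  \<comment> \<open>Splits off \<open>q\<close>, the same for all paths, so that the length appears
    only in a term of order \<open>q ^ (2 * t)\<close>.\<close>
  have inv: "1 / p (t - 1) = q - (1 - q\<^sup>2) * (q ^ (2 * t) / (1 - q ^ (2 * t + 1)))" if "1 \<le> t" for t
  proof -
    obtain j where j: "t = Suc j" using \<open>1 \<le> t\<close> by (cases t) auto
    define a where "a = q ^ (2 * j + 1)"
    define D where "D = 1 - q\<^sup>2 * a"
    have e: "2 * t + 1 = 2 + (2 * j + 1)" "2 * t = 1 + (2 * j + 1)" "2 * j + 3 = 2 + (2 * j + 1)" "t - 1 = j"
      using j by simp_all
    have a: "q ^ (2 * t + 1) = q\<^sup>2 * a" "q ^ (2 * j + 3) = q\<^sup>2 * a"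
      unfolding e(1,3) power_add a_def by (rule refl)+
    have a2: "q ^ (2 * t) = q * a" unfolding e(2) a_def by simp
    have n: "D \<noteq> 0" using nz[of "2 * j + 3"] unfolding a D_def by simp
    have "1 / p (t - 1) = q * (1 - a) / D" unfolding e(4) p_def a D_def a_def by simp
    also have "q * (1 - a) = q * D - (1 - q\<^sup>2) * (q * a)"
      by (simp add: D_def algebra_simps)
    also have "(q * D - (1 - q\<^sup>2) * (q * a)) / D = q - (1 - q\<^sup>2) * (q * a / D)" using n by (simp add: diff_divide_distrib)
    finally show ?thesis unfolding a a2 D_def .
  qed
  have P: "(\<Prod>t\<leftarrow>us. \<Prod>j<t. p j) = (\<Prod>t\<leftarrow>us. 1 - q ^ (2 * t + 1)) / (q ^ sum_list us * (1 - q) ^ length us)" for us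
    by (induction us) (simp_all add: prod power_add mult_ac)
  have S: "(\<Sum>t\<leftarrow>us. 1 / p (t - 1)) = length us * q - (1 - q\<^sup>2) * (\<Sum>t\<leftarrow>us. q ^ (2 * t) / (1 - q ^ (2 * t + 1)))"
    if "\<forall>t\<in>set us. 1 \<le> t" for us
    using that
  proof (induction us)
    case (Cons t us)
    then have "(\<Sum>t\<leftarrow>t # us. 1 / p (t - 1)) = (q - (1 - q\<^sup>2) * (q ^ (2 * t) / (1 - q ^ (2 * t + 1)))) +
       (length us * q - (1 - q\<^sup>2) * (\<Sum>t\<leftarrow>us. q ^ (2 * t) / (1 - q ^ (2 * t + 1))))"
      using inv[of t] by simp
    then show ?case by (simp add: algebra_simps)
  qed simp
  have Z: "y - (l - m) - r = y - r - l + m" for y l m r :: real by simp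
  have W: "A / B * (M * Y) = M / B * (A * Y)" for A B M Y :: real by simp
  show ?thesis
    unfolding pf_mat_lap[OF ts] pf_mat_fdet[OF x3 p0 pnz pS ts] P S[OF ts] Z by (rule W)
qed

section \<open>Expansion in \<open>q\<close> near 0\<close>

abbreviation path_prod :: "real \<Rightarrow> nat multiset \<Rightarrow> real" where
  "path_prod q T \<equiv> prod_mset (image_mset (\<lambda>t. 1 - q ^ (2 * t + 1)) T)"

abbreviation path_sum :: "real \<Rightarrow> nat multiset \<Rightarrow> real" where
  "path_sum q T \<equiv> sum_mset (image_mset (\<lambda>t. q ^ (2 * t) / (1 - q ^ (2 * t + 1))) T)"

text \<open>Error terms are explicit cofactors \<open>h\<close> continuous at 0, which can be added
  and multiplied exactly. Their order is \<open>2 * t0 + 3\<close>: lengths above \<open>t0\<close>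
  give exponents at least that large, and a product of two deviations from 1 has order at least
  \<open>4 * t0 + 2\<close>, which is enough since \<open>t0 \<ge> 1\<close>.\<close>

lemma prod_expansion:
  assumes t0: "1 \<le> t0" and T: "\<forall>t\<in>#T. t0 \<le> t"
  shows "\<exists>h. isCont h 0 \<and> (\<forall>q. path_prod q T =
    1 - real (count T t0) * q ^ (2 * t0 + 1) + q\<^sup>2 * q ^ (2 * t0 + 1) * (h q :: real))"
  using T
proof (induction T)
  case empty
  show ?case by (intro exI[of _ "\<lambda>_. 0"]) simp
next
  case (add t T)
  then obtain h where h: "isCont h 0" "\<And>q. path_prod q T =
    1 - real (count T t0) * q ^ (2 * t0 + 1) + q\<^sup>2 * q ^ (2 * t0 + 1) * h q" by auto
  let ?a = "real (count T t0)"
  show ?case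
  proof (cases "t = t0")
    case True
    have v: "(q::real) ^ (2 * t0 + 1) = q\<^sup>2 * q ^ (2 * t0 - 1)" for q
    proof -
      have e: "2 * t0 + 1 = 2 + (2 * t0 - 1)" using t0 by simp
      show ?thesis by (subst e) (rule power_add)
    qed
    show ?thesis
    proof (intro exI[of _ "\<lambda>q. ?a * q ^ (2 * t0 - 1) + h q * (1 - q ^ (2 * t0 + 1))"] conjI allI)
      show "isCont (\<lambda>q. ?a * q ^ (2 * t0 - 1) + h q * (1 - q ^ (2 * t0 + 1))) 0"
        by (intro continuous_intros h(1))
      fix q :: real
      show "path_prod q (add_mset t T) =
          1 - real (count (add_mset t T) t0) * q ^ (2 * t0 + 1) +
          q\<^sup>2 * q ^ (2 * t0 + 1) * (?a * q ^ (2 * t0 - 1) + h q * (1 - q ^ (2 * t0 + 1)))"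
      proof -
        have gen: "(1 - u) * (1 - a * u + k * u * g) = 1 - (a + 1) * u + k * u * (a * w + g * (1 - u))"
          if "u = k * w" for u a k g w :: real
        proof -
          have "(1 - u) * (1 - a * u + k * u * g) - (1 - (a + 1) * u + k * u * (a * w + g * (1 - u))) = a * u * (u - k * w)"
            by (simp add: algebra_simps)
          then show ?thesis using that by simp
        qed
        have "path_prod q (add_mset t T) =
            (1 - q ^ (2 * t0 + 1)) * path_prod q T" using True by simp
        also have "\<dots> = 1 - (?a + 1) * q ^ (2 * t0 + 1) +
            q\<^sup>2 * q ^ (2 * t0 + 1) * (?a * q ^ (2 * t0 - 1) + h q * (1 - q ^ (2 * t0 + 1)))"
          unfolding h(2) by (rule gen[OF v])
        also have "?a + 1 = real (count (add_mset t T) t0)" using True by simp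
        finally show ?thesis .
      qed
    qed
  next
    case False
    then have lt: "t0 < t" using add.prems by auto
    define r where "r = 2 * (t - t0 - 1)"
    have v: "(q::real) ^ (2 * t + 1) = q\<^sup>2 * q ^ (2 * t0 + 1) * q ^ r" for q
    proof -
      have e: "2 * t + 1 = 2 + (2 * t0 + 1) + r" using lt by (simp add: r_def)
      show ?thesis by (subst e) (simp only: power_add)
    qed
    let ?g = "\<lambda>q. h q - q ^ r * (1 - ?a * q ^ (2 * t0 + 1) + q\<^sup>2 * q ^ (2 * t0 + 1) * h q)"
    show ?thesis
    proof (intro exI[of _ ?g] conjI allI)
      show "isCont ?g 0" by (intro continuous_intros h(1))
      fix q :: real
      have "path_prod q (add_mset t T) =
        (1 - q\<^sup>2 * q ^ (2 * t0 + 1) * q ^ r) * (1 - ?a * q ^ (2 * t0 + 1) + q\<^sup>2 * q ^ (2 * t0 + 1) * h q)"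
        unfolding h(2)[symmetric] v[symmetric] by simp
      then show "path_prod q (add_mset t T) =
          1 - real (count (add_mset t T) t0) * q ^ (2 * t0 + 1) + q\<^sup>2 * q ^ (2 * t0 + 1) * ?g q"
        using lt by (simp add: algebra_simps)
    qed
  qed
qed

text \<open>Expanding \<open>1 / (1 - q ^ (2 * t0 + 1))\<close> leaves an error of order
  \<open>4 * t0 + 1\<close>, at least \<open>2 * t0 + 2\<close>; restricting to
  \<open>0 < q < 1\<close> keeps the denominators nonzero.\<close>

lemma sum_expansion:
  assumes t0: "1 \<le> t0" and T: "\<forall>t\<in>#T. t0 \<le> t"
  shows "\<exists>h. isCont h 0 \<and> (\<forall>q. 0 < q \<longrightarrow> q < 1 \<longrightarrow> path_sum q T =
    real (count T t0) * q ^ (2 * t0) + q\<^sup>2 * q ^ (2 * t0) * (h q :: real))"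
  using T
proof (induction T)
  case empty
  show ?case by (intro exI[of _ "\<lambda>_. 0"]) simp
next
  case (add t T)
  then obtain h where h: "isCont h 0" "\<And>q. 0 < q \<Longrightarrow> q < 1 \<Longrightarrow> path_sum q T =
    real (count T t0) * q ^ (2 * t0) + q\<^sup>2 * q ^ (2 * t0) * h q" by auto
  obtain g where g: "isCont g 0" "\<And>q::real. 0 < q \<Longrightarrow> q < 1 \<Longrightarrow> q ^ (2 * t) / (1 - q ^ (2 * t + 1)) =
      (if t = t0 then 1 else 0) * q ^ (2 * t0) + q\<^sup>2 * q ^ (2 * t0) * g q"
  proof (cases "t = t0")
    case True
    have v: "(q::real) ^ (2 * t0 + 1) = q\<^sup>2 * q ^ (2 * t0 - 1)" for q
    proof -
      have e: "2 * t0 + 1 = 2 + (2 * t0 - 1)" using t0 by simp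
      show ?thesis by (subst e) (rule power_add)
    qed
    have gen: "X / (1 - u) = X + k * X * (w / (1 - u))" if "u = k * w" "1 - u \<noteq> 0" for X u k w :: real
    proof -
      have "X + k * X * (w / (1 - u)) = X + u * X / (1 - u)" using that(1) by simp
      also have "\<dots> = X / (1 - u)" using that(2) by (simp add: field_simps)
      finally show ?thesis by simp
    qed
    show ?thesis
    proof (rule that[of "\<lambda>q. q ^ (2 * t0 - 1) / (1 - q ^ (2 * t0 + 1))"])
      show "isCont (\<lambda>q::real. q ^ (2 * t0 - 1) / (1 - q ^ (2 * t0 + 1))) 0" by (intro continuous_intros) auto
      fix q :: real assume q: "0 < q" "q < 1"
      have "1 - q ^ (2 * t0 + 1) \<noteq> 0" using power_Suc_less_one[OF q, of "2 * t0"] by simp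
      from gen[OF v this, where X = "q ^ (2 * t0)"] show "q ^ (2 * t) / (1 - q ^ (2 * t + 1)) = (if t = t0 then 1 else 0) * q ^ (2 * t0) +
          q\<^sup>2 * q ^ (2 * t0) * (q ^ (2 * t0 - 1) / (1 - q ^ (2 * t0 + 1)))"
        unfolding True by (simp only: if_True mult_1_left simp_thms)
    qed
  next
    case False
    then have lt: "t0 < t" using add.prems by auto
    define r where "r = 2 * (t - t0 - 1)"
    have v: "(q::real) ^ (2 * t) = q\<^sup>2 * q ^ (2 * t0) * q ^ r" for q
    proof -
      have e: "2 * t = 2 + 2 * t0 + r" using lt by (simp add: r_def)
      show ?thesis by (subst e) (simp only: power_add)
    qed
    show ?thesis
    proof (rule that[of "\<lambda>q. q ^ r / (1 - q ^ (2 * t + 1))"])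
      show "isCont (\<lambda>q::real. q ^ r / (1 - q ^ (2 * t + 1))) 0" by (intro continuous_intros) auto
      show "q ^ (2 * t) / (1 - q ^ (2 * t + 1)) = (if t = t0 then 1 else 0) * q ^ (2 * t0) +
          q\<^sup>2 * q ^ (2 * t0) * (q ^ r / (1 - q ^ (2 * t + 1)))" for q :: real
        unfolding times_divide_eq_right v[symmetric] using False by (simp only: if_False mult_zero_left add_0_left)
    qed
  qed
  show ?case
  proof (intro exI[of _ "\<lambda>q. g q + h q"] conjI allI impI)
    show "isCont (\<lambda>q. g q + h q) 0" by (intro continuous_intros g(1) h(1))
    fix q :: real assume q: "0 < q" "q < 1"
    show "path_sum q (add_mset t T) =
      real (count (add_mset t T) t0) * q ^ (2 * t0) + q\<^sup>2 * q ^ (2 * t0) * (g q + h q)"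
    proof -
      have "path_sum q (add_mset t T) =
        q ^ (2 * t) / (1 - q ^ (2 * t + 1)) + path_sum q T"
        by simp
      then show ?thesis unfolding g(2)[OF q] h(2)[OF q] by (cases "t = t0") (simp_all add: algebra_simps)
    qed
  qed
qed

text \<open>
  Here \<open>t0\<close> is the shortest path length at which the two graphs differ. Its terms of order \<open>q ^ (2 * t0)\<close>
  cancel; the next order has the coefficient \<open>count T t0 * (\<Delta> - 2)\<close>, where \<open>\<Delta> = 2 * s + k\<close>.
\<close>

lemma lengths_asym:
  fixes s k :: nat
  assumes C: "\<forall>t\<in>#C. 1 \<le> t" and t0: "1 \<le> t0" "t0 \<in># T" "\<forall>t\<in>#T. t0 \<le> t" "\<forall>t\<in>#T'. t0 < t"
    and D: "2 * s + k \<ge> 3"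
    and id: "\<And>q::real. 0 < q \<Longrightarrow> q < 1 \<Longrightarrow>
      path_prod q T *
      ((2 + q + 1 / q) - (2 * s + k) - 2 * real s / ((2 + q + 1 / q) - 1) - k * q
       + (1 - q\<^sup>2) * path_sum q (C + T)) =
      path_prod q T' *
      ((2 + q + 1 / q) - (2 * s + k) - 2 * real s / ((2 + q + 1 / q) - 1) - k * q
       + (1 - q\<^sup>2) * path_sum q (C + T'))"
  shows False
proof -
  let ?A = "\<lambda>T q. path_prod q T :: real"
  let ?S = "\<lambda>T q. path_sum q T :: real"
  define a where "a = real (count T t0)"
  define d where "d = real (2 * s + k)"
  have a: "a \<noteq> 0" using t0(2) by (simp add: a_def)
  have c0: "count T' t0 = 0" using t0(4) by (auto simp: count_eq_zero_iff)
  have T': "\<forall>t\<in>#T'. t0 \<le> t" using t0(4) by auto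
  obtain h1 where h1: "isCont h1 0" "\<And>q. ?A T q = 1 - a * q ^ (2 * t0 + 1) + q\<^sup>2 * q ^ (2 * t0 + 1) * h1 q"
    using prod_expansion[OF t0(1,3)] by (auto simp: a_def)
  obtain h1' where h1': "isCont h1' 0" "\<And>q. ?A T' q = 1 + q\<^sup>2 * q ^ (2 * t0 + 1) * h1' q"
    using prod_expansion[OF t0(1) T'] by (auto simp: c0)
  obtain h2 where h2: "isCont h2 0" "\<And>q. 0 < q \<Longrightarrow> q < 1 \<Longrightarrow> ?S T q = a * q ^ (2 * t0) + q\<^sup>2 * q ^ (2 * t0) * h2 q"
    using sum_expansion[OF t0(1,3)] by (auto simp: a_def)
  obtain h2' where h2': "isCont h2' 0" "\<And>q. 0 < q \<Longrightarrow> q < 1 \<Longrightarrow> ?S T' q = q\<^sup>2 * q ^ (2 * t0) * h2' q"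
    using sum_expansion[OF t0(1) T'] by (auto simp: c0)
  obtain hC where hC: "isCont hC 0" "\<And>q. 0 < q \<Longrightarrow> q < 1 \<Longrightarrow> ?S C q = real (count C 1) * q\<^sup>2 + q\<^sup>2 * q\<^sup>2 * hC q"
    using sum_expansion[OF _ C] by auto
  \<comment> \<open>Everything is multiplied by \<open>q\<close> to clear \<open>1 / q\<close>.
    \<open>L\<close> below is \<open>q\<close> times the part of the bracket shared by both sides,
    the sum over \<open>C\<close> included; \<open>l\<close> collects its terms from order 2
    on.\<close>
  define l where "l q = 1 - real k - 2 * real s / (1 + q + q\<^sup>2) + q * (1 - q\<^sup>2) * (real (count C 1) + q\<^sup>2 * hC q)" for q
  define L where "L q = 1 + (2 - d) * q + q\<^sup>2 * l q" for q
  \<comment> \<open>Chosen so that \<open>q ^ (2 * t0 + 1) = q^2 * v q\<close>; the natural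
    subtraction is exact as \<open>t0 \<ge> 1\<close>.\<close>
  define v where "v q = q ^ (2 * t0 - 1)" for q :: real
  define AT where "AT q = 1 - a * (q\<^sup>2 * v q) + q\<^sup>2 * (q\<^sup>2 * v q) * h1 q" for q
  define AT' where "AT' q = 1 + q\<^sup>2 * (q\<^sup>2 * v q) * h1' q" for q
  define h3 where "h3 q = (1 - q\<^sup>2) * h2 q - a" for q
  define h3' where "h3' q = (1 - q\<^sup>2) * h2' q" for q
  define R where "R q = - a * l q + a * (- a * v q + (q\<^sup>2 * v q) * h1 q) + L q * (h1 q - h1' q) + AT q * h3 q - AT' q * h3' q" for q
  have u: "q ^ (2 * t0 + 1) = q\<^sup>2 * v q" "q * q ^ (2 * t0) = q\<^sup>2 * v q" for q
    using t0(1) by (simp_all add: v_def power_add[symmetric] flip: power_Suc)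
  have cl: "isCont l 0" unfolding l_def by (intro continuous_intros hC(1)) auto
  have cv: "isCont v 0" unfolding v_def by (intro continuous_intros)
  have "isCont R 0" unfolding R_def L_def AT_def AT'_def h3_def h3'_def
    by (intro continuous_intros cl cv h1(1) h1'(1) h2(1) h2'(1))
  then have cont: "isCont (\<lambda>q. a * (d - 2) + q * R q) 0" by (intro continuous_intros)
  have zero: "a * (d - 2) + q * R q = 0" if q: "0 < q" "q < 1" for q
  proof -
    let ?K = "(2 + q + 1 / q) - (2 * s + k) - 2 * real s / ((2 + q + 1 / q) - 1) - k * q"
    have pos: "1 + q + q\<^sup>2 > 0" using q by (simp add: add_pos_pos)
    have "(2 + q + 1 / q) - 1 = (1 + q + q\<^sup>2) / q" using q by (simp add: field_simps power2_eq_square)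
    then have "2 * real s / ((2 + q + 1 / q) - 1) = 2 * real s / (1 + q + q\<^sup>2) * q" by simp
    then have K: "q * ?K = 1 + (2 - d) * q + q\<^sup>2 * (1 - real k - 2 * real s / (1 + q + q\<^sup>2))"
      using q by (simp add: d_def algebra_simps power2_eq_square)
    have SC: "q * ((1 - q\<^sup>2) * ?S C q) = q\<^sup>2 * (q * (1 - q\<^sup>2) * (real (count C 1) + q\<^sup>2 * hC q))"
      unfolding hC(2)[OF q] by (simp add: algebra_simps power2_eq_square)
    have ST: "q * ((1 - q\<^sup>2) * ?S T q) = a * (q\<^sup>2 * v q) + q\<^sup>2 * (q\<^sup>2 * v q) * h3 q"
    proof -
      have "q * ((1 - q\<^sup>2) * ?S T q) = (1 - q\<^sup>2) * (a + q\<^sup>2 * h2 q) * (q * q ^ (2 * t0))"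
        unfolding h2(2)[OF q] by (simp only: algebra_simps)
      then show ?thesis unfolding u h3_def by (simp only: algebra_simps)
    qed
    have ST': "q * ((1 - q\<^sup>2) * ?S T' q) = q\<^sup>2 * (q\<^sup>2 * v q) * h3' q"
    proof -
      have "q * ((1 - q\<^sup>2) * ?S T' q) = (1 - q\<^sup>2) * (q\<^sup>2 * h2' q) * (q * q ^ (2 * t0))"
        unfolding h2'(2)[OF q] by (simp only: algebra_simps)
      then show ?thesis unfolding u h3'_def by (simp only: algebra_simps)
    qed
    have KC: "q * ?K + q * ((1 - q\<^sup>2) * ?S C q) = L q" unfolding K SC L_def l_def by (simp only: algebra_simps)
    have A: "?A T q = AT q" "?A T' q = AT' q" unfolding h1(2) h1'(2) u AT_def AT'_def by simp_all
    have gen: "A * (q * K + q * (r * c) + q * (r * e)) = q * (A * (K + r * (c + e)))" for A K r c e :: real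
      by (simp add: algebra_simps)
    have SS: "?S (C + T) q = ?S C q + ?S T q" "?S (C + T') q = ?S C q + ?S T' q" by simp_all
    have "AT q * (q * ?K + q * ((1 - q\<^sup>2) * ?S C q) + q * ((1 - q\<^sup>2) * ?S T q)) =
        q * (?A T q * (?K + (1 - q\<^sup>2) * ?S (C + T) q))"
      unfolding A SS by (rule gen)
    also have "\<dots> = q * (?A T' q * (?K + (1 - q\<^sup>2) * ?S (C + T') q))"
      by (rule arg_cong[OF id[OF q]])
    also have "\<dots> = AT' q * (q * ?K + q * ((1 - q\<^sup>2) * ?S C q) + q * ((1 - q\<^sup>2) * ?S T' q))"
      unfolding A SS by (rule gen[symmetric])
    finally have "AT q * (L q + (a * (q\<^sup>2 * v q) + q\<^sup>2 * (q\<^sup>2 * v q) * h3 q)) = AT' q * (L q + q\<^sup>2 * (q\<^sup>2 * v q) * h3' q)"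
      unfolding KC ST ST' .
    then have "0 = L q * (AT q - AT' q) + AT q * (a * (q\<^sup>2 * v q) + q\<^sup>2 * (q\<^sup>2 * v q) * h3 q) - AT' q * (q\<^sup>2 * (q\<^sup>2 * v q) * h3' q)"
      by (simp add: algebra_simps)
    also have "AT q - AT' q = (q\<^sup>2 * v q) * (- a + q\<^sup>2 * (h1 q - h1' q))"
      unfolding AT_def AT'_def by (simp add: algebra_simps)
    \<comment> \<open>\<open>AT\<close> and \<open>L\<close> both begin with 1, so in
      \<open>a * (AT q - L q)\<close> the lowest order cancels and \<open>a * (d - 2) * q\<close>
      remains, from the linear term of \<open>L\<close>.\<close>
    also have "L q * ((q\<^sup>2 * v q) * (- a + q\<^sup>2 * (h1 q - h1' q))) + AT q * (a * (q\<^sup>2 * v q) + q\<^sup>2 * (q\<^sup>2 * v q) * h3 q)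
         - AT' q * (q\<^sup>2 * (q\<^sup>2 * v q) * h3' q) =
       (q\<^sup>2 * v q) * (a * (AT q - L q) + q\<^sup>2 * (L q * (h1 q - h1' q) + AT q * h3 q - AT' q * h3' q))"
      by (simp add: algebra_simps)
    also have "a * (AT q - L q) = a * (d - 2) * q + q\<^sup>2 * (- a * l q + a * (- a * v q + (q\<^sup>2 * v q) * h1 q))"
      unfolding AT_def L_def by (simp add: algebra_simps power2_eq_square)
    also have "(q\<^sup>2 * v q) * (a * (d - 2) * q + q\<^sup>2 * (- a * l q + a * (- a * v q + (q\<^sup>2 * v q) * h1 q)) +
        q\<^sup>2 * (L q * (h1 q - h1' q) + AT q * h3 q - AT' q * h3' q)) =
       (q\<^sup>2 * v q * q) * (a * (d - 2) + q * R q)"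
      unfolding R_def by (simp add: algebra_simps power2_eq_square)
    finally have "(q\<^sup>2 * v q * q) * (a * (d - 2) + q * R q) = 0" by simp
    moreover have "q\<^sup>2 * v q * q \<noteq> 0" using q by (simp add: v_def)
    ultimately show ?thesis by simp
  qed
  \<comment> \<open>The limit is one-sided because the identity is available only for
    \<open>0 < q < 1\<close>.\<close>
  have "((\<lambda>q. a * (d - 2) + q * R q) \<longlongrightarrow> a * (d - 2) + 0 * R 0) (at_right 0)"
    using cont unfolding isCont_def by (rule tendsto_within_subset) simp
  moreover have "eventually (\<lambda>q. a * (d - 2) + q * R q = 0) (at_right (0::real))"
    using zero by (auto simp: eventually_at_right_field intro!: exI[of _ 1])
  then have "((\<lambda>q. a * (d - 2) + q * R q) \<longlongrightarrow> 0) (at_right 0)"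
    by (rule tendsto_eventually)
  ultimately have "a * (d - 2) + 0 * R 0 = 0"
    by (intro tendsto_unique[of "at_right (0::real)"]) simp_all
  then show False using a D by (simp add: d_def)
qed

text \<open>Removing the common lengths \<open>C\<close> leaves disjoint multisets \<open>T\<close>
  and \<open>T'\<close> of equal size. The product over \<open>C\<close> cancels in the determinant
  identity, and so does the prefactor, which depends only on \<open>q\<close>, \<open>s\<close>, the
  number of paths and their total length. The smallest remaining length lies in exactly one of
  \<open>T\<close> and \<open>T'\<close>, the asymmetry that \<open>lengths_asym\<close>
  refutes.\<close>

theorem pf_lengths_unique:
  assumes ts: "\<forall>t\<in>set ts. 1 \<le> t" "\<forall>t\<in>set ts'. 1 \<le> t" and len: "length ts = length ts'"
    and sum: "sum_list ts = sum_list ts'" and D: "2 * s + length ts \<ge> 3"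
    and eq: "\<And>x. fdet (pf_verts s ts) (charmat x (lap (pf_arcs s ts))) =
      fdet (pf_verts s ts') (charmat x (lap (pf_arcs s ts')))"
  shows "mset ts = mset ts'"
proof (rule ccontr)
  assume neq: "mset ts \<noteq> mset ts'"
  let ?A = "\<lambda>T q. path_prod q T :: real"
  let ?S = "\<lambda>T q. path_sum q T :: real"
  let ?K = "\<lambda>q::real. (2 + q + 1 / q) - (2 * s + length ts) - 2 * real s / ((2 + q + 1 / q) - 1) - length ts * q"
  define C where "C = mset ts \<inter># mset ts'"
  define T where "T = mset ts - mset ts'"
  define T' where "T' = mset ts' - mset ts"
  have dec: "mset ts = C + T" "mset ts' = C + T'"
    by (auto simp: C_def T_def T'_def multiset_eq_iff)
  have disj: "count T t = 0 \<or> count T' t = 0" for t by (auto simp: T_def T'_def)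
  have "size (mset ts) = size (mset ts')" using len by simp
  then have "size T = size T'" unfolding dec by simp
  then have ne: "T \<noteq> {#}" "T' \<noteq> {#}" using neq unfolding dec by auto
  have "set ts = set_mset C \<union> set_mset T" "set ts' = set_mset C \<union> set_mset T'"
    using arg_cong[OF dec(1), of set_mset] arg_cong[OF dec(2), of set_mset] by simp_all
  then have ge1: "\<forall>t\<in>#C. 1 \<le> t" "\<forall>t\<in>#T. 1 \<le> t" "\<forall>t\<in>#T'. 1 \<le> t" using ts by auto
  have id: "?A T q * (?K q + (1 - q\<^sup>2) * ?S (C + T) q) = ?A T' q * (?K q + (1 - q\<^sup>2) * ?S (C + T') q)"
    if q: "0 < q" "q < 1" for q
  proof -
    let ?x = "2 + q + 1 / q"
    have l: "(\<Prod>t\<leftarrow>us. 1 - q ^ (2 * t + 1)) = ?A (mset us) q" "(\<Sum>t\<leftarrow>us. q ^ (2 * t) / (1 - q ^ (2 * t + 1))) = ?S (mset us) q" for us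
      by (induction us) simp_all
    define M where "M = ((?x - 2)\<^sup>2 - 1) ^ s / (q ^ sum_list ts * (1 - q) ^ length ts)"
    have "1 / q > 1" using q by simp
    then have "?x - 2 > 1" using q by linarith
    then have "(?x - 2)\<^sup>2 > 1\<^sup>2" by (intro power_strict_mono) auto
    then have M: "M \<noteq> 0" using q by (simp add: M_def)
    have nzA: "?A C q \<noteq> 0"
    proof -
      have nz: "1 - q ^ (2 * t + 1) \<noteq> 0" for t using power_Suc_less_one[OF q, of "2 * t"] by simp
      have "0 \<notin># image_mset (\<lambda>t. 1 - q ^ (2 * t + 1)) C"
      proof
        assume "0 \<in># image_mset (\<lambda>t. 1 - q ^ (2 * t + 1)) C"
        then obtain t where "0 = 1 - q ^ (2 * t + 1)" unfolding set_image_mset by (rule imageE)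
        then show False using nz[of t] by simp
      qed
      then show ?thesis by (simp only: prod_mset_zero_iff not_False_eq_True)
    qed
    have "M * (?A (C + T) q * (?K q + (1 - q\<^sup>2) * ?S (C + T) q)) =
        fdet (pf_verts s ts) (charmat ?x (lap (pf_arcs s ts)))"
      unfolding M_def dec(1)[symmetric] l[symmetric] by (rule pf_lengths_identity[OF ts(1) q refl, symmetric])
    also have "\<dots> = fdet (pf_verts s ts') (charmat ?x (lap (pf_arcs s ts')))" by (rule eq)
    also have "\<dots> = M * (?A (C + T') q * (?K q + (1 - q\<^sup>2) * ?S (C + T') q))"
      unfolding M_def dec(2)[symmetric] l[symmetric] len sum by (rule pf_lengths_identity[OF ts(2) q refl])
    finally have "?A (C + T) q * (?K q + (1 - q\<^sup>2) * ?S (C + T) q) = ?A (C + T') q * (?K q + (1 - q\<^sup>2) * ?S (C + T') q)"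
      using M by simp
    then have "?A C q * (?A T q * (?K q + (1 - q\<^sup>2) * ?S (C + T) q)) = ?A C q * (?A T' q * (?K q + (1 - q\<^sup>2) * ?S (C + T') q))"
      by (simp add: mult.assoc)
    then show ?thesis using nzA by simp
  qed
  define t0 where "t0 = Min (set_mset T \<union> set_mset T')"
  have t0: "t0 \<in># T \<or> t0 \<in># T'"
    using Min_in[of "set_mset T \<union> set_mset T'"] ne by (auto simp: t0_def)
  have le: "t0 \<le> t" if "t \<in># T \<or> t \<in># T'" for t using that by (auto simp: t0_def intro!: Min_le)
  have t01: "1 \<le> t0" using t0 ge1 by auto
  from t0 show False
  proof
    assume t: "t0 \<in># T"
    then have "t0 \<notin># T'" using disj[of t0] by (metis not_in_iff)
    then have lt: "\<forall>t\<in>#T'. t0 < t" using le by (metis order_le_less)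
    show False by (rule lengths_asym[OF ge1(1) t01 t _ lt D id]) (use le in auto)
  next
    assume t: "t0 \<in># T'"
    then have "t0 \<notin># T" using disj[of t0] by (metis not_in_iff)
    then have lt: "\<forall>t\<in>#T. t0 < t" using le by (metis order_le_less)
    show False by (rule lengths_asym[OF ge1(1) t01 t _ lt D id[symmetric]]) (use le in auto)
  qed
qed

subsection \<open>Cospectral graphs\<close>

lemma fdet_bij:
  assumes V: "finite V" and f: "bij_betw f V W" and g: "\<And>u v. u \<in> V \<Longrightarrow> v \<in> V \<Longrightarrow> g (f u) (f v) = h u v"
  shows "fdet W g = fdet V h"
proof -
  obtain vs where vs: "distinct vs" "set vs = V" using V finite_distinct_list by metis
  have "distinct (map f vs)" "set (map f vs) = W" using vs f by (auto simp: distinct_map bij_betw_def)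
  then have "fdet W g = det (fmat (map f vs) g)" by (rule fdet_eq)
  also have "fmat (map f vs) g = fmat vs h"
    using g vs(2) by (intro eq_matI) (auto simp: fmat_def)
  finally show ?thesis using fdet_eq[OF vs] by simp
qed

lemma giso_lap:
  assumes "giso f V E W F" "ugraph V E" "ugraph W F" "u \<in> V" "v \<in> V"
  shows "lap F (f u) (f v) = lap E u v"
proof -
  have "f u = f v \<longleftrightarrow> u = v" using assms(1,4,5) by (auto simp: giso_def bij_betw_def dest: inj_onD)
  moreover have "(f u, f v) \<in> F \<longleftrightarrow> (u, v) \<in> E" using assms(1,4,5) by (simp add: giso_def)
  ultimately show ?thesis using giso_deg[OF assms(1-4)] by (simp only: lap_def)
qed

lemma pf_permute:
  assumes "mset ts = mset ts'"
  shows "\<exists>f. giso f (pf_verts s ts) (pf_arcs s ts) (pf_verts s ts') (pf_arcs s ts')"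
proof -
  obtain \<pi> where \<pi>: "\<pi> permutes {..<length ts'}" "permute_list \<pi> ts' = ts"
    using mset_eq_permutation[OF assms] by blast
  have len: "length ts = length ts'" using assms by (metis size_mset)
  have lt: "\<pi> i < length ts' \<longleftrightarrow> i < length ts'" for i
    using permutes_in_image[OF \<pi>(1), of i] by simp
  have nth: "ts ! i = ts' ! \<pi> i" if "i < length ts'" for i
    using permute_list_nth[OF \<pi>(1) that] \<pi>(2) by simp
  have inj: "\<pi> i = \<pi> j \<longleftrightarrow> i = j" for i j using permutes_inj[OF \<pi>(1)] by (auto dest: injD)
  define f where "f v = (case v of Pth i j \<Rightarrow> Pth (\<pi> i) j | _ \<Rightarrow> v)" for v
  have f: "f Center = Center" "f (Tri i b) = Tri i b" "f (Pth i j) = Pth (\<pi> i) j" for i j b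
    by (simp_all add: f_def)
  have "inj_on f (pf_verts s ts)"
    by (rule inj_onI) (auto simp: f_def inj split: pf_vertex.splits)
  moreover have "f ` pf_verts s ts = pf_verts s ts'"
  proof (intro equalityI subsetI)
    fix y assume "y \<in> f ` pf_verts s ts"
    then show "y \<in> pf_verts s ts'" using lt nth len by (auto simp: pf_verts_def f)
  next
    fix y assume y: "y \<in> pf_verts s ts'"
    show "y \<in> f ` pf_verts s ts"
    proof (cases y)
      case (Pth i j)
      then have ij: "i < length ts'" "j < ts' ! i" using y by (auto simp: pf_verts_def)
      obtain i' where i': "\<pi> i' = i" using permutes_surj[OF \<pi>(1)] by (metis surjD)
      then have "i' < length ts'" using lt ij(1) by metis
      then have "Pth i' j \<in> pf_verts s ts" using nth[of i'] i' ij len by (auto simp: pf_verts_def)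
      then show ?thesis using Pth i' f(3)[of i' j] by (metis image_eqI)
    next
      case Center
      then show ?thesis using y by (intro image_eqI[of _ f Center]) (auto simp: f pf_verts_def)
    next
      case (Tri i b)
      then show ?thesis using y by (intro image_eqI[of _ f "Tri i b"]) (auto simp: f pf_verts_def)
    qed
  qed
  moreover have "(u, v) \<in> pf_edges s ts \<longleftrightarrow> (f u, f v) \<in> pf_edges s ts'" for u v
    using lt nth len inj by (cases u; cases v) (auto simp: pf_edges_def f)
  ultimately show ?thesis by (intro exI[of _ f]) (auto simp: giso_def bij_betw_def)
qed

lemma structure_from_counts:
  assumes E: "ugraph V E" "conn V E" and c: "c \<in> V" and d: "\<And>v. v \<in> V \<Longrightarrow> v \<noteq> c \<Longrightarrow> deg E v \<le> 2"
    and arcs: "card E = 2 * (card V - 1 + s)"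
    and tri: "card (closed_3_walks E) = 6 * s"
  shows "\<exists>ts f. (\<forall>t\<in>set ts. 1 \<le> t) \<and> giso f V E (pf_verts s ts) (pf_arcs s ts) \<and>
    deg E c = 2 * s + length ts \<and> card V = 1 + 2 * s + sum_list ts"
proof -
  have "card (center_triangles E c) = 2 * s" using card_triangles[OF E c d] tri by simp
  then obtain ts f where f: "\<forall>t\<in>set ts. 1 \<le> t" "giso f V E (pf_verts s ts) (pf_arcs s ts)" "f c = Center"
    using path_friendship_structure[OF E c d arcs] by blast
  have "deg E c = 2 * s + length ts"
    using giso_deg[OF f(2) E(1) ugraph_pf c] pf_deg(1)[OF f(1)] f(3) by simp
  moreover have "card V = 1 + 2 * s + sum_list ts"
    using bij_betw_same_card[OF giso_bij[OF f(2)]] pf_card_verts by simp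
  ultimately show ?thesis using f by blast
qed

text \<open>A path rooted at an inner vertex has two entries in \<open>ts\<close>, rooted at an end
  only one. Re-rooting at a vertex of degree 1, found because the average degree is below 2, brings
  both cospectral paths to the same normal form.\<close>

lemma path_structure:
  assumes E: "ugraph V E" "conn V E" and d: "\<And>v. v \<in> V \<Longrightarrow> deg E v \<le> 2" and n: "card V \<ge> 2"
    and arcs: "card E = 2 * (card V - 1)"
    and tri: "card (closed_3_walks E) = 0"
  shows "\<exists>f. giso f V E (pf_verts 0 [card V - 1]) (pf_arcs 0 [card V - 1])"
proof -
  note D = ugraphD[OF E(1)]
  have "\<exists>c\<in>V. deg E c \<le> 1"
  proof (rule ccontr)
    assume "\<not> ?thesis"
    then have "(\<Sum>v\<in>V. 2) \<le> (\<Sum>v\<in>V. deg E v)" by (intro sum_mono) auto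
    then show False using sum_deg[OF E(1)] arcs n by simp
  qed
  then obtain c where c: "c \<in> V" "deg E c \<le> 1" by blast
  have "\<exists>w\<in>V. c \<noteq> w"
  proof (rule ccontr)
    assume "\<not> ?thesis"
    then have "V \<subseteq> {c}" by auto
    then have "card V \<le> 1" using card_mono[of "{c}" V] by simp
    then show False using n by simp
  qed
  then have "deg E c = 1" using deg_pos[OF E c(1)] c(2) by force
  moreover obtain ts f where f: "giso f V E (pf_verts 0 ts) (pf_arcs 0 ts)"
    "deg E c = 2 * 0 + length ts" "card V = 1 + 2 * 0 + sum_list ts"
    using structure_from_counts[OF E c(1), of 0] d arcs tri by auto
  ultimately have "length ts = 1" by simp
  then obtain t where "ts = [t]" by (auto simp: length_Suc_conv)
  then have "ts = [card V - 1]" using f(3) by simp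
  then show ?thesis using f(1) by blast
qed

text \<open>
  Cospectral graphs agree in \<open>\<Sum>d\<close>, \<open>\<Sum>d\<^sup>2\<close> and \<open>\<Sum>d\<^sup>3 - 6t\<close> (\<open>d\<close> the degrees, \<open>t\<close> the number of triangles). In
  the basis below all vertices of degree 1 and 2 (respectively 1, 2 and 3) drop out, so that these
  sums compare only the two centers.
\<close>

definition vanish12 :: "nat \<Rightarrow> real" where "vanish12 d = (real d - 1) * (real d - 2)"

definition vanish123 :: "nat \<Rightarrow> real" where "vanish123 d = (real d - 1) * (real d - 2) * (real d - 3)"

lemma sum_vanish12:
  "(\<Sum>v\<in>X. vanish12 (g v)) = (\<Sum>v\<in>X. real (g v) ^ 2) - 3 * (\<Sum>v\<in>X. real (g v)) + 2 * card X"
proof -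
  have "(\<Sum>v\<in>X. vanish12 (g v)) = (\<Sum>v\<in>X. real (g v) ^ 2 - 3 * real (g v) + 2)"
    by (intro sum.cong refl) (simp add: vanish12_def algebra_simps power2_eq_square)
  then show ?thesis by (simp add: sum.distrib sum_subtractf sum_distrib_left)
qed

lemma sum_vanish123:
  "(\<Sum>v\<in>X. vanish123 (g v)) = (\<Sum>v\<in>X. real (g v) ^ 3) - 6 * (\<Sum>v\<in>X. real (g v) ^ 2)
    + 11 * (\<Sum>v\<in>X. real (g v)) - 6 * card X"
proof -
  have "(\<Sum>v\<in>X. vanish123 (g v)) = (\<Sum>v\<in>X. real (g v) ^ 3 - 6 * real (g v) ^ 2 + 11 * real (g v) - 6)"
    by (intro sum.cong refl) (simp add: vanish123_def algebra_simps power2_eq_square power3_eq_cube)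
  then show ?thesis by (simp add: sum.distrib sum_subtractf sum_distrib_left)
qed

lemma vanish12_less: "2 \<le> a \<Longrightarrow> a < b \<Longrightarrow> vanish12 a < vanish12 b"
  unfolding vanish12_def by (intro mult_strict_mono') auto

lemma vanish12_nonneg: "1 \<le> a \<Longrightarrow> 0 \<le> vanish12 a"
  unfolding vanish12_def by (cases "a = 1") (auto intro!: mult_nonneg_nonneg)

lemma vanish12_eq_0: "vanish12 a = 0 \<longleftrightarrow> a = 1 \<or> a = 2"
  unfolding vanish12_def by auto

lemma vanish123_small: "1 \<le> a \<Longrightarrow> a \<le> 3 \<Longrightarrow> vanish123 a = 0"
  unfolding vanish123_def by (cases "a = 1"; cases "a = 2"; cases "a = 3") auto

lemma vanish123_mono:
  assumes "1 \<le> a" "a \<le> b"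
  shows "vanish123 a \<le> vanish123 b"
proof (cases "a \<le> 3")
  case True
  have "0 \<le> vanish123 b"
  proof (cases "b \<le> 3")
    case False
    then show ?thesis unfolding vanish123_def by (intro mult_nonneg_nonneg) auto
  qed (use vanish123_small[of b] assms in auto)
  then show ?thesis using vanish123_small[of a] assms True by simp
next
  case False
  then show ?thesis unfolding vanish123_def using assms by (intro mult_mono mult_nonneg_nonneg) auto
qed

lemma vanish123_step: "vanish123 (Suc a) - vanish123 a = 3 * ((real a - 1) * (real a - 2))"
  unfolding vanish123_def by (simp add: algebra_simps)

theorem cospectral_path_friendship:
  fixes E :: "('b \<times> 'b) set"
  assumes E: "ugraph V E" and ts: "\<forall>t\<in>set ts. 1 \<le> t"
    and cs: "cospectral_dec V (lap E) e p (pf_verts s ts) (lap (pf_arcs s ts)) e' p'"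
  shows "\<exists>f. giso f V E (pf_verts s ts) (pf_arcs s ts)"
proof -
  let ?W = "pf_verts s ts" and ?F = "pf_arcs s ts" and ?\<Delta> = "2 * s + length ts"
  let ?TE = "card (closed_3_walks E)"
  let ?TF = "card (closed_3_walks ?F)"
  note D = ugraphD[OF E]
  note F = ugraph_pf[of s ts] conn_pf[OF ts, of s]
  have CW: "Center \<in> ?W" by (simp add: pf_verts_def)
  have dF: "deg ?F v \<le> 2" "1 \<le> deg ?F v" if "v \<in> ?W" "v \<noteq> Center" for v using pf_deg_le[OF ts that] by auto
  have dC: "deg ?F Center = ?\<Delta>" by (rule pf_deg(1)[OF ts])
  have finW: "finite ?W" using ugraphD(1)[OF F(1)] .
  note n = cospectral_dec_card[OF cs]
  have conn: "conn V E" by (rule cospectral_conn[OF cs E F CW])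
  have TF: "?TF = 6 * s"
    using card_triangles[OF F CW dF(1)] pf_center_triangles[OF ts, of s] by simp
  have nW: "card ?W = 1 + 2 * s + sum_list ts" by (rule pf_card_verts)
  have V0: "V \<noteq> {}" using n nW D(1) by auto

  have S1: "(\<Sum>v\<in>V. real (deg E v)) = (\<Sum>v\<in>?W. real (deg ?F v))"
    using cospectral_dec_traces(1)[OF cs] lap_traces(1)[OF E] lap_traces(1)[OF F(1)] by simp
  have S2: "(\<Sum>v\<in>V. real (deg E v) ^ 2) = (\<Sum>v\<in>?W. real (deg ?F v) ^ 2)"
    using cospectral_dec_traces(2)[OF cs] lap_traces(2)[OF E] lap_traces(2)[OF F(1)] S1 by simp
  have S3: "(\<Sum>v\<in>V. real (deg E v) ^ 3) - ?TE = (\<Sum>v\<in>?W. real (deg ?F v) ^ 3) - ?TF"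
    using cospectral_dec_traces(3)[OF cs] lap_traces(3)[OF E] lap_traces(3)[OF F(1)] S2 by simp
  have "real (card E) = real (card ?F)"
    using S1 sum_deg[OF E] sum_deg[OF F(1)] by (metis of_nat_sum)
  then have arcs: "card E = 2 * (card V - 1 + s)" using pf_card_arcs[OF ts, of s] n by simp

  have J2: "(\<Sum>v\<in>V. vanish12 (deg E v)) = vanish12 ?\<Delta>"
  proof -
    have "(\<Sum>v\<in>V. vanish12 (deg E v)) = (\<Sum>v\<in>?W. vanish12 (deg ?F v))" unfolding sum_vanish12 using S1 S2 n by simp
    also have "\<dots> = vanish12 (deg ?F Center) + (\<Sum>v\<in>?W - {Center}. vanish12 (deg ?F v))" by (rule sum.remove[OF finW CW])
    also have "(\<Sum>v\<in>?W - {Center}. vanish12 (deg ?F v)) = 0"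
    proof (rule sum.neutral, rule ballI)
      fix v assume "v \<in> ?W - {Center}"
      then have "deg ?F v \<le> 2" "1 \<le> deg ?F v" using dF[of v] by auto
      then show "vanish12 (deg ?F v) = 0" unfolding vanish12_eq_0 by linarith
    qed
    finally show ?thesis using dC by simp
  qed
  have J3: "(\<Sum>v\<in>V. vanish123 (deg E v)) - ?TE = vanish123 ?\<Delta> - 6 * s"
  proof -
    have "(\<Sum>v\<in>V. vanish123 (deg E v)) - ?TE = (\<Sum>v\<in>?W. vanish123 (deg ?F v)) - ?TF" unfolding sum_vanish123 using S1 S2 S3 n by simp
    also have "(\<Sum>v\<in>?W. vanish123 (deg ?F v)) = vanish123 (deg ?F Center) + (\<Sum>v\<in>?W - {Center}. vanish123 (deg ?F v))"
      by (rule sum.remove[OF finW CW])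
    also have "(\<Sum>v\<in>?W - {Center}. vanish123 (deg ?F v)) = 0"
    proof (rule sum.neutral, rule ballI)
      fix v assume "v \<in> ?W - {Center}"
      then have "deg ?F v \<le> 2" "1 \<le> deg ?F v" using dF[of v] by auto
      then show "vanish123 (deg ?F v) = 0" by (intro vanish123_small) linarith+
    qed
    finally show ?thesis using dC TF by simp
  qed
  have nil: "us = []" if "\<forall>t\<in>set us. 1 \<le> t" "sum_list us = 0" for us :: "nat list"
    using that by (cases us) auto

  show ?thesis
  proof (cases "card V = 1")
    case True
    then obtain c where c: "V = {c}" by (auto simp: card_1_singleton_iff)
    have s0: "s = 0" "sum_list ts = 0" using True n nW by auto
    have E0: "E = {}" using arcs True s0 D(2) by simp
    have "(closed_3_walks E) = {}" using E0 by auto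
    then have TE: "?TE = 6 * s" by (simp only: s0 card.empty mult_0_right)
    obtain ts1 f where f: "\<forall>t\<in>set ts1. 1 \<le> t" "giso f V E (pf_verts s ts1) (pf_arcs s ts1)"
        "card V = 1 + 2 * s + sum_list ts1"
      using structure_from_counts[OF E conn _ _ arcs TE, of c] c by blast
    have "ts1 = []" "ts = []" using nil[OF f(1)] nil[OF ts] f(3) True s0 by auto
    then show ?thesis using f(2) by blast
  next
    case False
    then have n2: "card V \<ge> 2" using V0 D(1) by (metis One_nat_def Suc_1 Suc_leI card_gt_0_iff le_neq_implies_less)
    have other: "\<exists>w\<in>V. v \<noteq> w" if "v \<in> V" for v
    proof (rule ccontr)
      assume "\<not> ?thesis"
      then have "V \<subseteq> {v}" by auto
      then have "card V \<le> 1" using card_mono[of "{v}" V] by simp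
      then show False using n2 by simp
    qed
    have pos: "1 \<le> deg E v" if v: "v \<in> V" for v
      using other[OF v] deg_pos[OF E conn v] by blast
    have "Max (deg E ` V) \<in> deg E ` V" using V0 D(1) by (intro Max_in) auto
    then obtain c where c: "c \<in> V" "deg E c = Max (deg E ` V)" by auto
    have le: "deg E v \<le> deg E c" if "v \<in> V" for v unfolding c(2) using D(1) that by (intro Max_ge) auto
    have le3: "deg E v \<le> 3" if v: "v \<in> V" "v \<noteq> c" for v
    proof (cases "deg E c \<ge> 4")
      case True
      show ?thesis
        by (rule cospectral_one_large_degree[OF cs E F CW dF(1) c(1) v(1) v(2)[symmetric] True])
    next
      case False
      then show ?thesis using le[OF v(1)] by linarith
    qed
    define N3 where "N3 = {v \<in> V - {c}. deg E v = 3}"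
    have finN: "finite N3" using D(1) by (simp add: N3_def)
    have A: "vanish12 (deg E c) + 2 * card N3 = vanish12 ?\<Delta>"
    proof -
      have "(\<Sum>v\<in>V - {c}. vanish12 (deg E v)) = (\<Sum>v\<in>V - {c}. if deg E v = 3 then 2 else 0)"
      proof (rule sum.cong[OF refl])
        fix v assume v: "v \<in> V - {c}"
        then have "1 \<le> deg E v" "deg E v \<le> 3" using pos le3 by auto
        then have "deg E v = 1 \<or> deg E v = 2 \<or> deg E v = 3" by linarith
        then show "vanish12 (deg E v) = (if deg E v = 3 then 2 else 0)" by (auto simp: vanish12_def)
      qed
      also have "\<dots> = (\<Sum>v\<in>N3. 2)" unfolding N3_def by (rule sum.inter_filter[symmetric]) (use D(1) in simp)
      finally show ?thesis using J2 sum.remove[OF D(1) c(1), of "\<lambda>v. vanish12 (deg E v)"] by simp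
    qed
    have B: "vanish123 (deg E c) - ?TE = vanish123 ?\<Delta> - 6 * s"
    proof -
      have "(\<Sum>v\<in>V - {c}. vanish123 (deg E v)) = 0"
      proof (rule sum.neutral, rule ballI)
        fix v assume "v \<in> V - {c}"
        then show "vanish123 (deg E v) = 0" using pos[of v] le3[of v] by (intro vanish123_small) auto
      qed
      then show ?thesis using J3 sum.remove[OF D(1) c(1), of "\<lambda>v. vanish123 (deg E v)"] by simp
    qed
    have D1: "?\<Delta> \<ge> 1"
    proof (rule ccontr)
      assume "\<not> ?thesis"
      then have "s = 0 \<and> length ts = 0" by linarith
      then show False using n2 n nW by simp
    qed
    have N3': "N3 = {}" if "deg E c \<le> 2"
    proof -
      have "deg E v \<noteq> 3" if "v \<in> V" for v using le[OF that] \<open>deg E c \<le> 2\<close> by simp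
      then show ?thesis by (auto simp: N3_def)
    qed
    \<comment> \<open>For \<open>\<Delta> \<le> 2\<close> the coefficient
      \<open>\<Delta> - 2\<close> behind the length argument is not positive, and the degree of the
      center need not distinguish it; the graphs here are paths and a single triangle.\<close>
    show ?thesis
    proof (cases "?\<Delta> \<le> 2")
      case True
      then have "vanish12 ?\<Delta> = 0" using D1 by (subst vanish12_eq_0) linarith
      then have "vanish12 (deg E c) = 0" using A vanish12_nonneg[OF pos[OF c(1)]] by linarith
      then have c2: "deg E c \<le> 2" by (auto simp: vanish12_eq_0)
      have d2: "deg E v \<le> 2" if "v \<in> V" for v using le[OF that] c2 by simp
      have "vanish123 (deg E c) = 0" "vanish123 ?\<Delta> = 0" using c2 True D1 pos[OF c(1)] by (intro vanish123_small; linarith)+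
      then have "real ?TE = real (6 * s)" using B by simp
      then have TE: "?TE = 6 * s" by (simp only: of_nat_eq_iff)
      show ?thesis
      proof (cases "s = 0")
        case s0: True
        have E0: "card E = 2 * (card V - 1)" "?TE = 0" "card ?F = 2 * (card ?W - 1)" "?TF = 0"
          using arcs TE pf_card_arcs[OF ts, of s] TF by (simp_all only: s0 mult_0_right add_0_right)
        obtain f where f: "giso f V E (pf_verts 0 [card V - 1]) (pf_arcs 0 [card V - 1])"
          using path_structure[OF E conn d2 n2 E0(1,2)] by blast
        have dW: "deg ?F v \<le> 2" if "v \<in> ?W" for v using dF(1)[OF that] dC True by (cases "v = Center") auto
        have "2 \<le> card ?W" using n2 n by simp
        then obtain g where g: "giso g ?W ?F (pf_verts 0 [card ?W - 1]) (pf_arcs 0 [card ?W - 1])"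
          using path_structure[OF F dW _ E0(3,4)] by blast
        then have "giso g ?W ?F (pf_verts 0 [card V - 1]) (pf_arcs 0 [card V - 1])" using n by simp
        from giso_trans[OF f giso_sym[OF this]] show ?thesis by blast
      next
        case False
        then have "s = 1 \<and> length ts = 0" using True by linarith
        then have s1: "s = 1" "ts = []" by simp_all
        obtain ts1 f where f: "giso f V E (pf_verts s ts1) (pf_arcs s ts1)" "deg E c = 2 * s + length ts1"
          using structure_from_counts[OF E conn c(1) d2 arcs TE] by blast
        then have "ts1 = []" using c2 s1 by simp
        then show ?thesis using f(1) s1 by blast
      qed
    next
      case False
      then have D3: "?\<Delta> \<ge> 3" by simp
      have le\<Delta>: "deg E c \<le> ?\<Delta>"
      proof (rule ccontr)
        assume "\<not> ?thesis"
        then have "vanish12 ?\<Delta> < vanish12 (deg E c)" using D3 by (intro vanish12_less) auto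
        then show False using A by simp
      qed
      show ?thesis
      proof (cases "deg E c = ?\<Delta>")
        case eq: True
        then have "N3 = {}" using A finN by simp
        have d2: "deg E v \<le> 2" if "v \<in> V" "v \<noteq> c" for v
        proof -
          have "deg E v \<noteq> 3" using \<open>N3 = {}\<close> that by (auto simp: N3_def)
          then show ?thesis using le3[OF that] by linarith
        qed
        have "real ?TE = real (6 * s)" using B eq by simp
        then have TE: "?TE = 6 * s" by (simp only: of_nat_eq_iff)
        obtain ts1 f where f: "\<forall>t\<in>set ts1. 1 \<le> t" "giso f V E (pf_verts s ts1) (pf_arcs s ts1)"
            "deg E c = 2 * s + length ts1" "card V = 1 + 2 * s + sum_list ts1"
          using structure_from_counts[OF E conn c(1) d2 arcs TE] by blast
        have "mset ts1 = mset ts"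
        proof (rule pf_lengths_unique[OF f(1) ts])
          show "length ts1 = length ts" using f(3) eq by simp
          then show "2 * s + length ts1 \<ge> 3" using D3 by simp
          show "sum_list ts1 = sum_list ts" using f(4) n nW by simp
          fix x :: real
          have "fdet (pf_verts s ts1) (charmat x (lap (pf_arcs s ts1))) =
              fdet V (charmat x (lap E))"
          proof (rule fdet_bij[OF D(1) giso_bij[OF f(2)]])
            fix u v assume uv: "u \<in> V" "v \<in> V"
            have "f u = f v \<longleftrightarrow> u = v" using giso_bij[OF f(2)] uv by (auto simp: bij_betw_def dest: inj_onD)
            then show "(if f u = f v then x else 0) - lap (pf_arcs s ts1) (f u) (f v) = (if u = v then x else 0) - lap E u v"
              using giso_lap[OF f(2) E ugraph_pf uv] by simp
          qed
          also have "\<dots> = fdet ?W (charmat x (lap ?F))"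
            by (rule cospectral_dec_fdet[OF cs])
          finally show "fdet (pf_verts s ts1) (charmat x (lap (pf_arcs s ts1))) =
            fdet ?W (charmat x (lap ?F))" .
        qed
        then obtain g where "giso g (pf_verts s ts1) (pf_arcs s ts1) ?W ?F" using pf_permute by blast
        from giso_trans[OF f(2) this] show ?thesis by blast
      next
        case neq: False
        have c3: "deg E c \<ge> 3"
        proof (rule ccontr)
          assume "\<not> ?thesis"
          then have "deg E c \<le> 2" by simp
          then have "N3 = {}" "vanish12 (deg E c) = 0" using N3' pos[OF c(1)] by (auto simp: vanish12_eq_0)
          then have "vanish12 ?\<Delta> = 0" using A by simp
          then show False using D3 by (auto simp: vanish12_eq_0)
        qed
        have lt: "deg E c < ?\<Delta>" using le\<Delta> neq by simp
        then obtain m where m: "?\<Delta> = Suc m" "deg E c \<le> m" 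
        proof (cases "?\<Delta>")
          case (Suc m)
          then show ?thesis using lt that[of m] by simp
        qed simp
        \<comment> \<open>A smaller center lowers the cubic sum by at least
          \<open>vanish123 (m + 1) - vanish123 m = 3 * (m - 1) * (m - 2)\<close>. Only missing
          triangles can balance this, by at most \<open>6 * s \<le> 3 * (m + 1)\<close>, which
          leaves \<open>m \<le> 3\<close>.\<close>
        have "vanish123 (deg E c) \<le> vanish123 m" using pos[OF c(1)] m(2) by (rule vanish123_mono)
        moreover have "0 \<le> real ?TE" by simp
        ultimately have "vanish123 (Suc m) - vanish123 m \<le> 6 * real s" using B m(1) by simp
        then have "3 * ((real m - 1) * (real m - 2)) \<le> 6 * real s" unfolding vanish123_step .
        also have "6 * real s \<le> 3 * (real m + 1)"
        proof -
          have "2 * s \<le> Suc m" using m(1) by simp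
          then have "real (2 * s) \<le> real (Suc m)" by (simp only: of_nat_le_iff)
          then show ?thesis by simp
        qed
        finally have bound: "(real m - 1) * (real m - 2) \<le> real m + 1" by (rule mult_left_le_imp_le) simp
        have "m \<le> 3"
        proof (rule ccontr)
          assume "\<not> ?thesis"
          then have m4: "real m \<ge> 4" by simp
          then have "(real m - 1) * 2 \<le> (real m - 1) * (real m - 2)" by (intro mult_left_mono) auto
          from order_trans[OF this bound] show False using m4 by (simp add: left_diff_distrib)
        qed
        then have m3: "m = 3" "deg E c = 3" using m(2) c3 by auto
        then have \<Delta>4: "?\<Delta> = 4" using m(1) by simp
        have f34: "vanish123 3 = 0" "vanish123 4 = 6" "vanish12 3 = 2" "vanish12 4 = 6" by (simp_all add: vanish123_def vanish12_def)
        \<comment> \<open>The cubic sums differ by \<open>vanish123 4 - vanish123 3 = 6\<close>, the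
          weight of one triangle.\<close>
        have TE6: "real ?TE = 6 * real s - 6" using B unfolding m3(2) \<Delta>4 f34 by simp
        then have "s \<ge> 1" using of_nat_0_le_iff[of ?TE, where 'a = real] by linarith
        then have "s = 1 \<and> length ts = 2 \<or> s = 2 \<and> length ts = 0" using \<Delta>4 by presburger
        then consider "s = 1" "length ts = 2" | "s = 2" "ts = []" by auto
        then have False
        proof cases
          case 1
          have cE: "card E = 2 * card V" "card ?F = 2 * card ?W"
            using arcs pf_card_arcs[OF ts, of s] 1 n nW by auto
          have "(Center, Tri 0 False) \<in> ?F" "(Tri 0 False, Tri 0 True) \<in> ?F" "(Tri 0 True, Center) \<in> ?F"
            using 1 by (auto simp: pf_edges_def)
          then have "has_triangle ?F" unfolding has_triangle_def by blast
          then have "fdet (?W - {Center}) (lap ?F) = 3"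
            using unicyclic_grounded_fdet[OF F cE(2) CW] by simp
          moreover have "fdet (V - {c}) (lap E) = fdet (?W - {Center}) (lap ?F)"
            by (rule cospectral_dec_grounded_fdet[OF cs c(1) CW])
              (use lap_sym[OF E] lap_sym[OF F(1)] lap_row_sum[OF E] lap_row_sum[OF F(1)] in auto)
          ultimately have "has_triangle E" using unicyclic_grounded_fdet[OF E conn cE(1) c(1)] by simp
          then obtain u v w where t: "(u, v) \<in> E" "(v, w) \<in> E" "(w, u) \<in> E" by (auto simp: has_triangle_def)
          have "(closed_3_walks E) \<subseteq> V \<times> V \<times> V" using D(3,4) by auto
          then have "finite (closed_3_walks E)"
            by (rule finite_subset) (use D(1) in simp)
          then have "?TE \<noteq> 0" using t by (simp only: card_eq_0_iff) blast
          moreover have "real ?TE = 0" using TE6 unfolding 1(1) by linarith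
          ultimately show False by (simp only: of_nat_eq_0_iff)
        next
          case 2
          have n5: "card V = 5" "card ?W = 5" using n nW 2 by auto
          \<comment> \<open>Without a leaf all degrees are 2 or 3, where
            \<open>vanish12 d = 2 * d - 4\<close> is linear; the sum would be
            \<open>2 * 12 - 4 * 5 = 4\<close> instead of \<open>vanish12 4 = 6\<close>.\<close>
          have "\<exists>l\<in>V. deg E l = 1"
          proof (rule ccontr)
            assume neg: "\<not> ?thesis"
            have "vanish12 (deg E v) = 2 * real (deg E v) - 4" if v: "v \<in> V" for v
            proof -
              have "deg E v \<noteq> 1" using neg v by blast
              then have "deg E v = 2 \<or> deg E v = 3" using pos[OF v] le[OF v] m3(2) by linarith
              then show ?thesis by (auto simp: vanish12_def)
            qed
            then have "(\<Sum>v\<in>V. vanish12 (deg E v)) = (\<Sum>v\<in>V. 2 * real (deg E v) - 4)" by (intro sum.cong) auto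
            also have "\<dots> = 2 * (\<Sum>v\<in>V. real (deg E v)) - 4 * card V" by (simp add: sum_subtractf sum_distrib_left)
            also have "(\<Sum>v\<in>V. real (deg E v)) = card E" using sum_deg[OF E] by (metis of_nat_sum)
            also have "card E = 12" using arcs n5 2 by simp
            finally show False using J2 n5 unfolding \<Delta>4 f34 by simp
          qed
          then obtain l b where l: "l \<in> V" "E `` {l} = {b}" by (auto simp: deg_def card_1_singleton_iff)
          have bV: "b \<in> V" using l(2) D(4) by blast
          \<comment> \<open>The maximal degree 3 leaves no vertex adjacent to all four others;
            together with the leaf this excludes 5 as an eigenvalue.\<close>
          have b: "deg E b < card V - 1" using le[OF bV] m3(2) n5 by simp
          have dom: "(v, Center) \<in> ?F" if "v \<in> ?W" "v \<noteq> Center" for v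
            using that 2 by (auto simp: pf_verts_def pf_edges_def)
          let ?x = "\<lambda>v. (if v = Center then real (card ?W) else 0) - 1"
          have x: "real (card ?W) * sqnorm ?W ?x \<le> qform ?W (lap ?F) ?x"
            using dominating_vertex_qform[OF F(1) CW dom] by simp
          obtain y where y: "\<exists>w\<in>V. y w \<noteq> 0" "real (card ?W) * sqnorm V y \<le> qform V (lap E) y"
            using cospectral_dec_transfer_line[OF cospectral_dec_sym[OF cs] CW _ x] n5 by auto
          then show False using qform_lt_order[OF E l b] n by auto
        qed
        then show ?thesis ..
      qed
    qed
  qed
qed

section \<open>Translation to pair graphs, their spectra and isomorphisms\<close>

lemma ugraph_pair_graph:
  assumes "pair_graph G"
  shows "ugraph (pverts G) (parcs G)"
proof -
  interpret pair_graph G by fact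
  have "sym (parcs G)" using pair_sym_arcs by (simp add: symmetric_def)
  moreover have "irrefl (parcs G)" using pair_no_loops by (fastforce simp: irrefl_def)
  moreover have "parcs G \<subseteq> pverts G \<times> pverts G" using in_arcsD1 in_arcsD2 by auto
  ultimately show ?thesis using pair_finite_verts by (simp add: ugraph_def)
qed

lemma out_degree_eq_deg: "out_degree (with_proj G) v = deg (parcs G) v"
proof -
  have "out_arcs (with_proj G) v = Pair v ` (parcs G `` {v})" by (auto simp: out_arcs_def)
  then show ?thesis by (simp add: out_degree_def deg_def card_image inj_on_def)
qed

lemma laplacian_mat_fmat: "distinct vs \<Longrightarrow> laplacian_mat G vs = fmat vs (lap (parcs G))"
  by (rule eq_matI)
    (auto simp: laplacian_mat_def degree_mat_def adjacency_mat_def fmat_def lap_def out_degree_eq_deg nth_eq_iff_index_eq)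

lemma laplacian_spectrum_fmat:
  "distinct vs \<Longrightarrow> set vs = pverts G \<Longrightarrow> laplacian_spectrum G = proots (char_poly (fmat vs (lap (parcs G))))"
  using laplacian_spectrum_eq laplacian_mat_fmat by metis

text \<open>Isomorphisms of digraphs also carry maps of arcs, tails and heads. As tail and head are
  \<open>fst\<close> and \<open>snd\<close> on both sides, the arc map is forced by the vertex
  map.\<close>

lemma digraph_iso_imp_giso:
  assumes "digraph_iso (with_proj G) (with_proj H)" "ugraph (pverts G) (parcs G)"
  shows "\<exists>f. giso f (pverts G) (parcs G) (pverts H) (parcs H)"
proof -
  obtain h where h: "pre_digraph.digraph_isomorphism (with_proj G) h" "with_proj H = app_iso h (with_proj G)"
    using assms(1) by (auto simp: digraph_iso_def)
  let ?f = "iso_verts h"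
  have inj: "inj_on ?f (pverts G)"
    and ends: "\<And>a. a \<in> parcs G \<Longrightarrow> ?f (fst a) = iso_tail h (iso_arcs h a) \<and> ?f (snd a) = iso_head h (iso_arcs h a)"
    using h(1) by (auto simp: pre_digraph.digraph_isomorphism_def)
  have V: "pverts H = ?f ` pverts G" using arg_cong[OF h(2), of verts] by simp
  have A: "parcs H = iso_arcs h ` parcs G" using arg_cong[OF h(2), of arcs] by simp
  have t: "iso_tail h = fst" "iso_head h = snd"
    using arg_cong[OF h(2), of tail] arg_cong[OF h(2), of head] by simp_all
  have arc: "iso_arcs h a = (?f (fst a), ?f (snd a))" if "a \<in> parcs G" for a
    using ends[OF that] t by (simp add: prod_eq_iff)
  have "(u, v) \<in> parcs G \<longleftrightarrow> (?f u, ?f v) \<in> parcs H" if uv: "u \<in> pverts G" "v \<in> pverts G" for u v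
  proof
    assume "(u, v) \<in> parcs G"
    then show "(?f u, ?f v) \<in> parcs H" unfolding A using arc[of "(u, v)"] by force
  next
    assume "(?f u, ?f v) \<in> parcs H"
    then obtain a where a: "a \<in> parcs G" "iso_arcs h a = (?f u, ?f v)" unfolding A by auto
    then have "?f (fst a) = ?f u" "?f (snd a) = ?f v" using arc[OF a(1)] by auto
    moreover have "fst a \<in> pverts G" "snd a \<in> pverts G"
      using a(1) ugraphD(3,4)[OF assms(2), of "fst a" "snd a"] by simp_all
    ultimately have "fst a = u" "snd a = v" using inj uv by (auto dest: inj_onD)
    then show "(u, v) \<in> parcs G" using a(1) by auto
  qed
  then show ?thesis using inj V by (intro exI[of _ ?f]) (simp add: giso_def bij_betw_def)
qed

lemma giso_imp_digraph_iso:
  assumes f: "giso f (pverts G) (parcs G) (pverts H) (parcs H)" and G: "pair_graph G" and H: "pair_graph H"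
  shows "digraph_iso (with_proj G) (with_proj H)"
proof -
  interpret pair_graph G by fact
  note UG = ugraph_pair_graph[OF G] and UH = ugraph_pair_graph[OF H]
  let ?h = "\<lparr>iso_verts = f, iso_arcs = map_prod f f, iso_head = snd, iso_tail = fst\<rparr>"
  have bij: "bij_betw f (pverts G) (pverts H)" by (rule giso_bij[OF f])
  have inj: "inj_on f (pverts G)" using bij by (simp add: bij_betw_def)
  have sub: "parcs G \<subseteq> pverts G \<times> pverts G" using UG by (simp add: ugraph_def)
  have "inj_on (map_prod f f) (parcs G)" using map_prod_inj_on[OF inj inj] sub inj_on_subset by blast
  moreover have "wf_digraph (with_proj G)" by unfold_locales
  ultimately have iso: "pre_digraph.digraph_isomorphism (with_proj G) ?h"
    using inj by (simp add: pre_digraph.digraph_isomorphism_def)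
  have "parcs H = map_prod f f ` parcs G"
  proof (intro equalityI subsetI)
    fix e assume e: "e \<in> parcs H"
    obtain x y where xy: "e = (x, y)" by (cases e)
    then have "x \<in> pverts H" "y \<in> pverts H" using e ugraphD(3,4)[OF UH] by blast+
    then obtain u v where uv: "u \<in> pverts G" "v \<in> pverts G" "x = f u" "y = f v"
      using bij unfolding bij_betw_def by blast
    then have "(u, v) \<in> parcs G" using f e xy by (simp add: giso_def)
    then show "e \<in> map_prod f f ` parcs G" using xy uv by force
  next
    fix e assume "e \<in> map_prod f f ` parcs G"
    then obtain u v where uv: "(u, v) \<in> parcs G" "e = (f u, f v)" by auto
    then show "e \<in> parcs H" using f ugraphD(3,4)[OF UG uv(1)] by (simp add: giso_def)
  qed
  then have "with_proj H = app_iso ?h (with_proj G)"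
    using bij by (simp add: app_iso_def with_proj_def bij_betw_def)
  then show ?thesis using iso unfolding digraph_iso_def by blast
qed

lemma laplacian_spectrum_giso:
  assumes f: "giso f (pverts G) (parcs G) (pverts H) (parcs H)"
    and G: "ugraph (pverts G) (parcs G)" and H: "ugraph (pverts H) (parcs H)"
  shows "laplacian_spectrum H = laplacian_spectrum G"
proof -
  obtain vs where vs: "distinct vs" "set vs = pverts G" using ugraphD(1)[OF G] finite_distinct_list by metis
  have ws: "distinct (map f vs)" "set (map f vs) = pverts H"
    using vs giso_bij[OF f] by (auto simp: distinct_map bij_betw_def)
  have "fmat (map f vs) (lap (parcs H)) = fmat vs (lap (parcs G))"
    using giso_lap[OF f G H, folded vs(2)] by (intro eq_matI) (auto simp: fmat_def)
  then show ?thesis using laplacian_spectrum_fmat[OF vs] laplacian_spectrum_fmat[OF ws] by simp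
qed

theorem theorem3p10:
  fixes G :: "'a pair_pre_digraph" and H :: "'b pair_pre_digraph"
  assumes "path_friendship_graph G"
    and "pair_graph H"
    and "laplacian_spectrum H = laplacian_spectrum G"
  shows "digraph_iso (with_proj H) (with_proj G)"
proof -
  have G: "pair_graph G" using assms(1) by (simp add: path_friendship_graph_def)
  obtain s ts where ts: "\<forall>t\<in>set ts. 1 \<le> t" and iso: "digraph_iso (with_proj (pf_graph s ts)) (with_proj G)"
    using assms(1) by (auto simp: path_friendship_graph_def)
  let ?P = "pf_graph s ts"
  have P: "pverts ?P = pf_verts s ts" "parcs ?P = pf_arcs s ts" by (simp_all add: pf_graph_def)
  note UP = ugraph_pf[of s ts, folded P] and UG = ugraph_pair_graph[OF G] and UH = ugraph_pair_graph[OF assms(2)]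
  obtain g where g: "giso g (pverts ?P) (parcs ?P) (pverts G) (parcs G)"
    using digraph_iso_imp_giso[OF iso UP] by blast
  have spec: "laplacian_spectrum H = laplacian_spectrum ?P"
    using laplacian_spectrum_giso[OF g UP UG] assms(3) by simp
  obtain vs where vs: "distinct vs" "set vs = pverts H" using ugraphD(1)[OF UH] finite_distinct_list by metis
  obtain ws where ws: "distinct ws" "set ws = pverts ?P" using ugraphD(1)[OF UP] finite_distinct_list by metis
  have "\<exists>e p e' p'. cospectral_dec (pverts H) (lap (parcs H)) e p (pverts ?P) (lap (parcs ?P)) e' p'"
    by (rule cospectral_dec_exists[OF vs ws lap_sym[OF UH] lap_sym[OF UP]])
      (use spec laplacian_spectrum_fmat[OF vs] laplacian_spectrum_fmat[OF ws] in simp)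
  then obtain f where "giso f (pverts H) (parcs H) (pverts ?P) (parcs ?P)"
    using cospectral_path_friendship[OF UH ts] unfolding P by blast
  from giso_trans[OF this g] show ?thesis
    by (rule giso_imp_digraph_iso[OF _ assms(2) G])
qed

end
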